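(* Let $f:\Omega_Y\to\mathbb{R}$ be square-integrable, let $L:\mathscr{G}\to\mathbb{R}$, $L(g)=\int_{\Omega_Y}f(y)g(y)\,d\mu_Y(y)$, and $$L_{x,\theta}(r)=\int_{\Omega_Y}f(y)\,(1+r(y)/2)^2\,\eta_0(x,y,\theta)\,d\mu_Y(y).$$ Consider the model in which $E[f(Y)\mid X]=E[f(Y)\mid\sigma_{\theta_0}(X)]$ (the $L$-central subspace problem). Suppose: 1. For each $x\in\Omega_X$ and each $\theta$ in a neighborhood of $\theta_0$, $L_{x,\theta}:L_2(\eta_0(x,\cdot,\theta))\to\mathbb{R}$ is continuously Fréchet differentiable in a neighborhood of $0$. Let $\tau(x,y,\theta)$ be the Riesz representation of $\dot L_{x,\theta}(0)$ and $\tau_c(x,y,\theta)=\tau(x,y,\theta)-E_\theta[\tau(X,Y,\theta)\mid X]_x$. 2. $\theta\mapsto r_0(x,\cdot,\theta)$ is Fréchet differentiable at $\theta_0$ with Fréchet derivative $\overset{\circ}{r}_0(x,\cdot,\theta_0)$. 3. With $$q_1(x,\theta_0)=E[\overset{\circ}{r}_0(X,Y,\theta_0)\,\tau_c(X,Y,\theta_0)\mid X]_x,\qquad q_2(x,\theta_0)=E[\tau_c^2(X,Y,\theta_0)\mid X]_x,$$ $$q_3(x,\theta_0)=q_1(x,\theta_0)-\frac{E_{\theta_0}[q_1(X,\theta_0)\,q_2^{-1}(X,\theta_0)\mid\sigma_{\theta_0}(X)]_x}{E[q_2^{-1}(X,\theta_0)\mid\sigma_{\theta_0}(X)]_x},\qquad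 q_4(x,\theta_0)=q_2^{-1}(x,\theta_0)\,q_3(x,\theta_0),$$ one has $q_4(\cdot,\theta_0)\in L_2(\lambda_0)$ (componentwise). Then the efficient score for $\theta$ is $S_{\mathrm{eff}}(x,y,\theta_0)=q_4(x,\theta_0)\,\tau_c(x,y,\theta_0)$, in which $$\tau_c(x,y,\theta_0)=f(y)-E_{\theta_0}[f(Y)\mid\sigma_{\theta_0}(X)]_x,$$ $$q_1(x,\theta_0)=\frac{\partial}{\partial\theta}E_\theta[f(Y)\mid\sigma_\theta(X)]_x\Big|_{\theta=\theta_0},$$ $$q_2(x,\theta_0)=E_{\theta_0}[f^2(Y)\mid X]_x-\bigl(E_{\theta_0}[f(Y)\mid\sigma_{\theta_0}(X)]_x\bigr)^2 .$$
   Context: Spaces. $(\Omega_X,\mathscr{B}_X,\mu_X)$ and $(\Omega_Y,\mathscr{B}_Y,\mu_Y)$ are $\sigma$-finite measure spaces with $\Omega_X\subseteq\mathbb{R}^d$, $\Omega_Y\subseteq\mathbb{R}$ and Borel $\sigma$-fields; $\mu=\mu_X\times\mu_Y$. $(X,Y)$ takes values in $\Omega_X\times\Omega_Y$. Model. $\Theta=\mathbb{R}^{s(d-s)}$, and $\theta\mapsto\beta(\theta)\in\mathbb{R}^{d\times s}$ is a smooth parameterization (rank $s$) of the $s$-dimensional subspaces $\mathrm{span}(\beta(\theta))$ of $\mathbb{R}^d$; $\sigma_\theta(X)$ is the $\sigma$-field generated by $\beta(\theta)^{\mathsf T}X$. $\mathscr{G}$ is a class of densities of $Y$ w.r.t.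 $\mu_Y$ containing all conditional densities in the model; $f$ is square-integrable with respect to the densities in $\mathscr{G}$. For each $\theta$, $\mathscr{M}_\theta$ is the family of joint densities $\lambda(x)\eta(x,y,\theta)$, where $\lambda\in\mathscr{L}$ is a marginal density of $X$ ($\mathscr{L}$ has no constraint) and $\eta(\cdot,\cdot,\theta)\in\mathscr{H}_\theta$ is a conditional density of $Y$ given $X$; $\mathscr{H}_\theta$ is restricted only by $$L(\eta(x,\cdot,\theta))=E_\lambda[\,L(\eta(X,\cdot,\theta))\mid\sigma_\theta(X)\,]_x\quad\text{for all }x\in\Omega_X .$$ Here $E[\cdot\mid\mathscr{A}]_x$ denotes the evaluation at $x$ of a conditional expectation. Fix $\theta_0\in\Theta$, $\lambda_0\in\mathscr{L}$ and $\eta_0$ with $\eta_0(\cdot,\cdot,\theta)\in\mathscr{H}_\theta$ for all $\theta$; put $\phi_0(x,y,\theta)=\lambda_0(x)\eta_0(x,y,\theta)$ and $\phi_0=\phi_0(\cdot,\cdot,\theta_0)$ (the true density). $E_\theta$ is expectation under $\phi_0(\cdot,\cdot,\theta)$, and $E=E_{\theta_0}$. $\mathscr{M}_0=\mathscr{M}_{\theta_0}$. $q_2^{-1}$ denotes the reciprocal of $q_2$. $L_2$ spaces. $L_2(\phi_0)=\{r:\int r^2\phi_0\,d\mu<\infty\}$ with inner product $\langle f,g\rangle=\int fg\,\phi_0\,d\mu$; $L_2(\lambda_0)$ and $L_2(\eta_0(x,\cdot,\theta))$ are defined analogously with respect to $\lambda_0\,d\mu_X$ and $\eta_0(x,\cdot,\theta)\,d\mu_Y$.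 $\dot L_{x,\theta}(0)$ is the Fréchet derivative of $L_{x,\theta}$ at $0$, a bounded linear functional on $L_2(\eta_0(x,\cdot,\theta))$. Tangent space. Let $R(\phi)=2(\phi^{1/2}-\phi_0^{1/2})/\phi_0^{1/2}$, so $R(\phi_0)=0$. A curve in $R(\mathscr{M}_0)$ through $0$ is a map $\alpha\mapsto r_\alpha\in R(\mathscr{M}_0)$, $\alpha\in[0,1)$, $r_0=0$, for which there is $\dot r_0\in L_2(\phi_0)$ with $\|r_\alpha-r_0-\dot r_0\alpha\|_{\phi_0}=o(|\alpha|)$. $\mathscr{T}_\phi$ is the closure in $L_2(\phi_0)$ of the linear span of all such $\dot r_0$ along all curves; $\mathscr{T}_\phi^\perp$ is its orthogonal complement and $\Pi(\cdot\mid\mathscr{T}_\phi^\perp)$ is the (componentwise) orthogonal projection onto it. Score. $r_0(x,y,\theta)=2[\phi_0^{1/2}(x,y,\theta)-\phi_0^{1/2}(x,y,\theta_0)]/\phi_0^{1/2}(x,y,\theta_0)$. The true score $\overset{\circ}{r}_0(x,y,\theta_0)=\partial r_0(x,y,\theta)/\partial\theta|_{\theta=\theta_0}$ is its Fréchet derivative, an $s(d-s)$-dimensional vector with components in $L_2(\phi_0)$ satisfying $\|r_0(\cdot,\cdot,\theta)-r_0(\cdot,\cdot,\theta_0)-\overset{\circ}{r}_0{}^{\mathsf T}(\theta-\theta_0)\|_{\phi_0}=o(\|\theta-\theta_0\|)$. The efficient score is $S_{\mathrm{eff}}(\cdot,\cdot,\theta_0)=\Pi(\overset{\circ}{r}_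0\mid\mathscr{T}_\phi^\perp)$.
   Formalization: The true density φ0 is assumed positive μ-almost everywhere: R(φ) and r_0 divide by its square root, and if φ0 vanishes where mass of other model densities can escape, the quotient is undefined or the efficient score formula fails. *)

theory Defs
  imports "HOL-Probability.Probability"
begin

text \<open>Elements of \<open>L\<^sub>2\<close> are represented by functions; all notions below respect almost everywhere
  equality.\<close>

definition L2_space :: "'a measure \<Rightarrow> ('a \<Rightarrow> real) set" where
  "L2_space M = {r \<in> borel_measurable M. integrable M (\<lambda>z. (r z)\<^sup>2)}"

definition L2_inner :: "'a measure \<Rightarrow> ('a \<Rightarrow> real) \<Rightarrow> ('a \<Rightarrow> real) \<Rightarrow> real" where
  "L2_inner M g h = (\<integral>z. g z * h z \<partial>M)"

definition L2_norm :: "'a measure \<Rightarrow> ('a \<Rightarrow> real) \<Rightarrow> real" where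
  "L2_norm M r = sqrt (L2_inner M r r)"

definition linear_hull :: "('a \<Rightarrow> real) set \<Rightarrow> ('a \<Rightarrow> real) set" where
  "linear_hull S = {v. \<exists>(n::nat) c u. (\<forall>i<n. u i \<in> S) \<and> v = (\<lambda>z. \<Sum>i<n. c i * u i z)}"

definition L2_closure :: "'a measure \<Rightarrow> ('a \<Rightarrow> real) set \<Rightarrow> ('a \<Rightarrow> real) set" where
  "L2_closure M S = {g \<in> L2_space M. \<forall>\<epsilon>>0. \<exists>h\<in>S. L2_norm M (\<lambda>z. g z - h z) < \<epsilon>}"

definition L2_orth_compl :: "'a measure \<Rightarrow> ('a \<Rightarrow> real) set \<Rightarrow> ('a \<Rightarrow> real) set" where
  "L2_orth_compl M T = {g \<in> L2_space M. \<forall>h\<in>T. L2_inner M g h = 0}"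

text \<open>The projection is determined only up to almost everywhere equality, hence a predicate on
  representatives \<open>p\<close>.\<close>

definition is_L2_projection ::
  "'a measure \<Rightarrow> ('a \<Rightarrow> real) set \<Rightarrow> ('a \<Rightarrow> real) \<Rightarrow> ('a \<Rightarrow> real) \<Rightarrow> bool" where
  "is_L2_projection M V r p \<longleftrightarrow>
     r \<in> L2_space M \<and> p \<in> V \<and> (\<forall>h\<in>V. L2_inner M (\<lambda>z. r z - p z) h = 0)"

definition L2_functional :: "'a measure \<Rightarrow> (('a \<Rightarrow> real) \<Rightarrow> real) \<Rightarrow> bool" where
  "L2_functional M D \<longleftrightarrow>
     (\<forall>g\<in>L2_space M. \<forall>h\<in>L2_space M. \<forall>a b.
        D (\<lambda>z. a * g z + b * h z) = a * D g + b * D h) \<and>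
     (\<exists>K. \<forall>h\<in>L2_space M. \<bar>D h\<bar> \<le> K * L2_norm M h)"

definition has_L2_derivative ::
  "'a measure \<Rightarrow> (('a \<Rightarrow> real) \<Rightarrow> real) \<Rightarrow> (('a \<Rightarrow> real) \<Rightarrow> real) \<Rightarrow> ('a \<Rightarrow> real) \<Rightarrow> bool" where
  "has_L2_derivative M \<Phi> D r \<longleftrightarrow>
     L2_functional M D \<and>
     (\<forall>\<epsilon>>0. \<exists>\<delta>>0. \<forall>h\<in>L2_space M. L2_norm M h < \<delta> \<longrightarrow>
        \<bar>\<Phi> (\<lambda>z. r z + h z) - \<Phi> r - D h\<bar> \<le> \<epsilon> * L2_norm M h)"

definition L2_C1_near_zero ::
  "'a measure \<Rightarrow> (('a \<Rightarrow> real) \<Rightarrow> real) \<Rightarrow> (('a \<Rightarrow> real) \<Rightarrow> ('a \<Rightarrow> real) \<Rightarrow> real) \<Rightarrow> bool" where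
  "L2_C1_near_zero M \<Phi> D \<longleftrightarrow>
     (\<exists>\<rho>>0. \<forall>r\<in>L2_space M. L2_norm M r < \<rho> \<longrightarrow>
        has_L2_derivative M \<Phi> (D r) r \<and>
        (\<forall>\<epsilon>>0. \<exists>\<delta>>0. \<forall>r'\<in>L2_space M.
           L2_norm M r' < \<rho> \<and> L2_norm M (\<lambda>z. r' z - r z) < \<delta> \<longrightarrow>
           (\<forall>h\<in>L2_space M. \<bar>D r' h - D r h\<bar> \<le> \<epsilon> * L2_norm M h)))"

definition is_riesz_rep ::
  "'a measure \<Rightarrow> (('a \<Rightarrow> real) \<Rightarrow> real) \<Rightarrow> ('a \<Rightarrow> real) \<Rightarrow> bool" where
  "is_riesz_rep M D \<tau> \<longleftrightarrow> \<tau> \<in> L2_space M \<and> (\<forall>h\<in>L2_space M. D h = L2_inner M \<tau> h)"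

text \<open>Frechet derivative \<open>h \<mapsto> D \<bullet> h\<close> at \<open>\<theta>\<^sub>0\<close> of the \<open>L\<^sub>2\<close>-valued map \<open>F\<close>.\<close>

definition has_L2_gradient ::
  "'a measure \<Rightarrow> (real^'p \<Rightarrow> 'a \<Rightarrow> real) \<Rightarrow> ('a \<Rightarrow> real^'p) \<Rightarrow> real^'p \<Rightarrow> bool" where
  "has_L2_gradient M F D \<theta>\<^sub>0 \<longleftrightarrow>
     (\<forall>\<theta>. F \<theta> \<in> L2_space M) \<and> (\<forall>i. (\<lambda>z. D z $ i) \<in> L2_space M) \<and>
     (\<lambda>\<theta>. L2_norm M (\<lambda>z. F \<theta> z - F \<theta>\<^sub>0 z - D z \<bullet> (\<theta> - \<theta>\<^sub>0)))
       \<in> o[at \<theta>\<^sub>0](\<lambda>\<theta>. norm (\<theta> - \<theta>\<^sub>0))"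

primrec C_k :: "nat \<Rightarrow> ('a::euclidean_space \<Rightarrow> 'b::real_normed_vector) \<Rightarrow> bool" where
  "C_k 0 g \<longleftrightarrow> continuous_on UNIV g"
| "C_k (Suc k) g \<longleftrightarrow>
     (\<forall>x. g differentiable (at x)) \<and> (\<forall>v. C_k k (\<lambda>x. frechet_derivative g (at x) v))"

definition smooth_map :: "('a::euclidean_space \<Rightarrow> 'b::real_normed_vector) \<Rightarrow> bool" where
  "smooth_map g \<longleftrightarrow> (\<forall>k. C_k k g)"

text \<open>\<^const>\<open>real_cond_exp\<close> fixes arbitrary values on null sets. A conditional expectation that is evaluated
  at points is therefore given through an arbitrary version \<open>g\<close>.\<close>

definition is_cond_exp ::
  "'a measure \<Rightarrow> 'a measure \<Rightarrow> ('a \<Rightarrow> real) \<Rightarrow> ('a \<Rightarrow> real) \<Rightarrow> bool" where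
  "is_cond_exp M F Z g \<longleftrightarrow>
     subalgebra M F \<and> integrable M Z \<and> g \<in> borel_measurable F \<and>
     (AE z in M. real_cond_exp M F Z z = g z)"

text \<open>The \<open>\<sigma>\<close>-field generated by \<open>B\<^sup>T X\<close>, first on the range of \<open>X\<close>, then (with \<open>X\<close> the first
  coordinate) on the range of \<open>(X, Y)\<close>; and the \<open>\<sigma>\<close>-field generated by \<open>X\<close> on the latter.\<close>

definition sigma_proj :: "(real^'d) measure \<Rightarrow> real^'s^'d \<Rightarrow> (real^'d) measure" where
  "sigma_proj \<mu>X B = vimage_algebra (space \<mu>X) (\<lambda>x. transpose B *v x) borel"

definition sigma_proj_joint ::
  "(real^'d) measure \<Rightarrow> real measure \<Rightarrow> real^'s^'d \<Rightarrow> ((real^'d) \<times> real) measure" where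
  "sigma_proj_joint \<mu>X \<mu>Y B =
     vimage_algebra (space \<mu>X \<times> space \<mu>Y) (\<lambda>z. transpose B *v fst z) borel"

definition sigma_X :: "(real^'d) measure \<Rightarrow> real measure \<Rightarrow> ((real^'d) \<times> real) measure" where
  "sigma_X \<mu>X \<mu>Y = vimage_algebra (space \<mu>X \<times> space \<mu>Y) fst \<mu>X"

definition densities :: "'a measure \<Rightarrow> ('a \<Rightarrow> real) set" where
  "densities M = {g \<in> borel_measurable M. (\<forall>z\<in>space M. 0 \<le> g z) \<and> (\<integral>\<^sup>+z. ennreal (g z) \<partial>M) = 1}"

text \<open>The domain of the functional \<open>L\<close>: all densities for which \<open>f\<close> is square-integrable. Taking
  the largest such class means that the conditional densities are restricted only by the
  constraint on \<open>L\<close>.\<close>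

definition sq_densities :: "real measure \<Rightarrow> (real \<Rightarrow> real) \<Rightarrow> (real \<Rightarrow> real) set" where
  "sq_densities \<mu>Y f = {g \<in> densities \<mu>Y. integrable \<mu>Y (\<lambda>y. (f y)\<^sup>2 * g y)}"

definition stat_functional :: "real measure \<Rightarrow> (real \<Rightarrow> real) \<Rightarrow> (real \<Rightarrow> real) \<Rightarrow> real" where
  "stat_functional \<mu>Y f g = (\<integral>y. f y * g y \<partial>\<mu>Y)"

text \<open>\<open>g\<close> is a version of \<open>E\<^sub>\<lambda>[L(\<eta>(X,\<cdot>)) | B\<^sup>T X]\<close> that satisfies the model constraint at every \<open>x\<close>.\<close>

definition constraint_version ::
  "(real^'d) measure \<Rightarrow> real measure \<Rightarrow> (real \<Rightarrow> real) \<Rightarrow> real^'s^'d \<Rightarrow> (real^'d \<Rightarrow> real) \<Rightarrow>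
   (real^'d \<Rightarrow> real \<Rightarrow> real) \<Rightarrow> (real^'d \<Rightarrow> real) \<Rightarrow> bool" where
  "constraint_version \<mu>X \<mu>Y f B lam \<eta> g \<longleftrightarrow>
     is_cond_exp (density \<mu>X (\<lambda>x. ennreal (lam x))) (sigma_proj \<mu>X B)
       (\<lambda>x. stat_functional \<mu>Y f (\<eta> x)) g \<and>
     (\<forall>x\<in>space \<mu>X. stat_functional \<mu>Y f (\<eta> x) = g x)"

definition cond_densities ::
  "(real^'d) measure \<Rightarrow> real measure \<Rightarrow> (real \<Rightarrow> real) \<Rightarrow> real^'s^'d \<Rightarrow> (real^'d \<Rightarrow> real) \<Rightarrow>
   (real^'d \<Rightarrow> real \<Rightarrow> real) set" where
  "cond_densities \<mu>X \<mu>Y f B lam =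
     {\<eta>. (\<lambda>(x, y). \<eta> x y) \<in> borel_measurable (\<mu>X \<Otimes>\<^sub>M \<mu>Y) \<and>
         (\<forall>x\<in>space \<mu>X. \<eta> x \<in> sq_densities \<mu>Y f) \<and>
         (\<exists>g. constraint_version \<mu>X \<mu>Y f B lam \<eta> g)}"

definition model ::
  "(real^'d) measure \<Rightarrow> real measure \<Rightarrow> (real \<Rightarrow> real) \<Rightarrow> real^'s^'d \<Rightarrow> ((real^'d) \<times> real \<Rightarrow> real) set"
  where
  "model \<mu>X \<mu>Y f B =
     {\<phi>. \<exists>lam\<in>densities \<mu>X. \<exists>\<eta>\<in>cond_densities \<mu>X \<mu>Y f B lam. \<phi> = (\<lambda>(x, y). lam x * \<eta> x y)}"

definition joint_law ::
  "(real^'d) measure \<Rightarrow> real measure \<Rightarrow> ((real^'d) \<times> real \<Rightarrow> real) \<Rightarrow> ((real^'d) \<times> real) measure" where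
  "joint_law \<mu>X \<mu>Y \<phi> = density (\<mu>X \<Otimes>\<^sub>M \<mu>Y) (\<lambda>z. ennreal (\<phi> z))"

text \<open>The functional \<open>L\<close> as a function of \<open>r\<close>, where \<open>(1 + r/2)\<^sup>2 g\<close> is the density with
  \<open>r = 2 (\<surd>((1 + r/2)\<^sup>2 g) - \<surd>g) / \<surd>g\<close>.\<close>

definition local_functional ::
  "real measure \<Rightarrow> (real \<Rightarrow> real) \<Rightarrow> (real \<Rightarrow> real) \<Rightarrow> (real \<Rightarrow> real) \<Rightarrow> real" where
  "local_functional \<mu>Y f g r = (\<integral>y. f y * (1 + r y / 2)\<^sup>2 * g y \<partial>\<mu>Y)"

definition root_ratio :: "('a \<Rightarrow> real) \<Rightarrow> ('a \<Rightarrow> real) \<Rightarrow> 'a \<Rightarrow> real" where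
  "root_ratio \<phi>\<^sub>0 \<phi> = (\<lambda>z. 2 * (sqrt (\<phi> z) - sqrt (\<phi>\<^sub>0 z)) / sqrt (\<phi>\<^sub>0 z))"

definition curve_tangents :: "'a measure \<Rightarrow> ('a \<Rightarrow> real) set \<Rightarrow> ('a \<Rightarrow> real) \<Rightarrow> ('a \<Rightarrow> real) set" where
  "curve_tangents \<mu> \<M> \<phi>\<^sub>0 =
     (let P = density \<mu> (\<lambda>z. ennreal (\<phi>\<^sub>0 z)) in
      {v \<in> L2_space P. \<exists>r :: real \<Rightarrow> 'a \<Rightarrow> real.
         (\<forall>\<alpha>\<in>{0..<1}. r \<alpha> \<in> root_ratio \<phi>\<^sub>0 ` \<M>) \<and> (AE z in P. r 0 z = 0) \<and>
         (\<lambda>\<alpha>. L2_norm P (\<lambda>z. r \<alpha> z - r 0 z - v z * \<alpha>)) \<in> o[at 0 within {0..<1}](\<lambda>\<alpha>. \<bar>\<alpha>\<bar>)})"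

definition tangent_space :: "'a measure \<Rightarrow> ('a \<Rightarrow> real) set \<Rightarrow> ('a \<Rightarrow> real) \<Rightarrow> ('a \<Rightarrow> real) set" where
  "tangent_space \<mu> \<M> \<phi>\<^sub>0 =
     L2_closure (density \<mu> (\<lambda>z. ennreal (\<phi>\<^sub>0 z))) (linear_hull (curve_tangents \<mu> \<M> \<phi>\<^sub>0))"

definition is_efficient_score ::
  "'a measure \<Rightarrow> ('a \<Rightarrow> real) set \<Rightarrow> ('a \<Rightarrow> real) \<Rightarrow> ('a \<Rightarrow> real^'p) \<Rightarrow> ('a \<Rightarrow> real^'p) \<Rightarrow> bool" where
  "is_efficient_score \<mu> \<M> \<phi>\<^sub>0 r S \<longleftrightarrow>
     (let P = density \<mu> (\<lambda>z. ennreal (\<phi>\<^sub>0 z)) in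
      \<forall>i. is_L2_projection P (L2_orth_compl P (tangent_space \<mu> \<M> \<phi>\<^sub>0)) (\<lambda>z. r z $ i) (\<lambda>z. S z $ i))"

end

theory Submission
  imports Defs
begin

text \<open>
  Condition 1 lets \<open>f r\<^sup>2\<close> be integrated for every square-integrable \<open>r\<close>, which forces \<open>f\<close> to be
  essentially bounded; hence the derivative of the functional at \<open>0\<close> is \<open>r \<mapsto> E[f r | X = x]\<close>, and
  \<open>\<tau>\<close> is \<open>f\<close>. Write \<open>m(x) = E[f(Y) | X = x]\<close>, so that \<open>\<tau>\<^sub>c = f - m\<close>.

  A tangent \<open>v\<close> has \<open>E[\<tau>\<^sub>c v | X]\<close> measurable with respect to \<open>\<sigma>\<^sub>\<theta>(X)\<close>: for bounded \<open>b(X)\<close> with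
  \<open>E[b | \<sigma>\<^sub>\<theta>(X)] = 0\<close>, the constraint makes \<open>E[b \<tau>\<^sub>c r]\<close> of the order of \<open>\<parallel>r\<parallel>\<^sup>2\<close> along every curve. Since
  \<open>E[q\<^sub>4 | \<sigma>\<^sub>\<theta>(X)] = 0\<close>, the function \<open>q\<^sub>4 \<tau>\<^sub>c\<close> is orthogonal to the tangent space.

  Conversely, explicit curves show that \<open>u - E[u | X] - \<tau>\<^sub>c q\<^sub>2\<^sup>-\<^sup>1 E[\<tau>\<^sub>c u | X]\<close>, for bounded \<open>u\<close>, and
  \<open>c \<tau>\<^sub>c q\<^sub>2\<^sup>-\<^sup>1 (a - m)\<close>, for \<open>c\<close> measurable with respect to \<open>\<sigma>\<^sub>\<theta>(X)\<close> with values in \<open>[0, 1]\<close> and \<open>a\<close> the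
  mean of \<open>f\<close> under some density, are tangents. Functions orthogonal to all of these are orthogonal to the
  score minus \<open>q\<^sub>4 \<tau>\<^sub>c\<close>, whose conditional mean is zero and whose conditional covariance with \<open>\<tau>\<^sub>c\<close> is
  \<open>q\<^sub>1 - q\<^sub>3\<close>, a function of \<open>\<sigma>\<^sub>\<theta>(X)\<close>.
\<close>

section \<open>Square-integrable functions\<close>

text \<open>That tangents obey the linearized constraint is not plain linearization, because a curve
  may also move the marginal of X. The constraint makes the conditional mean \<open>g\<close> of the
  competing density measurable with respect to the projection, but the integral of
  \<open>b * (g - m)\<close> is taken under the competing marginal \<open>lam'\<close>. Its integral
  under \<open>lam\<close> vanishes, which leaves \<open>(lam' - lam) * b * (g - m)\<close>: a
  product of two changes, both controlled by one Hellinger distance, hence of second order.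

  In the converse, a path must stay nonnegative and obey the constraint at every x, while the
  inverse of q2 is only known to be integrable, so the directions are unbounded. Truncating a
  direction at large x is no remedy: the truncation set depends on x beyond the projection, and so
  would the shift of the mean. Mixing with a fixed density of mean \<open>a\<close> moves the mean
  by a multiple of \<open>a - m\<close>, which is why this factor enters the directions; two values
  of \<open>a\<close> then eliminate \<open>m\<close>.

  The inverse of q2 is integrable because its conditional expectation is assumed to exist. Its zeros
  are harmless: q2 vanishes almost everywhere or almost nowhere.\<close>

lemma L2_spaceI:
  "r \<in> borel_measurable M \<Longrightarrow> integrable M (\<lambda>z. (r z)\<^sup>2) \<Longrightarrow> r \<in> L2_space M"
  by (simp add: L2_space_def)

lemma L2_space_measurable: "r \<in> L2_space M \<Longrightarrow> r \<in> borel_measurable M"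
  and L2_space_integrable_sq: "r \<in> L2_space M \<Longrightarrow> integrable M (\<lambda>z. (r z)\<^sup>2)"
  by (simp_all add: L2_space_def)

lemma L2_space_integrable_mult:
  assumes "g \<in> L2_space M" "h \<in> L2_space M"
  shows "integrable M (\<lambda>z. g z * h z)"
proof (rule Bochner_Integration.integrable_bound[of M "\<lambda>z. (g z)\<^sup>2 + (h z)\<^sup>2"])
  note [measurable] = assms[THEN L2_space_measurable]
  show "(\<lambda>z. g z * h z) \<in> borel_measurable M" by measurable
  show "AE z in M. norm (g z * h z) \<le> norm ((g z)\<^sup>2 + (h z)\<^sup>2)"
  proof (rule AE_I2)
    fix z
    have "0 \<le> (\<bar>g z\<bar> - \<bar>h z\<bar>)\<^sup>2" by simp
    then have "2 * (\<bar>g z\<bar> * \<bar>h z\<bar>) \<le> (g z)\<^sup>2 + (h z)\<^sup>2"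
      by (simp add: power2_diff)
    moreover have "0 \<le> \<bar>g z\<bar> * \<bar>h z\<bar>" by simp
    ultimately have "\<bar>g z\<bar> * \<bar>h z\<bar> \<le> (g z)\<^sup>2 + (h z)\<^sup>2" by linarith
    then show "norm (g z * h z) \<le> norm ((g z)\<^sup>2 + (h z)\<^sup>2)"
      by (simp add: abs_mult)
  qed
qed (use assms in \<open>auto simp: L2_space_def\<close>)

lemma L2_space_cmult: "g \<in> L2_space M \<Longrightarrow> (\<lambda>z. c * g z) \<in> L2_space M"
  by (auto simp: L2_space_def power_mult_distrib)

lemma L2_space_add:
  assumes "g \<in> L2_space M" "h \<in> L2_space M"
  shows "(\<lambda>z. g z + h z) \<in> L2_space M"
proof -
  have "integrable M (\<lambda>z. (g z)\<^sup>2 + (h z)\<^sup>2 + 2 * (g z * h z))"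
    using assms L2_space_integrable_mult[OF assms] by (auto simp: L2_space_def)
  then show ?thesis
    using assms by (auto simp: L2_space_def power2_sum algebra_simps)
qed

lemma L2_space_diff:
  assumes "g \<in> L2_space M" "h \<in> L2_space M"
  shows "(\<lambda>z. g z - h z) \<in> L2_space M"
  using L2_space_add[OF assms(1) L2_space_cmult[OF assms(2), of "-1"]] by simp

lemma L2_space_sum:
  assumes "\<And>i. i \<in> I \<Longrightarrow> g i \<in> L2_space M"
  shows "(\<lambda>z. \<Sum>i\<in>I. g i z) \<in> L2_space M"
  using assms
proof (induction I rule: infinite_finite_induct)
  case (insert x F)
  then show ?case using L2_space_add[of "g x" M "\<lambda>z. \<Sum>i\<in>F. g i z"] by simp
qed (auto simp: L2_space_def)

lemma L2_space_cong_AE: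
  assumes "g \<in> L2_space M" "h \<in> borel_measurable M" "AE z in M. g z = h z"
  shows "h \<in> L2_space M"
proof (rule L2_spaceI)
  show "integrable M (\<lambda>z. (h z)\<^sup>2)"
    by (rule integrable_cong_AE_imp[OF L2_space_integrable_sq[OF assms(1)]])
       (use assms in \<open>auto simp: L2_space_def\<close>)
qed fact

lemma L2_space_bound:
  assumes "g \<in> L2_space M" "h \<in> borel_measurable M" "AE z in M. \<bar>h z\<bar> \<le> \<bar>g z\<bar>"
  shows "h \<in> L2_space M"
proof (rule L2_spaceI)
  show "integrable M (\<lambda>z. (h z)\<^sup>2)"
    by (rule Bochner_Integration.integrable_bound[OF L2_space_integrable_sq[OF assms(1)]])
       (use assms in \<open>auto simp: abs_le_square_iff\<close>)
qed fact

lemma (in finite_measure) L2_space_bounded: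
  assumes "h \<in> borel_measurable M" "AE z in M. \<bar>h z\<bar> \<le> K"
  shows "h \<in> L2_space M"
  by (rule L2_space_bound[of "\<lambda>_. K"]) (use assms in \<open>auto simp: L2_space_def\<close>)

lemma (in finite_measure) L2_space_integrable:
  assumes "h \<in> L2_space M"
  shows "integrable M h"
  using L2_space_integrable_mult[OF assms L2_space_bounded[of "\<lambda>_. 1" 1]] by simp

lemma L2_space_mult_bounded:
  assumes "h \<in> L2_space M" "g \<in> borel_measurable M" "AE z in M. \<bar>g z\<bar> \<le> K"
  shows "(\<lambda>z. g z * h z) \<in> L2_space M"
proof (rule L2_space_bound[OF L2_space_cmult[OF assms(1), of K]])
  show "AE z in M. \<bar>g z * h z\<bar> \<le> \<bar>K * h z\<bar>"
    using assms(3) by eventually_elim (auto simp: abs_mult intro!: mult_right_mono)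
qed (use assms in \<open>auto simp: L2_space_def\<close>)

lemma L2_inner_self: "L2_inner M g g = (LINT z|M. (g z)\<^sup>2)"
  by (simp add: L2_inner_def power2_eq_square)

lemma L2_norm_nonneg: "0 \<le> L2_norm M g"
  by (simp add: L2_norm_def L2_inner_self)

lemma L2_norm_power2: "(L2_norm M g)\<^sup>2 = (LINT z|M. (g z)\<^sup>2)"
  by (simp add: L2_norm_def L2_inner_self)

lemma L2_norm_cmult: "L2_norm M (\<lambda>z. c * g z) = \<bar>c\<bar> * L2_norm M g"
  by (simp add: L2_norm_def L2_inner_self power_mult_distrib real_sqrt_mult)

lemma L2_norm_cong_AE:
  assumes "AE z in M. g z = h z" "g \<in> borel_measurable M" "h \<in> borel_measurable M"
  shows "L2_norm M g = L2_norm M h"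
  unfolding L2_norm_def L2_inner_def
  by (rule arg_cong[of _ _ sqrt], rule integral_cong_AE) (use assms in auto)

lemma L2_Cauchy_Schwarz:
  assumes g: "g \<in> L2_space M" and h: "h \<in> L2_space M"
  shows "\<bar>L2_inner M g h\<bar> \<le> L2_norm M g * L2_norm M h"
proof -
  define a b c where "a = (LINT z|M. (g z)\<^sup>2)" "b = (LINT z|M. (h z)\<^sup>2)" "c = L2_inner M g h"
  have q: "0 \<le> a - 2 * t * c + t\<^sup>2 * b" for t
  proof -
    have "0 \<le> (LINT z|M. (g z - t * h z)\<^sup>2)" by simp
    also have "\<dots> = (LINT z|M. (g z)\<^sup>2 - 2 * t * (g z * h z) + t\<^sup>2 * (h z)\<^sup>2)"
      by (simp add: power2_diff power_mult_distrib algebra_simps)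
    also have "\<dots> = a - 2 * t * c + t\<^sup>2 * b"
      using L2_space_integrable_mult[OF assms] assms
      by (simp add: a_b_c_def L2_inner_def L2_space_def)
    finally show ?thesis .
  qed
  have ab: "0 \<le> a" "0 \<le> b" by (simp_all add: a_b_c_def)
  have "c\<^sup>2 \<le> a * b"
  proof (cases "b = 0")
    case True
    have "c = 0"
    proof (rule ccontr)
      assume "c \<noteq> 0"
      \<comment> \<open>With \<open>b = 0\<close> the form is affine in \<open>t\<close>, and this
        \<open>t\<close> gives it the value -1.\<close>
      then show False using q[of "(a + 1) / (2 * c)"] True ab by simp
    qed
    then show ?thesis using ab by simp
  next
    case False
    have "0 \<le> (a - 2 * (c / b) * c + (c / b)\<^sup>2 * b) * b"
      using q[of "c / b"] ab by (intro mult_nonneg_nonneg) auto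
    also have "\<dots> = a * b - c\<^sup>2"
      using False by (simp add: field_simps power2_eq_square)
    finally show ?thesis by simp
  qed
  then have "sqrt (c\<^sup>2) \<le> sqrt (a * b)" by (rule real_sqrt_le_mono)
  then show ?thesis
    by (simp add: real_sqrt_mult a_b_c_def L2_norm_def L2_inner_self)
qed

lemma L2_norm_power2_add_le:
  assumes "g \<in> L2_space M" "h \<in> L2_space M"
  shows "(L2_norm M (\<lambda>z. g z + h z))\<^sup>2 \<le> 2 * (L2_norm M g)\<^sup>2 + 2 * (L2_norm M h)\<^sup>2"
proof -
  have "(LINT z|M. (g z + h z)\<^sup>2) \<le> (LINT z|M. 2 * (g z)\<^sup>2 + 2 * (h z)\<^sup>2)"
  proof (rule integral_mono)
    fix z
    have "0 \<le> (g z - h z)\<^sup>2" by simp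
    then show "(g z + h z)\<^sup>2 \<le> 2 * (g z)\<^sup>2 + 2 * (h z)\<^sup>2"
      by (simp add: power2_sum power2_diff)
  qed (use L2_space_add[OF assms] assms in \<open>auto simp: L2_space_def\<close>)
  also have "\<dots> = 2 * (L2_norm M g)\<^sup>2 + 2 * (L2_norm M h)\<^sup>2"
    using assms by (simp add: L2_norm_power2 L2_space_def)
  finally show ?thesis by (simp add: L2_norm_power2)
qed

text \<open>Orthogonality passes to the span by linearity and to the closure by Cauchy-Schwarz, so
  it has to be checked only on tangents of curves.\<close>

lemma L2_orth_closure_hull:
  assumes g: "g \<in> L2_space M" and S: "S \<subseteq> L2_space M"
    and orth: "\<And>v. v \<in> S \<Longrightarrow> L2_inner M g v = 0"
  shows "g \<in> L2_orth_compl M (L2_closure M (linear_hull S))"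
proof -
  have hull: "h \<in> L2_space M \<and> L2_inner M g h = 0" if "h \<in> linear_hull S" for h
  proof -
    from that obtain n :: nat and c u where u: "\<And>i. i < n \<Longrightarrow> u i \<in> S"
      and h: "h = (\<lambda>z. \<Sum>i<n. c i * u i z)" unfolding linear_hull_def by blast
    have u2: "u i \<in> L2_space M" if "i < n" for i using u[OF that] S by auto
    have "h \<in> L2_space M" unfolding h
      by (rule L2_space_sum) (auto intro: L2_space_cmult u2)
    moreover have "L2_inner M g h = (\<Sum>i<n. c i * L2_inner M g (u i))"
    proof -
      have "integrable M (\<lambda>z. c i * (g z * u i z))" if "i < n" for i
        using L2_space_integrable_mult[OF g u2[OF that]] by simp
      then show ?thesis
        unfolding L2_inner_def h
        by (simp add: sum_distrib_left algebra_simps flip: Bochner_Integration.integral_mult_right_zero)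
    qed
    ultimately show ?thesis using orth u by simp
  qed
  show ?thesis
    unfolding L2_orth_compl_def
  proof (intro CollectI conjI ballI g)
    fix h assume "h \<in> L2_closure M (linear_hull S)"
    then have h: "h \<in> L2_space M"
      and ex: "\<And>e. 0 < e \<Longrightarrow> \<exists>k\<in>linear_hull S. L2_norm M (\<lambda>z. h z - k z) < e"
      by (auto simp: L2_closure_def)
    show "L2_inner M g h = 0"
    proof (rule ccontr)
      assume ne: "L2_inner M g h \<noteq> 0"
      define e where "e = \<bar>L2_inner M g h\<bar> / (L2_norm M g + 1)"
      have n0: "0 < L2_norm M g + 1" using L2_norm_nonneg[of M g] by simp
      then have "0 < e" using ne by (simp add: e_def)
      then obtain k where k: "k \<in> linear_hull S" "L2_norm M (\<lambda>z. h z - k z) < e" using ex by blast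
      have kL: "k \<in> L2_space M" and k0: "L2_inner M g k = 0" using hull[OF k(1)] by auto
      have "L2_inner M g (\<lambda>z. h z - k z) = L2_inner M g h - L2_inner M g k"
        using L2_space_integrable_mult[OF g h] L2_space_integrable_mult[OF g kL]
        by (simp add: L2_inner_def right_diff_distrib)
      with k0 L2_Cauchy_Schwarz[OF g L2_space_diff[OF h kL]]
      have "\<bar>L2_inner M g h\<bar> \<le> L2_norm M g * L2_norm M (\<lambda>z. h z - k z)" by simp
      also have "\<dots> \<le> L2_norm M g * e" using k(2) by (simp add: L2_norm_nonneg mult_left_mono)
      also have "\<dots> < (L2_norm M g + 1) * e" using \<open>0 < e\<close> by simp
      also have "\<dots> = \<bar>L2_inner M g h\<bar>" using n0 by (simp add: e_def)
      finally show False by simp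
    qed
  qed
qed

lemma L2_orth_compl_cong_AE:
  assumes g: "g \<in> L2_orth_compl M T" and T: "T \<subseteq> L2_space M"
    and h: "h \<in> borel_measurable M" and eq: "AE z in M. g z = h z"
  shows "h \<in> L2_orth_compl M T"
proof -
  have gL: "g \<in> L2_space M" and orth: "\<And>k. k \<in> T \<Longrightarrow> L2_inner M g k = 0"
    using g by (auto simp: L2_orth_compl_def)
  have "L2_inner M h k = 0" if k: "k \<in> T" for k
  proof -
    have "L2_inner M h k = L2_inner M g k"
      unfolding L2_inner_def
    proof (rule integral_cong_AE)
      show "AE z in M. h z * k z = g z * k z" using eq by eventually_elim simp
    qed (use L2_space_measurable k T h L2_space_measurable[OF gL] in \<open>auto intro!: borel_measurable_times\<close>)
    with orth[OF k] show ?thesis by simp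
  qed
  with L2_space_cong_AE[OF gL h eq] show ?thesis by (simp add: L2_orth_compl_def)
qed

lemma subset_L2_closure_hull:
  assumes "S \<subseteq> L2_space M"
  shows "S \<subseteq> L2_closure M (linear_hull S)"
proof
  fix v assume v: "v \<in> S"
  have "v \<in> linear_hull S"
    unfolding linear_hull_def
    by (rule CollectI, rule exI[of _ 1], rule exI[of _ "\<lambda>_. 1"], rule exI[of _ "\<lambda>_. v"]) (use v in auto)
  moreover have "L2_norm M (\<lambda>z. v z - v z) = 0" by (simp add: L2_norm_def L2_inner_def)
  ultimately show "v \<in> L2_closure M (linear_hull S)"
    using v assms by (auto simp: L2_closure_def intro!: bexI[of _ v])
qed

text \<open>The test function is \<open>r\<^sup>2 = (\<Sum>n. 2\<^sup>-\<^sup>n \<one>{\<bar>f\<bar> > 4\<^sup>n} / M{\<bar>f\<bar> > 4\<^sup>n})\<close>.\<close>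

lemma (in finite_measure) AE_bounded_if_integrable_mult_sq:
  assumes [measurable]: "f \<in> borel_measurable M"
    and int: "\<And>r. r \<in> L2_space M \<Longrightarrow> integrable M (\<lambda>y. f y * (r y)\<^sup>2)"
  shows "\<exists>K\<ge>0. AE y in M. \<bar>f y\<bar> \<le> K"
proof (rule ccontr)
  assume "\<not> (\<exists>K\<ge>0. AE y in M. \<bar>f y\<bar> \<le> K)"
  then have unb: "\<not> (AE y in M. \<bar>f y\<bar> \<le> 4 ^ n)" for n :: nat by (meson zero_le_numeral zero_le_power)
  define A where "A n = {y \<in> space M. 4 ^ n < \<bar>f y\<bar>}" for n :: nat
  have [measurable]: "A n \<in> sets M" for n unfolding A_def by measurable
  have a_pos: "0 < measure M (A n)" for n
  proof -
    have "emeasure M (A n) \<noteq> 0"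
    proof
      assume "emeasure M (A n) = 0"
      then have "AE y in M. \<bar>f y\<bar> \<le> 4 ^ n"
        by (intro AE_I[of _ _ "A n"]) (auto simp: A_def)
      with unb show False by simp
    qed
    then show ?thesis by (simp add: emeasure_eq_measure zero_less_measure_iff)
  qed
  \<comment> \<open>Each summand integrates to 2^-n, so \<open>W\<close> has integral 2. On
    \<open>A n\<close> the n-th summand times \<open>\<bar>f\<bar>\<close> is at least 4^n 2^-n /
    M(A n), and this alone contributes 2^n to the integral of \<open>\<bar>f\<bar> * W\<close>, for
    every n.\<close>
  define W where "W y = (\<Sum>n. ennreal ((1/2) ^ n / measure M (A n)) * indicator (A n) y)" for y
  have [measurable]: "W \<in> borel_measurable M" unfolding W_def by measurable
  have "(\<integral>\<^sup>+y. W y \<partial>M) = (\<Sum>n. \<integral>\<^sup>+y. ennreal ((1/2) ^ n / measure M (A n)) * indicator (A n) y \<partial>M)"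
    unfolding W_def by (rule nn_integral_suminf) auto
  also have "\<dots> = (\<Sum>n. ennreal ((1/2) ^ n))"
  proof (rule suminf_cong)
    fix n
    have "(\<integral>\<^sup>+y. ennreal ((1/2) ^ n / measure M (A n)) * indicator (A n) y \<partial>M)
        = ennreal ((1/2) ^ n / measure M (A n)) * ennreal (measure M (A n))"
      by (subst nn_integral_cmult_indicator) (auto simp: emeasure_eq_measure)
    also have "\<dots> = ennreal ((1/2) ^ n)"
      using a_pos[of n] by (subst ennreal_mult'[symmetric]) auto
    finally show "(\<integral>\<^sup>+y. ennreal ((1/2) ^ n / measure M (A n)) * indicator (A n) y \<partial>M) = ennreal ((1/2) ^ n)" .
  qed
  also have "\<dots> = ennreal 2"
    using suminf_geometric[of "1/2::real"] by (subst suminf_ennreal2) (auto intro: summable_geometric)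
  finally have W2: "(\<integral>\<^sup>+y. W y \<partial>M) = ennreal 2" .
  then have W_fin: "AE y in M. W y \<noteq> \<infinity>"
    by (intro nn_integral_noteq_infinite) auto
  define r where "r y = sqrt (enn2real (W y))" for y
  have [measurable]: "r \<in> borel_measurable M" unfolding r_def by measurable
  have r2: "(r y)\<^sup>2 = enn2real (W y)" for y by (simp add: r_def)
  have "integrable M (\<lambda>y. (r y)\<^sup>2)"
  proof (rule integrableI_bounded)
    have "(\<integral>\<^sup>+y. ennreal (norm ((r y)\<^sup>2)) \<partial>M) \<le> (\<integral>\<^sup>+y. W y \<partial>M)"
      unfolding r2 by (intro nn_integral_mono_AE, use W_fin in eventually_elim) (auto simp: less_top)
    then show "(\<integral>\<^sup>+y. ennreal (norm ((r y)\<^sup>2)) \<partial>M) < \<infinity>" using W2 by (auto intro: le_less_trans)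
  qed simp
  then have "integrable M (\<lambda>y. f y * (r y)\<^sup>2)" by (intro int L2_spaceI) auto
  then have fin: "(\<integral>\<^sup>+y. ennreal (norm (f y * (r y)\<^sup>2)) \<partial>M) < \<infinity>"
    by (simp add: integrable_iff_bounded)
  have "ennreal (2 ^ n) \<le> (\<integral>\<^sup>+y. ennreal (norm (f y * (r y)\<^sup>2)) \<partial>M)" for n :: nat
  proof -
    have "ennreal (2 ^ n) = (\<integral>\<^sup>+y. ennreal (4 ^ n * ((1/2) ^ n / measure M (A n))) * indicator (A n) y \<partial>M)"
    proof -
      have "(\<integral>\<^sup>+y. ennreal (4 ^ n * ((1/2) ^ n / measure M (A n))) * indicator (A n) y \<partial>M)
          = ennreal (4 ^ n * ((1/2) ^ n / measure M (A n))) * ennreal (measure M (A n))"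
        by (subst nn_integral_cmult_indicator) (auto simp: emeasure_eq_measure)
      also have "\<dots> = ennreal (4 ^ n * (1/2) ^ n)"
        using a_pos[of n] by (subst ennreal_mult'[symmetric]) auto
      also have "(4::real) ^ n * (1/2) ^ n = 2 ^ n" by (simp flip: power_mult_distrib)
      finally show ?thesis ..
    qed
    also have "\<dots> \<le> (\<integral>\<^sup>+y. ennreal (norm (f y * (r y)\<^sup>2)) \<partial>M)"
    proof (rule nn_integral_mono_AE, use W_fin in eventually_elim)
      fix y assume Wf: "W y \<noteq> \<infinity>"
      show "ennreal (4 ^ n * ((1/2) ^ n / measure M (A n))) * indicator (A n) y
          \<le> ennreal (norm (f y * (r y)\<^sup>2))"
      proof (cases "y \<in> A n")
        case True
        have "ennreal ((1/2) ^ n / measure M (A n)) * indicator (A n) y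
            \<le> (\<Sum>k. ennreal ((1/2) ^ k / measure M (A k)) * indicator (A k) y)"
        proof -
          define F where "F = (\<lambda>k. ennreal ((1/2) ^ k / measure M (A k)) * indicator (A k) y)"
          have "sum F {n} \<le> suminf F" by (rule sum_le_suminf) auto
          then have "F n \<le> suminf F" by simp
          then show ?thesis by (simp only: F_def)
        qed
        then have "ennreal ((1/2) ^ n / measure M (A n)) \<le> W y"
          using True by (simp add: W_def)
        then have "(1/2) ^ n / measure M (A n) \<le> enn2real (W y)"
          using Wf by (metis enn2real_ennreal enn2real_mono divide_nonneg_nonneg half_gt_zero infinity_ennreal_def
              less_top measure_nonneg order_less_le zero_le_power zero_less_one)
        moreover have "4 ^ n \<le> \<bar>f y\<bar>" using True by (auto simp: A_def)
        ultimately have "4 ^ n * ((1/2) ^ n / measure M (A n)) \<le> \<bar>f y\<bar> * enn2real (W y)"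
          by (intro mult_mono) auto
        then show ?thesis using True by (simp add: r2 abs_mult)
      qed simp
    qed
    finally show ?thesis .
  qed
  then have "ennreal (2 ^ n) \<le> ennreal (enn2real (\<integral>\<^sup>+y. ennreal (norm (f y * (r y)\<^sup>2)) \<partial>M))" for n :: nat
    using fin by simp
  then have "(2::real) ^ n \<le> enn2real (\<integral>\<^sup>+y. ennreal (norm (f y * (r y)\<^sup>2)) \<partial>M)" for n :: nat
    by (simp add: ennreal_le_iff)
  moreover obtain n :: nat where "enn2real (\<integral>\<^sup>+y. ennreal (norm (f y * (r y)\<^sup>2)) \<partial>M) < 2 ^ n"
    using real_arch_pow[of 2] by auto
  ultimately show False by (meson not_le)
qed

text \<open>Along a ray \<open>t * h\<close> the functional is a quadratic polynomial in
  \<open>t\<close> with linear coefficient \<open>L2_inner M f h\<close>; the half in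
  \<open>1 + r / 2\<close> makes this coefficient free of constants. Uniqueness of the derivative in
  \<open>t\<close> identifies \<open>D h\<close>, and testing with \<open>h = \<tau> - f\<close>
  makes the difference vanish.\<close>

lemma (in finite_measure) AE_eq_riesz_rep_perturbation:
  assumes f: "f \<in> L2_space M"
    and int: "\<And>r. r \<in> L2_space M \<Longrightarrow> integrable M (\<lambda>y. f y * (r y)\<^sup>2)"
    and der: "has_L2_derivative M (\<lambda>r. LINT y|M. f y * (1 + r y / 2)\<^sup>2) D (\<lambda>_. 0)"
    and riesz: "is_riesz_rep M D \<tau>"
  shows "AE y in M. \<tau> y = f y"
proof -
  have \<tau>: "\<tau> \<in> L2_space M" and D: "\<And>h. h \<in> L2_space M \<Longrightarrow> D h = L2_inner M \<tau> h"
    using riesz by (auto simp: is_riesz_rep_def)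
  have Dh: "D h = L2_inner M f h" if h: "h \<in> L2_space M" for h
  proof -
    define \<psi> where "\<psi> t = (LINT y|M. f y * (1 + t * h y / 2)\<^sup>2)" for t
    define Q where "Q = (LINT y|M. f y * (h y)\<^sup>2) / 4"
    have \<psi>: "\<psi> = (\<lambda>t. (LINT y|M. f y) + t * L2_inner M f h + t\<^sup>2 * Q)"
    proof
      fix t
      have "\<psi> t = (LINT y|M. f y + t * (f y * h y) + t\<^sup>2 / 4 * (f y * (h y)\<^sup>2))"
        unfolding \<psi>_def
        by (intro Bochner_Integration.integral_cong) (auto simp: power2_eq_square field_simps)
      then show "\<psi> t = (LINT y|M. f y) + t * L2_inner M f h + t\<^sup>2 * Q"
        using L2_space_integrable_mult[OF f h] L2_space_integrable[OF f] int[OF h]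
        by (simp add: Q_def L2_inner_def)
    qed
    have "(\<psi> has_real_derivative L2_inner M f h) (at 0)"
      unfolding \<psi> by (auto intro!: derivative_eq_intros)
    moreover have "(\<psi> has_real_derivative D h) (at 0)"
      unfolding has_field_derivative_def has_derivative_at_alt
    proof (intro conjI allI impI bounded_linear_mult_right)
      fix e :: real assume "0 < e"
      \<comment> \<open>The added 1 keeps the divisor positive when \<open>h\<close> has norm
        zero.\<close>
      define n where "n = L2_norm M h + 1"
      have n: "0 < n" "L2_norm M h \<le> n" using L2_norm_nonneg[of M h] by (auto simp: n_def)
      have "0 < e / n" using \<open>0 < e\<close> n by simp
      with der obtain \<delta> where "\<delta> > 0" and \<delta>: "\<And>g. g \<in> L2_space M \<Longrightarrow> L2_norm M g < \<delta> \<Longrightarrow>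
          \<bar>(LINT y|M. f y * (1 + (0 + g y) / 2)\<^sup>2) - (LINT y|M. f y * (1 + 0 / 2)\<^sup>2) - D g\<bar> \<le> e / n * L2_norm M g"
        unfolding has_L2_derivative_def by blast
      show "\<exists>d>0. \<forall>t. norm (t - 0) < d \<longrightarrow> norm (\<psi> t - \<psi> 0 - D h * (t - 0)) \<le> e * norm (t - 0)"
      proof (intro exI[of _ "\<delta> / n"] conjI allI impI)
        fix t :: real assume "norm (t - 0) < \<delta> / n"
        then have "\<bar>t\<bar> * n < \<delta>" using n by (simp add: pos_less_divide_eq)
        with mult_left_mono[OF n(2), of "\<bar>t\<bar>"] have nt: "L2_norm M (\<lambda>y. t * h y) < \<delta>"
          by (simp add: L2_norm_cmult)
        have th: "(\<lambda>y. t * h y) \<in> L2_space M" by (rule L2_space_cmult[OF h])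
        have "D (\<lambda>y. t * h y) = D h * t" by (simp add: D th h L2_inner_def mult_ac)
        then have "\<bar>\<psi> t - \<psi> 0 - D h * t\<bar> \<le> e / n * (\<bar>t\<bar> * L2_norm M h)"
          using \<delta>[OF th nt] by (simp add: \<psi>_def L2_norm_cmult)
        also have "\<dots> \<le> e / n * (\<bar>t\<bar> * n)"
          using n \<open>0 < e\<close> by (intro mult_left_mono) auto
        also have "\<dots> = e * \<bar>t\<bar>" using n by simp
        finally show "norm (\<psi> t - \<psi> 0 - D h * (t - 0)) \<le> e * norm (t - 0)" by simp
      qed (use \<open>\<delta> > 0\<close> n in simp)
    qed
    ultimately show ?thesis by (rule DERIV_unique[symmetric])
  qed
  define k where "k y = \<tau> y - f y" for y
  have k: "k \<in> L2_space M" unfolding k_def by (rule L2_space_diff[OF \<tau> f])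
  have "(LINT y|M. (k y)\<^sup>2) = L2_inner M \<tau> k - L2_inner M f k"
    using L2_space_integrable_mult[OF \<tau> k] L2_space_integrable_mult[OF f k]
    by (simp add: L2_inner_def k_def power2_eq_square algebra_simps
        flip: Bochner_Integration.integral_diff)
  also have "\<dots> = 0" using D[OF k] Dh[OF k] by simp
  finally have "(LINT y|M. (k y)\<^sup>2) = 0" .
  then have "AE y in M. (k y)\<^sup>2 = 0"
    by (subst (asm) integral_nonneg_eq_0_iff_AE) (use k in \<open>auto simp: L2_space_def\<close>)
  then show ?thesis by eventually_elim (simp add: k_def)
qed

text \<open>In the expansion g + g F + g F^2 / 4 the middle term carries the derivative, and the
  last one is O(\<parallel>F\<parallel>^2) because \<open>g\<close> is bounded, hence of second
  order in the parameter. With \<open>g\<close> equal to \<open>fb\<close> this differentiates the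
  conditional mean of f; with \<open>g = 1\<close> it shows that the score is conditionally
  centered.\<close>

lemma (in finite_measure) has_derivative_perturbation_of_gradient:
  fixes F :: "real^'p \<Rightarrow> 'a \<Rightarrow> real" and D :: "'a \<Rightarrow> real^'p"
  assumes g: "g \<in> borel_measurable M" and gK: "AE y in M. \<bar>g y\<bar> \<le> K"
    and grad: "has_L2_gradient M F D \<theta>0" and F0: "AE y in M. F \<theta>0 y = 0"
  shows "((\<lambda>\<theta>. LINT y|M. g y * (1 + F \<theta> y / 2)\<^sup>2) has_derivative
           (\<lambda>h. (\<chi> i. LINT y|M. g y * D y $ i) \<bullet> h)) (at \<theta>0)"
proof -
  define I where "I \<theta> = (LINT y|M. g y * (1 + F \<theta> y / 2)\<^sup>2)" for \<theta>
  have FL: "F \<theta> \<in> L2_space M" for \<theta> using grad by (auto simp: has_L2_gradient_def)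
  have DL: "(\<lambda>y. D y $ i) \<in> L2_space M" for i using grad by (auto simp: has_L2_gradient_def)
  have Dh: "(\<lambda>y. D y \<bullet> h) \<in> L2_space M" for h
    unfolding inner_vec_def inner_real_def
    by (rule L2_space_sum) (use L2_space_cmult[OF DL] in \<open>simp add: mult.commute\<close>)
  define R where "R \<theta> y = F \<theta> y - D y \<bullet> (\<theta> - \<theta>0)" for \<theta> y
  have RL: "R \<theta> \<in> L2_space M" for \<theta>
    unfolding R_def by (rule L2_space_diff[OF FL Dh])
  define \<rho> where "\<rho> \<theta> = L2_norm M (R \<theta>) / norm (\<theta> - \<theta>0)" for \<theta>
  have "(\<lambda>\<theta>. L2_norm M (\<lambda>z. F \<theta> z - F \<theta>0 z - D z \<bullet> (\<theta> - \<theta>0))) = (\<lambda>\<theta>. L2_norm M (R \<theta>))"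
  proof
    fix \<theta>
    show "L2_norm M (\<lambda>z. F \<theta> z - F \<theta>0 z - D z \<bullet> (\<theta> - \<theta>0)) = L2_norm M (R \<theta>)"
    proof (rule L2_norm_cong_AE)
      show "AE z in M. F \<theta> z - F \<theta>0 z - D z \<bullet> (\<theta> - \<theta>0) = R \<theta> z"
        using F0 by eventually_elim (simp add: R_def)
    qed (use FL Dh RL in \<open>auto simp: L2_space_def intro!: borel_measurable_diff\<close>)
  qed
  then have "(\<lambda>\<theta>. L2_norm M (R \<theta>)) \<in> o[at \<theta>0](\<lambda>\<theta>. norm (\<theta> - \<theta>0))"
    using grad by (simp add: has_L2_gradient_def)
  then have \<rho>0: "(\<rho> \<longlongrightarrow> 0) (at \<theta>0)"
    unfolding \<rho>_def by (rule smalloD_tendsto)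
  have gL: "g \<in> L2_space M" by (rule L2_space_bounded[OF g gK])
  define B where "B = (\<Sum>i\<in>UNIV. L2_norm M (\<lambda>y. D y $ i))"
  define G where "G = L2_norm M g"
  define L where "L h = (\<chi> i. LINT y|M. g y * D y $ i) \<bullet> h" for h
  have gD: "integrable M (\<lambda>y. g y * D y $ i)" for i by (rule L2_space_integrable_mult[OF gL DL])
  have L_eq: "L h = (LINT y|M. g y * (D y \<bullet> h))" for h
  proof -
    have "integrable M (\<lambda>y. h $ i * (g y * D y $ i))" for i using gD by simp
    then have "(LINT y|M. (\<Sum>i\<in>UNIV. h $ i * (g y * D y $ i))) = (\<Sum>i\<in>UNIV. h $ i * (LINT y|M. g y * D y $ i))"
      by simp
    moreover have "g y * (D y \<bullet> h) = (\<Sum>i\<in>UNIV. h $ i * (g y * D y $ i))" for y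
      by (simp add: inner_vec_def sum_distrib_left algebra_simps)
    ultimately show ?thesis by (simp add: L_def inner_vec_def algebra_simps)
  qed
  define A where "A = (LINT y|M. norm (D y)^2)"
  have nD: "norm (D y)^2 = (\<Sum>i\<in>UNIV. (D y $ i)\<^sup>2)" for y
    unfolding power2_norm_eq_inner inner_vec_def by (simp add: power2_eq_square)
  have iD: "integrable M (\<lambda>y. norm (D y)^2)"
    unfolding nD using DL by (auto simp: L2_space_def)
  have A: "(L2_norm M (\<lambda>y. D y \<bullet> h))\<^sup>2 \<le> A * (norm h)\<^sup>2" for h
  proof -
    have "(LINT y|M. (D y \<bullet> h)\<^sup>2) \<le> (LINT y|M. norm (D y)^2 * (norm h)\<^sup>2)"
    proof (rule integral_mono)
      fix y
      show "(D y \<bullet> h)\<^sup>2 \<le> norm (D y)^2 * (norm h)\<^sup>2"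
        using power_mono[OF Cauchy_Schwarz_ineq2[of "D y" h], of 2] by (simp add: power_mult_distrib)
    qed (use Dh iD in \<open>auto simp: L2_space_def\<close>)
    then show ?thesis by (simp add: L2_norm_power2 A_def)
  qed
  have K0: "0 \<le> \<bar>K\<bar>" by simp
  \<comment> \<open>The remainder divided by the distance of the parameters. The first term is
    Cauchy-Schwarz for \<open>g\<close> and the linearization error \<open>R\<close>; the bracket is
    the bound 2\<parallel>R\<parallel>^2 + 2\<parallel>D \<bullet> h\<parallel>^2 for
    \<parallel>F\<parallel>^2 after the division.\<close>
  define R2 where "R2 \<theta> = G * \<rho> \<theta> + \<bar>K\<bar> / 4 * (2 * (\<rho> \<theta>)\<^sup>2 * norm (\<theta> - \<theta>0) + 2 * A * norm (\<theta> - \<theta>0))" for \<theta>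
  have main: "norm (I \<theta> - I \<theta>0 - L (\<theta> - \<theta>0)) / norm (\<theta> - \<theta>0) \<le> R2 \<theta>"
    if ne: "\<theta> \<noteq> \<theta>0" for \<theta>
  proof -
    let ?h = "\<theta> - \<theta>0"
    have n: "0 < norm ?h" using ne by simp
    have gF2: "integrable M (\<lambda>y. g y * (F \<theta> y)\<^sup>2)"
      using L2_space_integrable_mult[OF L2_space_mult_bounded[OF FL g gK] FL, of \<theta> \<theta>]
      by (simp add: power2_eq_square mult.assoc)
    have gR: "integrable M (\<lambda>y. g y * R \<theta> y)" and gDh: "integrable M (\<lambda>y. g y * (D y \<bullet> ?h))"
      and gi: "integrable M g"
      by (rule L2_space_integrable_mult[OF gL RL] L2_space_integrable_mult[OF gL Dh] L2_space_integrable[OF gL])+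
    have "I \<theta>0 = (LINT y|M. g y)"
      unfolding I_def
    proof (rule integral_cong_AE)
      show "AE y in M. g y * (1 + F \<theta>0 y / 2)\<^sup>2 = g y"
        using F0 by eventually_elim simp
    qed (use g L2_space_measurable[OF FL[of \<theta>0]] in measurable)
    moreover have "I \<theta>
        = (LINT y|M. g y + g y * (D y \<bullet> ?h) + g y * R \<theta> y + g y * (F \<theta> y)\<^sup>2 / 4)"
      unfolding I_def
      by (intro Bochner_Integration.integral_cong) (auto simp: R_def power2_eq_square field_simps)
    ultimately have "I \<theta> - I \<theta>0 - L ?h
      = L2_inner M g (R \<theta>) + (LINT y|M. g y * (F \<theta> y)\<^sup>2) / 4"
      using gF2 gR gDh gi by (simp add: L_eq L2_inner_def)
    moreover have "\<bar>L2_inner M g (R \<theta>)\<bar> \<le> G * L2_norm M (R \<theta>)"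
      unfolding G_def by (rule L2_Cauchy_Schwarz[OF gL RL])
    moreover have "\<bar>LINT y|M. g y * (F \<theta> y)\<^sup>2\<bar> \<le> \<bar>K\<bar> * (L2_norm M (F \<theta>))\<^sup>2"
    proof -
      have "\<bar>LINT y|M. g y * (F \<theta> y)\<^sup>2\<bar> \<le> (LINT y|M. \<bar>g y * (F \<theta> y)\<^sup>2\<bar>)"
        by (rule integral_abs_bound)
      also have "\<dots> \<le> (LINT y|M. \<bar>K\<bar> * (F \<theta> y)\<^sup>2)"
      proof (rule integral_mono_AE)
        show "AE y in M. \<bar>g y * (F \<theta> y)\<^sup>2\<bar> \<le> \<bar>K\<bar> * (F \<theta> y)\<^sup>2"
          using gK by eventually_elim (auto simp: abs_mult intro!: mult_right_mono)
      qed (use gF2 FL in \<open>auto simp: L2_space_def\<close>)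
      finally show ?thesis by (simp add: L2_norm_power2)
    qed
    moreover have "(L2_norm M (F \<theta>))\<^sup>2 \<le> 2 * (L2_norm M (R \<theta>))\<^sup>2 + 2 * (A * (norm ?h)\<^sup>2)"
    proof -
      have "(L2_norm M (F \<theta>))\<^sup>2 \<le> 2 * (L2_norm M (R \<theta>))\<^sup>2 + 2 * (L2_norm M (\<lambda>y. D y \<bullet> ?h))\<^sup>2"
        using L2_norm_power2_add_le[OF RL[of \<theta>] Dh[of ?h]] by (simp add: R_def)
      with A[of ?h] show ?thesis by linarith
    qed
    ultimately have "norm (I \<theta> - I \<theta>0 - L ?h)
       \<le> G * L2_norm M (R \<theta>) + \<bar>K\<bar> * (2 * (L2_norm M (R \<theta>))\<^sup>2 + 2 * (A * (norm ?h)\<^sup>2)) / 4"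
      using mult_left_mono[OF _ K0, of "(L2_norm M (F \<theta>))\<^sup>2" "2 * (L2_norm M (R \<theta>))\<^sup>2 + 2 * (A * (norm ?h)\<^sup>2)"]
      unfolding real_norm_def by linarith
    also have "\<dots> = R2 \<theta> * norm ?h"
      using n by (simp add: R2_def \<rho>_def field_simps power2_eq_square)
    finally show ?thesis using n by (simp add: pos_divide_le_eq)
  qed
  have nh: "((\<lambda>\<theta>. norm (\<theta> - \<theta>0)) \<longlongrightarrow> 0) (at \<theta>0)"
    by (rule tendsto_eq_intros refl | simp)+
  have "(R2 \<longlongrightarrow> G * 0 + \<bar>K\<bar> / 4 * (2 * 0\<^sup>2 * 0 + 2 * A * 0)) (at \<theta>0)"
    unfolding R2_def by (intro tendsto_intros \<rho>0 nh)
  then have bound0: "(R2 \<longlongrightarrow> 0) (at \<theta>0)" by simp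
  have lim: "((\<lambda>\<theta>. norm (I \<theta> - I \<theta>0 - L (\<theta> - \<theta>0)) / norm (\<theta> - \<theta>0)) \<longlongrightarrow> 0) (at \<theta>0)"
  proof (rule tendsto_sandwich[OF _ _ tendsto_const bound0])
    show "\<forall>\<^sub>F \<theta> in at \<theta>0. norm (I \<theta> - I \<theta>0 - L (\<theta> - \<theta>0)) / norm (\<theta> - \<theta>0) \<le> R2 \<theta>"
      unfolding eventually_at_filter by (intro always_eventually allI impI main)
  qed (intro always_eventually allI divide_nonneg_nonneg norm_ge_zero)
  have "bounded_linear L"
    unfolding L_def by (rule bounded_linear_inner_right)
  with lim show ?thesis
    unfolding has_derivative_iff_norm L_def I_def by simp
qed

section \<open>Joint densities and conditional means\<close>

text \<open>The constraint on L is absent here, so that the locale can be interpreted for the true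
  density and also for an arbitrary competitor in the model, with its own marginal.\<close>

locale joint_density =
  fixes \<mu>X :: "'a measure" and \<mu>Y :: "'b measure"
    and lam :: "'a \<Rightarrow> real" and eta :: "'a \<Rightarrow> 'b \<Rightarrow> real"
  assumes sigma_finite_X: "sigma_finite_measure \<mu>X" and sigma_finite_Y: "sigma_finite_measure \<mu>Y"
    and lam: "lam \<in> densities \<mu>X"
    and eta_meas: "(\<lambda>(x, y). eta x y) \<in> borel_measurable (\<mu>X \<Otimes>\<^sub>M \<mu>Y)"
    and eta: "\<And>x. x \<in> space \<mu>X \<Longrightarrow> eta x \<in> densities \<mu>Y"
begin

sublocale XY: pair_sigma_finite \<mu>X \<mu>Y
  by (intro pair_sigma_finite.intro sigma_finite_X sigma_finite_Y)

abbreviation "\<mu>XY \<equiv> \<mu>X \<Otimes>\<^sub>M \<mu>Y"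

definition phi :: "'a \<times> 'b \<Rightarrow> real" where "phi = (\<lambda>(x, y). lam x * eta x y)"

definition J :: "('a \<times> 'b) measure" where "J = density \<mu>XY (\<lambda>z. ennreal (phi z))"

definition Lam :: "'a measure" where "Lam = density \<mu>X (\<lambda>x. ennreal (lam x))"

definition N :: "'a \<Rightarrow> 'b measure" where "N x = density \<mu>Y (\<lambda>y. ennreal (eta x y))"

lemma lam_meas [measurable]: "lam \<in> borel_measurable \<mu>X"
  and lam_nonneg: "x \<in> space \<mu>X \<Longrightarrow> 0 \<le> lam x"
  using lam by (auto simp: densities_def)

lemma eta_slice_meas [measurable]: "x \<in> space \<mu>X \<Longrightarrow> eta x \<in> borel_measurable \<mu>Y"
  and eta_nonneg: "x \<in> space \<mu>X \<Longrightarrow> y \<in> space \<mu>Y \<Longrightarrow> 0 \<le> eta x y"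
  using eta by (auto simp: densities_def)

lemma eta_meas' [measurable]: "(\<lambda>z. eta (fst z) (snd z)) \<in> borel_measurable \<mu>XY"
  using eta_meas by (simp add: split_beta')

lemma phi_meas [measurable]: "phi \<in> borel_measurable \<mu>XY"
  unfolding phi_def split_beta' by measurable

lemma phi_nonneg: "z \<in> space \<mu>XY \<Longrightarrow> 0 \<le> phi z"
  by (auto simp: phi_def space_pair_measure lam_nonneg eta_nonneg)

lemma sets_J [simp, measurable_cong]: "sets J = sets \<mu>XY"
  and space_J [simp]: "space J = space \<mu>X \<times> space \<mu>Y"
  by (simp_all add: J_def space_pair_measure)

lemma sets_Lam [simp, measurable_cong]: "sets Lam = sets \<mu>X"
  and space_Lam [simp]: "space Lam = space \<mu>X"
  by (simp_all add: Lam_def)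

lemma sets_N [simp, measurable_cong]: "sets (N x) = sets \<mu>Y"
  and space_N [simp]: "space (N x) = space \<mu>Y"
  by (simp_all add: N_def)

lemma nn_integral_N_meas [measurable]:
  assumes [measurable]: "h \<in> borel_measurable \<mu>XY"
  shows "(\<lambda>x. \<integral>\<^sup>+y. h (x, y) \<partial>N x) \<in> borel_measurable \<mu>X"
proof -
  have "(\<lambda>x. \<integral>\<^sup>+y. ennreal (eta x y) * h (x, y) \<partial>\<mu>Y) \<in> borel_measurable \<mu>X"
    by (rule XY.M2.borel_measurable_nn_integral) (simp add: split_beta')
  moreover have "(\<integral>\<^sup>+y. ennreal (eta x y) * h (x, y) \<partial>\<mu>Y) = (\<integral>\<^sup>+y. h (x, y) \<partial>N x)"
    if [measurable]: "x \<in> space \<mu>X" for x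
    unfolding N_def by (rule nn_integral_density[symmetric]) measurable
  ultimately show ?thesis by (simp cong: measurable_cong)
qed

text \<open>Disintegrates \<open>J\<close> into the marginal \<open>Lam\<close> and the conditional
  laws \<open>N x\<close>. The version for nonnegative functions comes first because total masses
  and null sets are derived from it.\<close>

lemma nn_integral_J:
  assumes [measurable]: "h \<in> borel_measurable \<mu>XY"
  shows "(\<integral>\<^sup>+z. h z \<partial>J) = (\<integral>\<^sup>+x. (\<integral>\<^sup>+y. h (x, y) \<partial>N x) \<partial>Lam)"
proof -
  have "(\<integral>\<^sup>+z. h z \<partial>J) = (\<integral>\<^sup>+z. ennreal (phi z) * h z \<partial>\<mu>XY)"
    unfolding J_def by (rule nn_integral_density) auto
  also have "\<dots> = (\<integral>\<^sup>+x. (\<integral>\<^sup>+y. ennreal (phi (x, y)) * h (x, y) \<partial>\<mu>Y) \<partial>\<mu>X)"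
    by (rule XY.M2.nn_integral_fst[symmetric]) auto
  also have "\<dots> = (\<integral>\<^sup>+x. ennreal (lam x) * (\<integral>\<^sup>+y. h (x, y) \<partial>N x) \<partial>\<mu>X)"
  proof (rule nn_integral_cong)
    fix x assume x [measurable]: "x \<in> space \<mu>X"
    have "(\<integral>\<^sup>+y. ennreal (phi (x, y)) * h (x, y) \<partial>\<mu>Y)
        = (\<integral>\<^sup>+y. ennreal (lam x) * (ennreal (eta x y) * h (x, y)) \<partial>\<mu>Y)"
      using x by (intro nn_integral_cong) (simp add: phi_def ennreal_mult lam_nonneg eta_nonneg mult.assoc)
    also have "\<dots> = ennreal (lam x) * (\<integral>\<^sup>+y. ennreal (eta x y) * h (x, y) \<partial>\<mu>Y)"
      by (rule nn_integral_cmult) measurable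
    also have "(\<integral>\<^sup>+y. ennreal (eta x y) * h (x, y) \<partial>\<mu>Y) = (\<integral>\<^sup>+y. h (x, y) \<partial>N x)"
      unfolding N_def by (rule nn_integral_density[symmetric]) measurable
    finally show "(\<integral>\<^sup>+y. ennreal (phi (x, y)) * h (x, y) \<partial>\<mu>Y) = ennreal (lam x) * (\<integral>\<^sup>+y. h (x, y) \<partial>N x)" .
  qed
  also have "\<dots> = (\<integral>\<^sup>+x. (\<integral>\<^sup>+y. h (x, y) \<partial>N x) \<partial>Lam)"
    unfolding Lam_def by (rule nn_integral_density[symmetric]) measurable
  finally show ?thesis .
qed

lemma prob_space_N: "x \<in> space \<mu>X \<Longrightarrow> prob_space (N x)"
  using eta[of x] by (intro prob_spaceI) (simp add: N_def emeasure_density densities_def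
    nn_integral_set_ennreal cong: nn_integral_cong)

lemma prob_space_Lam: "prob_space Lam"
  using lam by (intro prob_spaceI) (simp add: Lam_def emeasure_density densities_def cong: nn_integral_cong)

lemma prob_space_J: "prob_space J"
proof (rule prob_spaceI)
  have "emeasure J (space J) = (\<integral>\<^sup>+z. 1 \<partial>J)" by simp
  also have "\<dots> = (\<integral>\<^sup>+x. (\<integral>\<^sup>+y. 1 \<partial>N x) \<partial>Lam)" by (rule nn_integral_J) simp
  also have "\<dots> = (\<integral>\<^sup>+x. 1 \<partial>Lam)"
    using prob_space.emeasure_space_1[OF prob_space_N] by (intro nn_integral_cong) simp
  also have "\<dots> = 1" using prob_space.emeasure_space_1[OF prob_space_Lam] by simp
  finally show "emeasure J (space J) = 1" .
qed

sublocale Lam: prob_space Lam by (rule prob_space_Lam)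
sublocale J: prob_space J by (rule prob_space_J)

lemma space_Y_nonempty: "space \<mu>Y \<noteq> {}"
  using J.not_empty by auto

lemma AE_J_imp:
  assumes "AE z in J. Q z"
  shows "AE x in Lam. AE y in N x. Q (x, y)"
proof -
  obtain A where A: "{z \<in> space J. \<not> Q z} \<subseteq> A" "emeasure J A = 0" "A \<in> sets J"
    using assms by (rule AE_E)
  then have [measurable]: "A \<in> sets \<mu>XY" by simp
  have "0 = (\<integral>\<^sup>+z. indicator A z \<partial>J)" using A by simp
  also have "\<dots> = (\<integral>\<^sup>+x. (\<integral>\<^sup>+y. indicator A (x, y) \<partial>N x) \<partial>Lam)" by (rule nn_integral_J) simp
  finally have z: "(\<integral>\<^sup>+x. (\<integral>\<^sup>+y. indicator A (x, y) \<partial>N x) \<partial>Lam) = 0" by simp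
  have "(\<lambda>x. \<integral>\<^sup>+y. indicator A (x, y) \<partial>N x) \<in> borel_measurable Lam" by measurable
  with z have "AE x in Lam. (\<integral>\<^sup>+y. indicator A (x, y) \<partial>N x) = 0"
    by (simp add: nn_integral_0_iff_AE)
  then show ?thesis
  proof (rule AE_mp, intro AE_I2[of Lam] impI)
    fix x assume x [measurable]: "x \<in> space Lam" and 0: "(\<integral>\<^sup>+y. indicator A (x, y) \<partial>N x) = 0"
    have [measurable]: "x \<in> space \<mu>X" using x by simp
    have "AE y in N x. indicator A (x, y) = (0::ennreal)"
      using 0 by (subst (asm) nn_integral_0_iff_AE) measurable
    moreover have "AE y in N x. y \<in> space \<mu>Y" using AE_space[of "N x"] by simp
    ultimately show "AE y in N x. Q (x, y)"
      by eventually_elim (use A(1) x in \<open>auto split: split_indicator_asm\<close>)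
  qed
qed

lemma AE_J_I:
  assumes [measurable]: "Measurable.pred \<mu>XY Q"
    and ae: "AE x in Lam. AE y in N x. Q (x, y)"
  shows "AE z in J. Q z"
proof -
  let ?A = "{z \<in> space \<mu>XY. \<not> Q z}"
  have "emeasure J ?A = (\<integral>\<^sup>+z. indicator ?A z \<partial>J)" by simp
  also have "\<dots> = (\<integral>\<^sup>+x. (\<integral>\<^sup>+y. indicator ?A (x, y) \<partial>N x) \<partial>Lam)" by (rule nn_integral_J) simp
  also have "\<dots> = (\<integral>\<^sup>+x. 0 \<partial>Lam)"
  proof (rule nn_integral_cong_AE, use ae in eventually_elim)
    fix x assume "AE y in N x. Q (x, y)"
    then have "(\<integral>\<^sup>+y. indicator ?A (x, y) \<partial>N x) = (\<integral>\<^sup>+y. 0 \<partial>N x)"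
      by (intro nn_integral_cong_AE) (auto elim!: eventually_mono)
    then show "(\<integral>\<^sup>+y. indicator ?A (x, y) \<partial>N x) = 0" by simp
  qed
  finally have "emeasure J ?A = 0" by simp
  then show ?thesis by (intro AE_I[of _ _ ?A]) (auto simp: space_pair_measure)
qed

lemma AE_J_fst_iff:
  "(AE z in J. Q (fst z)) \<longleftrightarrow> (AE x in Lam. Q x)"
proof
  assume "AE z in J. Q (fst z)"
  from AE_J_imp[OF this] have "AE x in Lam. AE y in N x. Q x" by simp
  then show "AE x in Lam. Q x"
    by (rule AE_mp) (auto intro!: AE_I2 simp: prob_space.AE_const[OF prob_space_N])
next
  assume "AE x in Lam. Q x"
  then obtain A where A: "{x \<in> space Lam. \<not> Q x} \<subseteq> A" "emeasure Lam A = 0" "A \<in> sets Lam"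
    by (rule AE_E)
  then have [measurable]: "A \<in> sets \<mu>X" by simp
  have "AE x in Lam. x \<notin> A" using A by (intro AE_not_in null_setsI) auto
  then have "AE x in Lam. AE y in N x. fst (x, y) \<notin> A" by eventually_elim simp
  then have "AE z in J. fst z \<notin> A" by (intro AE_J_I) auto
  moreover have "AE z in J. z \<in> space J" by (rule AE_space)
  ultimately show "AE z in J. Q (fst z)"
    by eventually_elim (use A(1) in auto)
qed

lemma integral_J_density:
  fixes h :: "'a \<times> 'b \<Rightarrow> real"
  assumes [measurable]: "h \<in> borel_measurable \<mu>XY"
  shows "(LINT z|J. h z) = (LINT z|\<mu>XY. phi z * h z)"
    and "integrable J h \<longleftrightarrow> integrable \<mu>XY (\<lambda>z. phi z * h z)"
proof -
  have ae: "AE z in \<mu>XY. 0 \<le> phi z" by (intro AE_I2 phi_nonneg)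
  show "(LINT z|J. h z) = (LINT z|\<mu>XY. phi z * h z)"
    unfolding J_def using ae by (subst integral_density) auto
  show "integrable J h \<longleftrightarrow> integrable \<mu>XY (\<lambda>z. phi z * h z)"
    unfolding J_def using ae by (subst integrable_density) auto
qed

lemma integrable_phi: "integrable \<mu>XY phi"
  using integral_J_density(2)[of "\<lambda>_. 1"] by simp

lemma integral_Lam_density:
  fixes h :: "'a \<Rightarrow> real"
  assumes [measurable]: "h \<in> borel_measurable \<mu>X"
  shows "(LINT x|Lam. h x) = (LINT x|\<mu>X. lam x * h x)"
    and "integrable Lam h \<longleftrightarrow> integrable \<mu>X (\<lambda>x. lam x * h x)"
proof -
  have ae: "AE x in \<mu>X. 0 \<le> lam x" by (intro AE_I2 lam_nonneg)
  show "(LINT x|Lam. h x) = (LINT x|\<mu>X. lam x * h x)"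
    unfolding Lam_def using ae by (subst integral_density) auto
  show "integrable Lam h \<longleftrightarrow> integrable \<mu>X (\<lambda>x. lam x * h x)"
    unfolding Lam_def using ae by (subst integrable_density) auto
qed

lemma integral_N_density:
  fixes h :: "'b \<Rightarrow> real"
  assumes x [measurable]: "x \<in> space \<mu>X" and [measurable]: "h \<in> borel_measurable \<mu>Y"
  shows "(LINT y|N x. h y) = (LINT y|\<mu>Y. eta x y * h y)"
    and "integrable (N x) h \<longleftrightarrow> integrable \<mu>Y (\<lambda>y. eta x y * h y)"
proof -
  have ae: "AE y in \<mu>Y. 0 \<le> eta x y" by (intro AE_I2 eta_nonneg x)
  show "(LINT y|N x. h y) = (LINT y|\<mu>Y. eta x y * h y)"
    unfolding N_def using ae by (subst integral_density) auto
  show "integrable (N x) h \<longleftrightarrow> integrable \<mu>Y (\<lambda>y. eta x y * h y)"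
    unfolding N_def using ae by (subst integrable_density) auto
qed

lemma integral_N_meas [measurable]:
  assumes [measurable]: "(h :: 'a \<times> 'b \<Rightarrow> real) \<in> borel_measurable \<mu>XY"
  shows "(\<lambda>x. LINT y|N x. h (x, y)) \<in> borel_measurable \<mu>X"
proof -
  have *: "(\<lambda>x. LINT y|\<mu>Y. eta x y *\<^sub>R h (x, y)) \<in> borel_measurable \<mu>X"
    by (rule XY.M2.borel_measurable_lebesgue_integral) (simp add: split_beta')
  show ?thesis
    by (rule measurable_cong[where M = \<mu>X, THEN iffD1, OF _ *]) (simp add: integral_N_density(1))
qed

lemma
  fixes h :: "'a \<times> 'b \<Rightarrow> real"
  assumes "integrable J h"
  shows AE_integrable_N: "AE x in Lam. integrable (N x) (\<lambda>y. h (x, y))"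
    and integrable_integral_N: "integrable Lam (\<lambda>x. LINT y|N x. h (x, y))"
    and integral_J: "(LINT z|J. h z) = (LINT x|Lam. (LINT y|N x. h (x, y)))"
proof -
  have h [measurable]: "h \<in> borel_measurable \<mu>XY"
    using borel_measurable_integrable[OF assms] by simp
  have i: "integrable \<mu>XY (\<lambda>z. phi z * h z)"
    using assms by (simp add: integral_J_density(2))
  have eq: "(LINT y|\<mu>Y. phi (x, y) * h (x, y)) = lam x * (LINT y|N x. h (x, y))" if [measurable]: "x \<in> space \<mu>X" for x
    by (simp add: integral_N_density(1) that phi_def mult.assoc)
  have "AE x in \<mu>X. integrable \<mu>Y (\<lambda>y. phi (x, y) * h (x, y))"
    by (rule XY.AE_integrable_fst'[OF i])
  moreover have "AE x in \<mu>X. x \<in> space \<mu>X" by (rule AE_space)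
  \<comment> \<open>Integrability under \<mu>X speaks of \<open>lam x\<close> times the slice, so it
    says nothing where \<open>lam x = 0\<close>; such x form a null set of
    \<open>Lam\<close>.\<close>
  ultimately have "AE x in \<mu>X. 0 < lam x \<longrightarrow> integrable (N x) (\<lambda>y. h (x, y))"
  proof eventually_elim
    case (elim x)
    note [measurable] = elim(2)
    from elim(1) show ?case
      by (auto simp: integral_N_density(2) elim(2) phi_def mult.assoc)
  qed
  then show "AE x in Lam. integrable (N x) (\<lambda>y. h (x, y))"
    unfolding Lam_def by (subst AE_density) auto
  have "integrable \<mu>X (\<lambda>x. lam x * (LINT y|N x. h (x, y)))"
    using XY.integrable_fst'[OF i] eq by (simp cong: Bochner_Integration.integrable_cong)
  then show "integrable Lam (\<lambda>x. LINT y|N x. h (x, y))"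
    by (subst integral_Lam_density(2)) auto
  have "(LINT z|J. h z) = (LINT x|\<mu>X. (LINT y|\<mu>Y. phi (x, y) * h (x, y)))"
    unfolding integral_J_density(1)[OF h] by (rule XY.integral_fst'[OF i, symmetric])
  also have "\<dots> = (LINT x|Lam. (LINT y|N x. h (x, y)))"
    unfolding integral_Lam_density(1)[OF integral_N_meas[OF h]]
    by (intro Bochner_Integration.integral_cong eq refl)
  finally show "(LINT z|J. h z) = (LINT x|Lam. (LINT y|N x. h (x, y)))" .
qed

lemma distr_fst_J: "distr J \<mu>X fst = Lam"
proof (rule measure_eqI)
  fix A assume "A \<in> sets (distr J \<mu>X fst)"
  then have [measurable]: "A \<in> sets \<mu>X" by simp
  have "emeasure (distr J \<mu>X fst) A = (\<integral>\<^sup>+z. indicator A (fst z) \<partial>J)"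
    by (subst nn_integral_indicator[symmetric], simp, subst nn_integral_distr) auto
  also have "\<dots> = (\<integral>\<^sup>+x. (\<integral>\<^sup>+y. indicator A x \<partial>N x) \<partial>Lam)" by (subst nn_integral_J) auto
  also have "\<dots> = (\<integral>\<^sup>+x. indicator A x \<partial>Lam)"
    using prob_space.emeasure_space_1[OF prob_space_N] by (intro nn_integral_cong) simp
  finally show "emeasure (distr J \<mu>X fst) A = emeasure Lam A" by simp
qed simp

lemma
  fixes g :: "'a \<Rightarrow> real"
  assumes [measurable]: "g \<in> borel_measurable \<mu>X"
  shows integrable_J_fst_iff: "integrable J (\<lambda>z. g (fst z)) \<longleftrightarrow> integrable Lam g"
    and integral_J_fst: "(LINT z|J. g (fst z)) = (LINT x|Lam. g x)"
  unfolding distr_fst_J[symmetric]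
  by (subst integrable_distr_eq, auto) (subst integral_distr, auto)

lemma fst_Pi: "fst \<in> space \<mu>X \<times> space \<mu>Y \<rightarrow> space \<mu>X"
  by auto

lemma subalgebra_fst: "subalgebra J (vimage_algebra (space \<mu>X \<times> space \<mu>Y) fst \<mu>X)"
  unfolding subalgebra_def using measurable_fst[of \<mu>X \<mu>Y]
  by (auto simp: sets_vimage_algebra2[OF fst_Pi] space_pair_measure dest: measurable_sets)

text \<open>Sets of the sigma-field generated by X are cylinders, so Fubini verifies the defining
  integral identity. From here on, conditioning on X is integration against \<open>N x\<close>,
  slice by slice.\<close>

lemma real_cond_exp_fst:
  assumes h: "integrable J h"
  shows "AE z in J. real_cond_exp J (vimage_algebra (space \<mu>X \<times> space \<mu>Y) fst \<mu>X) h z = (LINT y|N (fst z). h (fst z, y))"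
proof -
  let ?F = "vimage_algebra (space \<mu>X \<times> space \<mu>Y) fst \<mu>X"
  interpret F: finite_measure_subalgebra J ?F
    by (intro finite_measure_subalgebra.intro finite_measure_subalgebra_axioms.intro subalgebra_fst)
      unfold_locales
  have [measurable]: "h \<in> borel_measurable \<mu>XY"
    using borel_measurable_integrable[OF h] by simp
  have fstF: "fst \<in> measurable ?F \<mu>X" by (rule measurable_vimage_algebra1) auto
  show ?thesis
  proof (rule F.real_cond_exp_charact)
    fix A assume "A \<in> sets ?F"
    then obtain A0 where A: "A = fst -` A0 \<inter> (space \<mu>X \<times> space \<mu>Y)" and A0 [measurable]: "A0 \<in> sets \<mu>X"
      by (auto simp: sets_vimage_algebra2[OF fst_Pi])
    have ind: "indicator A z = (indicator A0 (fst z) :: real)" if "z \<in> space J" for z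
      using that by (auto simp: A indicator_def)
    have "A \<in> sets J"
      using subalgebra_fst \<open>A \<in> sets ?F\<close> by (auto simp: subalgebra_def)
    from integrable_mult_indicator[OF this h]
    have i1: "integrable J (\<lambda>z. indicator A0 (fst z) * h z)"
      by (rule Bochner_Integration.integrable_cong[OF refl, THEN iffD1, rotated]) (simp add: ind)
    have "(\<integral>z\<in>A. h z \<partial>J) = (LINT z|J. indicator A0 (fst z) * h z)"
      unfolding set_lebesgue_integral_def by (intro Bochner_Integration.integral_cong) (auto simp: ind)
    also have "\<dots> = (LINT x|Lam. indicator A0 x * (LINT y|N x. h (x, y)))"
      by (subst integral_J[OF i1]) simp
    also have "\<dots> = (LINT z|J. indicator A0 (fst z) * (LINT y|N (fst z). h (fst z, y)))"
      by (rule integral_J_fst[symmetric]) measurable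
    also have "\<dots> = (\<integral>z\<in>A. (LINT y|N (fst z). h (fst z, y)) \<partial>J)"
      unfolding set_lebesgue_integral_def by (intro Bochner_Integration.integral_cong) (auto simp: ind)
    finally show "(\<integral>z\<in>A. h z \<partial>J) = (\<integral>z\<in>A. (LINT y|N (fst z). h (fst z, y)) \<partial>J)" .
  next
    show "integrable J (\<lambda>z. LINT y|N (fst z). h (fst z, y))"
      using integrable_integral_N[OF h] by (subst integrable_J_fst_iff) auto
    show "(\<lambda>z. LINT y|N (fst z). h (fst z, y)) \<in> borel_measurable ?F"
      by (rule measurable_compose[OF fstF]) measurable
  qed fact
qed

lemma slice_measurable:
  assumes "(\<lambda>z. g (fst z)) \<in> borel_measurable \<mu>XY"
  shows "g \<in> borel_measurable \<mu>X"
proof -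
  obtain y0 where y0: "y0 \<in> space \<mu>Y" using space_Y_nonempty by auto
  from measurable_compose[OF measurable_Pair2'[OF y0] assms] show ?thesis by simp
qed

lemma is_cond_exp_fstD:
  assumes ce: "is_cond_exp J (vimage_algebra (space \<mu>X \<times> space \<mu>Y) fst \<mu>X) h (\<lambda>(x, y). g x)"
  shows "integrable J h" "g \<in> borel_measurable \<mu>X" "AE x in Lam. g x = (LINT y|N x. h (x, y))"
proof -
  show h: "integrable J h" using ce by (simp add: is_cond_exp_def)
  have "(\<lambda>(x, y). g x) \<in> borel_measurable J"
    using ce measurable_from_subalg unfolding is_cond_exp_def by blast
  then show "g \<in> borel_measurable \<mu>X" by (intro slice_measurable) (simp add: split_beta')
  have "AE z in J. g (fst z) = (LINT y|N (fst z). h (fst z, y))"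
    using ce real_cond_exp_fst[OF h] unfolding is_cond_exp_def by (auto simp: split_beta')
  then show "AE x in Lam. g x = (LINT y|N x. h (x, y))"
    by (simp add: AE_J_fst_iff[of "\<lambda>x. g x = (LINT y|N x. h (x, y))"])
qed

text \<open>The given conditional expectations concern \<open>\<tau>\<close> and
  \<open>\<tau>c\<close>, which are determined only up to null sets. This allows them to be computed
  with bounded representatives instead.\<close>

lemma is_cond_exp_fst_AE:
  assumes ce: "is_cond_exp J (vimage_algebra (space \<mu>X \<times> space \<mu>Y) fst \<mu>X) h (\<lambda>(x, y). g x)"
    and h' [measurable]: "h' \<in> borel_measurable \<mu>XY" and eq: "AE z in J. h z = h' z"
  shows "AE x in Lam. g x = (LINT y|N x. h' (x, y))"
proof -
  have [measurable]: "h \<in> borel_measurable \<mu>XY"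
    using borel_measurable_integrable[OF is_cond_exp_fstD(1)[OF ce]] by simp
  show ?thesis
    using is_cond_exp_fstD(3)[OF ce] AE_J_imp[OF eq] AE_space[of Lam]
  proof eventually_elim
    case (elim x)
    then have [measurable]: "x \<in> space \<mu>X" by simp
    have "(LINT y|N x. h (x, y)) = (LINT y|N x. h' (x, y))"
      by (rule integral_cong_AE) (use elim(2) in measurable)
    with elim(1) show ?case by simp
  qed
qed

lemma is_cond_exp_fstI:
  assumes h: "integrable J h"
  shows "is_cond_exp J (vimage_algebra (space \<mu>X \<times> space \<mu>Y) fst \<mu>X) h (\<lambda>(x, y). \<integral>y'. h (x, y') \<partial>N x)"
proof -
  have [measurable]: "h \<in> borel_measurable \<mu>XY"
    using borel_measurable_integrable[OF h] by simp
  have fstF: "fst \<in> measurable (vimage_algebra (space \<mu>X \<times> space \<mu>Y) fst \<mu>X) \<mu>X"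
    by (rule measurable_vimage_algebra1) auto
  have "(\<lambda>z. LINT y|N (fst z). h (fst z, y)) \<in> borel_measurable (vimage_algebra (space \<mu>X \<times> space \<mu>Y) fst \<mu>X)"
    by (rule measurable_compose[OF fstF]) measurable
  with h real_cond_exp_fst[OF h] subalgebra_fst show ?thesis
    by (simp add: is_cond_exp_def split_beta')
qed

end

section \<open>Densities and the Hellinger distance\<close>

lemma densities_measurable: "p \<in> densities M \<Longrightarrow> p \<in> borel_measurable M"
  and densities_nonneg: "p \<in> densities M \<Longrightarrow> z \<in> space M \<Longrightarrow> 0 \<le> p z"
  by (auto simp: densities_def)

lemma densities_has_bochner_integral:
  assumes "p \<in> densities M"
  shows "has_bochner_integral M p 1"
  by (rule has_bochner_integral_nn_integral) (use assms in \<open>auto simp: densities_def intro!: AE_I2\<close>)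

lemma densities_integrable: "p \<in> densities M \<Longrightarrow> integrable M p"
  and densities_integral: "p \<in> densities M \<Longrightarrow> (LINT z|M. p z) = 1"
  using densities_has_bochner_integral by (auto simp: has_bochner_integral_iff)

lemma densitiesI:
  assumes "integrable M p" "\<And>z. z \<in> space M \<Longrightarrow> 0 \<le> p z" "(LINT z|M. p z) = 1"
  shows "p \<in> densities M"
proof -
  have "(\<integral>\<^sup>+z. ennreal (p z) \<partial>M) = 1"
    by (subst nn_integral_eq_integral) (use assms in \<open>auto intro!: AE_I2\<close>)
  with assms show ?thesis by (auto simp: densities_def)
qed

lemma integrable_mult_bounded:
  fixes g h :: "'a \<Rightarrow> real"
  assumes "integrable M h" "g \<in> borel_measurable M" "AE z in M. \<bar>g z\<bar> \<le> K"
  shows "integrable M (\<lambda>z. g z * h z)"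
proof (rule Bochner_Integration.integrable_bound)
  show "integrable M (\<lambda>z. K * h z)" using assms(1) by simp
  show "AE z in M. norm (g z * h z) \<le> norm (K * h z)"
    using assms(3) by eventually_elim (auto simp: abs_mult intro!: mult_right_mono)
qed (use assms in auto)

lemma sqrt_density_L2: "p \<in> densities M \<Longrightarrow> (\<lambda>z. sqrt (p z)) \<in> L2_space M"
  using densities_measurable[of p M] densities_integrable[of p M]
  by (intro L2_spaceI) (auto simp: densities_nonneg cong: Bochner_Integration.integrable_cong)

text \<open>The joint Hellinger distance of \<open>a\<^sup>2 p\<close> and \<open>c\<^sup>2 q\<close> controls the change of the mean of \<open>g\<close> and the
  change of the total mass at the same time, so that their product is of second order.\<close>

lemma mean_diff_mult_mass_diff_le_hellinger:
  assumes p: "p \<in> densities M" and q: "q \<in> densities M"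
    and g: "g \<in> borel_measurable M" and gK: "\<And>z. z \<in> space M \<Longrightarrow> \<bar>g z\<bar> \<le> K"
    and a: "0 \<le> a" and c: "0 \<le> c"
  shows "\<bar>(LINT z|M. g z * p z) - (LINT z|M. g z * q z)\<bar> * \<bar>a\<^sup>2 - c\<^sup>2\<bar>
      \<le> (1 + 8 * K\<^sup>2) * (LINT z|M. (a * sqrt (p z) - c * sqrt (q z))\<^sup>2)"
proof -
  define u w where "u = (\<lambda>z. sqrt (p z))" and "w = (\<lambda>z. sqrt (q z))"
  note u_w_def = this
  have uL: "u \<in> L2_space M" and wL: "w \<in> L2_space M"
    using sqrt_density_L2[OF p] sqrt_density_L2[OF q] by (auto simp: u_w_def)
  have u2: "(u z)\<^sup>2 = p z" and w2: "(w z)\<^sup>2 = q z" if "z \<in> space M" for z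
    using densities_nonneg[OF p that] densities_nonneg[OF q that] by (auto simp: u_w_def)
  have iu: "(LINT z|M. (u z)\<^sup>2) = 1" "(LINT z|M. (w z)\<^sup>2) = 1"
    using densities_integral[OF p] densities_integral[OF q]
    by (simp_all add: u2 w2 cong: Bochner_Integration.integral_cong)
  define \<rho> where "\<rho> = (LINT z|M. u z * w z)"
  have uw: "integrable M (\<lambda>z. u z * w z)" by (rule L2_space_integrable_mult[OF uL wL])
  have sq: "(LINT z|M. (s * u z + t * w z)\<^sup>2) = s\<^sup>2 + t\<^sup>2 + 2 * (s * t) * \<rho>" for s t
  proof -
    have "(LINT z|M. (s * u z + t * w z)\<^sup>2) = (LINT z|M. s\<^sup>2 * (u z)\<^sup>2 + t\<^sup>2 * (w z)\<^sup>2 + 2 * (s * t) * (u z * w z))"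
      by (simp add: power2_sum power_mult_distrib algebra_simps)
    also have "\<dots> = s\<^sup>2 + t\<^sup>2 + 2 * (s * t) * \<rho>"
      using uL wL uw by (simp add: L2_space_def iu \<rho>_def)
    finally show ?thesis .
  qed
  define H where "H = (LINT z|M. (u z - w z)\<^sup>2)"
  have H: "H = 2 - 2 * \<rho>" using sq[of 1 "-1"] by (simp add: H_def)
  have S: "(LINT z|M. (u z + w z)\<^sup>2) = 2 + 2 * \<rho>" using sq[of 1 1] by simp
  have H0: "0 \<le> H" by (simp add: H_def)
  define D where "D = (LINT z|M. g z * p z) - (LINT z|M. g z * q z)"
  have gae: "AE z in M. \<bar>g z\<bar> \<le> K" using gK by (intro AE_I2)
  have ip: "integrable M (\<lambda>z. g z * p z)" "integrable M (\<lambda>z. g z * q z)"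
    by (rule integrable_mult_bounded[OF densities_integrable[OF p] g gae]
             integrable_mult_bounded[OF densities_integrable[OF q] g gae])+
  have K0: "0 \<le> K" if "space M \<noteq> {}" using that gK by fastforce
  have "space M \<noteq> {}"
    using densities_integral[OF p] Bochner_Integration.integral_cong[OF refl, of M p "\<lambda>_. 0"] by auto
  with K0 have K: "0 \<le> K" by blast
  have dL: "(\<lambda>z. u z - w z) \<in> L2_space M" by (rule L2_space_diff[OF uL wL])
  have gdL: "(\<lambda>z. g z * (u z - w z)) \<in> L2_space M" by (rule L2_space_mult_bounded[OF dL g gae])
  have "D = (LINT z|M. g z * p z - g z * q z)" using ip by (simp add: D_def)
  also have "\<dots> = L2_inner M (\<lambda>z. g z * (u z - w z)) (\<lambda>z. u z + w z)"
    unfolding L2_inner_def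
    by (intro Bochner_Integration.integral_cong refl)
       (simp flip: u2 w2 add: power2_eq_square algebra_simps)
  finally have "\<bar>D\<bar> \<le> L2_norm M (\<lambda>z. g z * (u z - w z)) * L2_norm M (\<lambda>z. u z + w z)"
    using L2_Cauchy_Schwarz[OF gdL L2_space_add[OF uL wL]] by simp
  then have "D\<^sup>2 \<le> (L2_norm M (\<lambda>z. g z * (u z - w z)) * L2_norm M (\<lambda>z. u z + w z))\<^sup>2"
    using power_mono[of "\<bar>D\<bar>" _ 2] by simp
  also have "\<dots> = (LINT z|M. (g z * (u z - w z))\<^sup>2) * (2 + 2 * \<rho>)"
    by (simp add: power_mult_distrib L2_norm_power2 S)
  also have "\<dots> \<le> (K\<^sup>2 * H) * 4"
  proof (rule mult_mono)
    have "(LINT z|M. (g z * (u z - w z))\<^sup>2) \<le> (LINT z|M. K\<^sup>2 * (u z - w z)\<^sup>2)"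
    proof (rule integral_mono)
      fix z assume "z \<in> space M"
      from power_mono[OF gK[OF this], of 2] have "(g z)\<^sup>2 \<le> K\<^sup>2" by simp
      then show "(g z * (u z - w z))\<^sup>2 \<le> K\<^sup>2 * (u z - w z)\<^sup>2"
        by (simp add: power_mult_distrib mult_right_mono)
    qed (use gdL dL in \<open>auto simp: L2_space_def\<close>)
    then show "(LINT z|M. (g z * (u z - w z))\<^sup>2) \<le> K\<^sup>2 * H" by (simp add: H_def)
    show "2 + 2 * \<rho> \<le> 4" using H H0 by simp
    show "0 \<le> K\<^sup>2 * H" using H0 by simp
    have "0 \<le> (LINT z|M. (u z + w z)\<^sup>2)" by simp
    then show "0 \<le> 2 + 2 * \<rho>" using S by simp
  qed
  finally have D2: "D\<^sup>2 \<le> 4 * K\<^sup>2 * H" by (simp add: algebra_simps)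
  have \<rho>0: "0 \<le> \<rho>"
    unfolding \<rho>_def using p q by (intro Bochner_Integration.integral_nonneg) (auto simp: u_w_def densities_nonneg)
  then have "H \<le> 2" using H by simp
  then have "4 * K\<^sup>2 * H \<le> 4 * K\<^sup>2 * 2" by (rule mult_left_mono) simp
  \<comment> \<open>Both bounds for D^2 are kept: the constant one will multiply (a - c)^2, the one
    proportional to \<open>H\<close> will multiply a c.\<close>
  from order_trans[OF D2 this] have D2': "D\<^sup>2 \<le> 8 * K\<^sup>2" by simp
  \<comment> \<open>The joint distance splits into the change of mass (a - c)^2 and the Hellinger
    distance \<open>H\<close> of the normalized densities, weighted by a c.\<close>
  have NN: "(LINT z|M. (a * u z - c * w z)\<^sup>2) = (a - c)\<^sup>2 + a * c * H"
    using sq[of a "-c"] by (simp add: H power2_diff algebra_simps)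
  have "\<bar>a\<^sup>2 - c\<^sup>2\<bar> = \<bar>a + c\<bar> * \<bar>a - c\<bar>"
    unfolding power2_eq_square square_diff_square_factored by (rule abs_mult)
  \<comment> \<open>The product is grouped so that 2xy \<le> x^2 + y^2 applies with x = |a - c| and
    y = |D|(a + c); then (a + c)^2 = (a - c)^2 + 4ac matches the two parts of the distance.\<close>
  then have "2 * (\<bar>D\<bar> * \<bar>a\<^sup>2 - c\<^sup>2\<bar>) = 2 * (\<bar>a - c\<bar> * (\<bar>D\<bar> * (a + c)))"
    using a c by simp
  also have "\<dots> \<le> (a - c)\<^sup>2 + D\<^sup>2 * (a + c)\<^sup>2"
    using sum_squares_bound[of "\<bar>a - c\<bar>" "\<bar>D\<bar> * (a + c)"] by (simp add: power_mult_distrib)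
  also have "\<dots> = (a - c)\<^sup>2 + D\<^sup>2 * (a - c)\<^sup>2 + 4 * (a * c) * D\<^sup>2"
    by (simp add: power2_eq_square algebra_simps)
  also have "\<dots> \<le> (a - c)\<^sup>2 + (8 * K\<^sup>2) * (a - c)\<^sup>2 + 4 * (a * c) * (4 * K\<^sup>2 * H)"
    using a c by (intro add_mono mult_mono D2 D2' order_refl) auto
  also have "\<dots> \<le> 2 * ((1 + 8 * K\<^sup>2) * ((a - c)\<^sup>2 + a * c * H))"
  proof -
    define X Y where "X = (a - c)\<^sup>2" and "Y = a * c * H"
    have "0 \<le> X" "0 \<le> K\<^sup>2 * X" "0 \<le> Y" using a c H0 by (auto simp: X_def Y_def)
    moreover have "X + 8 * K\<^sup>2 * X + 4 * (a * c) * (4 * K\<^sup>2 * H) = X + 8 * (K\<^sup>2 * X) + 16 * (K\<^sup>2 * Y)"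
      by (simp add: Y_def)
    moreover have "2 * ((1 + 8 * K\<^sup>2) * (X + Y)) = 2 * X + 2 * Y + 16 * (K\<^sup>2 * X) + 16 * (K\<^sup>2 * Y)"
      by (simp add: ring_distribs)
    ultimately show ?thesis unfolding X_def[symmetric] Y_def[symmetric] by linarith
  qed
  finally show ?thesis using NN by (simp add: D_def u_w_def)
qed

section \<open>Positivity of the densities and bounded representatives\<close>

context joint_density
begin

lemma AE_Lam_I: "AE x in \<mu>X. Q x \<Longrightarrow> AE x in Lam. Q x"
  unfolding Lam_def by (subst AE_density) auto

lemma AE_J_I': "AE z in \<mu>XY. Q z \<Longrightarrow> AE z in J. Q z"
  unfolding J_def by (subst AE_density) auto

lemma AE_N_I: "x \<in> space \<mu>X \<Longrightarrow> AE y in \<mu>Y. Q y \<Longrightarrow> AE y in N x. Q y"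
  unfolding N_def by (subst AE_density) auto

lemma AE_eta_pos:
  assumes phi_pos: "AE z in \<mu>XY. 0 < phi z"
  shows "AE x in \<mu>X. 0 < lam x \<and> (AE y in \<mu>Y. 0 < eta x y)"
proof -
  have "AE x in \<mu>X. AE y in \<mu>Y. 0 < phi (x, y)" using XY.AE_pair[OF phi_pos] .
  moreover have "AE x in \<mu>X. x \<in> space \<mu>X" by (rule AE_space)
  ultimately show ?thesis
  proof eventually_elim
    case (elim x)
    have "AE y in \<mu>Y. y \<in> space \<mu>Y" by (rule AE_space)
    with elim(1) have *: "AE y in \<mu>Y. 0 < lam x \<and> 0 < eta x y"
      by eventually_elim
         (use lam_nonneg[OF elim(2)] eta_nonneg[OF elim(2)] in \<open>auto simp: phi_def zero_less_mult_iff\<close>)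
    \<comment> \<open>An almost sure statement about \<open>y\<close> that does not contain
      \<open>y\<close> holds outright, since \<open>N x\<close> has mass one.\<close>
    then have "AE y in \<mu>Y. 0 < lam x" by eventually_elim simp
    then have "0 < lam x"
      using AE_N_I[OF elim(2)] prob_space.AE_const[OF prob_space_N[OF elim(2)]] by blast
    with * show ?case by auto
  qed
qed

end

text \<open>\<open>m\<close> is the version of the conditional mean that satisfies the constraint at
  every x; \<open>m_meas_sigma\<close> and \<open>m_eq\<close> are what the constraint yields for
  the true density. The bound \<open>K\<close> is assumed here and supplied from the
  differentiability of the functional in the final proof.\<close>

locale central_model = joint_density \<mu>X \<mu>Y lam eta
  for \<mu>X :: "(real^'d) measure" and \<mu>Y :: "real measure"
    and lam :: "real^'d \<Rightarrow> real" and eta :: "real^'d \<Rightarrow> real \<Rightarrow> real" +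
  fixes B :: "real^'s^'d" and f :: "real \<Rightarrow> real" and m :: "real^'d \<Rightarrow> real" and K :: real
  assumes f_meas [measurable]: "f \<in> borel_measurable \<mu>Y"
    and f_bound: "AE y in \<mu>Y. \<bar>f y\<bar> \<le> K" and K_nonneg: "0 \<le> K"
    and phi_pos: "AE z in \<mu>X \<Otimes>\<^sub>M \<mu>Y. 0 < phi z"
    and subalg: "subalgebra Lam (sigma_proj \<mu>X B)"
    and m_meas_sigma: "m \<in> borel_measurable (sigma_proj \<mu>X B)"
    and m_eq: "\<And>x. x \<in> space \<mu>X \<Longrightarrow> stat_functional \<mu>Y f (eta x) = m x"
begin

abbreviation "G \<equiv> sigma_proj \<mu>X B"

abbreviation "tangents \<equiv> curve_tangents \<mu>XY (model \<mu>X \<mu>Y f B) phi"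

sublocale G: finite_measure_subalgebra Lam G
  by (intro finite_measure_subalgebra.intro finite_measure_subalgebra_axioms.intro subalg) unfold_locales

lemma measurable_G: "g \<in> borel_measurable G \<Longrightarrow> g \<in> borel_measurable \<mu>X"
  by (rule measurable_from_subalg[OF subalg, unfolded measurable_cong_sets[OF sets_Lam refl]])

lemma m_meas [measurable]: "m \<in> borel_measurable \<mu>X"
  by (rule measurable_G[OF m_meas_sigma])

text \<open>A version of \<open>f\<close> that is bounded everywhere, so that bounds on conditional means hold at every \<open>x\<close>
  and not only almost everywhere.\<close>

definition fb :: "real \<Rightarrow> real" where "fb y = max (- K) (min K (f y))"

lemma fb_meas [measurable]: "fb \<in> borel_measurable \<mu>Y"
  unfolding fb_def by (intro borel_measurable_max borel_measurable_min borel_measurable_const f_meas)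

lemma fb_bound: "\<bar>fb y\<bar> \<le> K"
  using K_nonneg by (auto simp: fb_def max_def min_def)

lemma fb_eq: "AE y in \<mu>Y. fb y = f y"
  using f_bound by eventually_elim (auto simp: fb_def)

lemma stat_functional_fb:
  assumes [measurable]: "p \<in> borel_measurable \<mu>Y"
  shows "stat_functional \<mu>Y f p = (LINT y|\<mu>Y. fb y * p y)"
  unfolding stat_functional_def
  by (rule integral_cong_AE, measurable, use fb_eq in eventually_elim) simp

text \<open>A representative of \<tau>c that is bounded by \<open>2 * K\<close> everywhere and
  centered under every \<open>N x\<close>.\<close>

definition tb :: "(real^'d) \<times> real \<Rightarrow> real" where "tb z = fb (snd z) - m (fst z)"

lemma tb_meas [measurable]: "tb \<in> borel_measurable \<mu>XY"
  unfolding tb_def by measurable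

lemma m_eq_integral_N: "x \<in> space \<mu>X \<Longrightarrow> m x = (LINT y|N x. fb y)"
proof -
  assume x [measurable]: "x \<in> space \<mu>X"
  show "m x = (LINT y|N x. fb y)"
    using m_eq[OF x] stat_functional_fb[of "eta x"] by (simp add: integral_N_density[OF x] mult.commute)
qed

lemma fb_integrable_N: "x \<in> space \<mu>X \<Longrightarrow> integrable (N x) fb"
proof -
  assume x: "x \<in> space \<mu>X"
  interpret prob_space "N x" by (rule prob_space_N[OF x])
  show ?thesis by (rule integrable_const_bound[of _ K]) (auto simp: fb_bound)
qed

lemma m_bound: "x \<in> space \<mu>X \<Longrightarrow> \<bar>m x\<bar> \<le> K"
proof -
  assume x: "x \<in> space \<mu>X"
  interpret prob_space "N x" by (rule prob_space_N[OF x])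
  have "\<bar>LINT y|N x. fb y\<bar> \<le> (LINT y|N x. \<bar>fb y\<bar>)" by (rule integral_abs_bound)
  also have "\<dots> \<le> (LINT y|N x. K)"
    using fb_integrable_N[OF x] by (intro integral_mono) (auto simp: fb_bound)
  finally show ?thesis using prob_space[unfolded space_N] by (simp add: m_eq_integral_N[OF x])
qed

lemma tb_bound: "z \<in> space J \<Longrightarrow> \<bar>tb z\<bar> \<le> 2 * K"
  using m_bound[of "fst z"] fb_bound[of "snd z"] by (auto simp: tb_def)

lemma integral_tb_N: "x \<in> space \<mu>X \<Longrightarrow> (LINT y|N x. tb (x, y)) = 0"
proof -
  assume x: "x \<in> space \<mu>X"
  interpret prob_space "N x" by (rule prob_space_N[OF x])
  show ?thesis using fb_integrable_N[OF x] m_eq_integral_N[OF x] prob_space[unfolded space_N]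
    by (simp add: tb_def)
qed

text \<open>The first identity inverts the passage from a density to its root ratio. The second
  makes the squared norm of a root ratio four times the squared distance of the square
  roots.\<close>

lemma phi_root_ratio:
  assumes "0 < phi z" "0 \<le> \<phi> z"
  shows "phi z * (1 + root_ratio phi \<phi> z / 2)\<^sup>2 = \<phi> z"
    and "phi z * (root_ratio phi \<phi> z)\<^sup>2 = 4 * (sqrt (\<phi> z) - sqrt (phi z))\<^sup>2"
proof -
  have r: "1 + root_ratio phi \<phi> z / 2 = sqrt (\<phi> z) / sqrt (phi z)"
    using assms by (simp add: root_ratio_def diff_divide_distrib)
  show "phi z * (1 + root_ratio phi \<phi> z / 2)\<^sup>2 = \<phi> z"
    using assms by (simp add: r power_divide)
  show "phi z * (root_ratio phi \<phi> z)\<^sup>2 = 4 * (sqrt (\<phi> z) - sqrt (phi z))\<^sup>2"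
    unfolding root_ratio_def power_divide power_mult_distrib using assms by simp
qed

end

section \<open>Tangents satisfy the linearized constraint\<close>

context central_model
begin

lemma mult_tb_bound:
  assumes "\<And>x. x \<in> space \<mu>X \<Longrightarrow> \<bar>b x\<bar> \<le> C" "0 \<le> C" "z \<in> space \<mu>XY"
  shows "\<bar>b (fst z) * tb z\<bar> \<le> C * (2 * K)"
  using assms(1)[of "fst z"] assms(2,3) tb_bound[of z]
  by (auto simp: abs_mult space_pair_measure intro!: mult_mono)

text \<open>Since (1 + r/2)^2 = 1 + r + r^2/4, the mean of \<open>b * tb\<close> under the
  competitor minus its mean under the truth equals the integral of \<open>b * tb\<close> against r +
  r^2/4. The difference of means is of second order by the Hellinger bound, which gives the first
  part of the constant (divided by 4, as \<parallel>r\<parallel>^2 is four times the squared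
  distance). The quadratic term gives the second part, 2CK / 4. The bound \<open>2 * K\<close> in
  \<open>b0\<close> is that of a difference of two conditional means of \<open>fb\<close>.\<close>

lemma integral_score_mult_le:
  assumes \<phi>: "\<phi> \<in> model \<mu>X \<mu>Y f B"
    and b [measurable]: "b \<in> borel_measurable \<mu>X" and bC: "\<And>x. x \<in> space \<mu>X \<Longrightarrow> \<bar>b x\<bar> \<le> C" and C: "0 \<le> C"
    and b0: "\<And>D. D \<in> borel_measurable G \<Longrightarrow> (\<And>x. x \<in> space \<mu>X \<Longrightarrow> \<bar>D x\<bar> \<le> 2 * K) \<Longrightarrow> (LINT x|Lam. b x * D x) = 0"
  shows "root_ratio phi \<phi> \<in> L2_space J"
    and "\<bar>LINT z|J. b (fst z) * tb z * root_ratio phi \<phi> z\<bar>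
          \<le> (C * (1 + 8 * K\<^sup>2) / 4 + C * K / 2) * (LINT z|J. (root_ratio phi \<phi> z)\<^sup>2)"
proof -
  obtain lam' eta' where lam': "lam' \<in> densities \<mu>X" and eta': "eta' \<in> cond_densities \<mu>X \<mu>Y f B lam'"
    and \<phi>_eq: "\<phi> = (\<lambda>(x, y). lam' x * eta' x y)"
    using \<phi> by (auto simp: model_def)
  interpret Q: joint_density \<mu>X \<mu>Y lam' eta'
    by (intro joint_density.intro sigma_finite_X sigma_finite_Y lam')
       (use eta' in \<open>auto simp: cond_densities_def sq_densities_def\<close>)
  have \<phi>Q: "\<phi> = Q.phi" by (simp add: \<phi>_eq Q.phi_def)
  obtain g where gG: "g \<in> borel_measurable G" and g: "\<And>x. x \<in> space \<mu>X \<Longrightarrow> stat_functional \<mu>Y f (eta' x) = g x"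
    using eta' by (auto simp: cond_densities_def constraint_version_def is_cond_exp_def)
  have [measurable]: "g \<in> borel_measurable \<mu>X" by (rule measurable_G[OF gG])
  define R where "R = root_ratio phi Q.phi"
  have [measurable]: "R \<in> borel_measurable \<mu>XY"
    unfolding R_def root_ratio_def by measurable
  define sqd where "sqd z = (sqrt (Q.phi z) - sqrt (phi z))\<^sup>2" for z
  have [measurable]: "sqd \<in> borel_measurable \<mu>XY"
    unfolding sqd_def by measurable
  have isqd: "integrable \<mu>XY sqd"
  proof (rule Bochner_Integration.integrable_bound)
    show "integrable \<mu>XY (\<lambda>z. Q.phi z + phi z)"
      using integrable_phi Q.integrable_phi by simp
    show "AE z in \<mu>XY. norm (sqd z) \<le> norm (Q.phi z + phi z)"
    proof (rule AE_I2)
      fix z assume "z \<in> space \<mu>XY"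
      then have "0 \<le> Q.phi z" "0 \<le> phi z" using phi_nonneg Q.phi_nonneg by auto
      then have "sqd z \<le> Q.phi z + phi z" by (simp add: sqd_def power2_diff)
      moreover have "0 \<le> sqd z" by (simp add: sqd_def)
      ultimately show "norm (sqd z) \<le> norm (Q.phi z + phi z)" by simp
    qed
  qed measurable
  have R2: "AE z in \<mu>XY. phi z * (R z)\<^sup>2 = 4 * sqd z \<and> phi z * (R z + (R z)\<^sup>2 / 4) = Q.phi z - phi z"
  proof -
    have "AE z in \<mu>XY. z \<in> space \<mu>XY" by (rule AE_space)
    with phi_pos show ?thesis
    proof eventually_elim
      case (elim z)
      have "0 \<le> Q.phi z" using elim Q.phi_nonneg by auto
      note * = phi_root_ratio[where \<phi> = Q.phi, OF elim(1) this, folded R_def]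
      have "phi z * (R z + (R z)\<^sup>2 / 4) = phi z * (1 + R z / 2)\<^sup>2 - phi z"
        by (simp add: power2_sum power_divide ring_distribs)
      with * show ?case by (simp add: sqd_def)
    qed
  qed
  have "integrable \<mu>XY (\<lambda>z. phi z * (R z)\<^sup>2)"
    by (rule integrable_cong_AE_imp[where g = "\<lambda>z. 4 * sqd z"])
       (use isqd in simp, measurable, use R2 in eventually_elim, simp)
  then have iR2: "integrable J (\<lambda>z. (R z)\<^sup>2)" by (subst integral_J_density(2)) auto
  then have RL: "R \<in> L2_space J" by (intro L2_spaceI) auto
  then show "root_ratio phi \<phi> \<in> L2_space J" by (simp add: R_def \<phi>Q)
  have R2_eq: "(LINT z|J. (R z)\<^sup>2) = 4 * (LINT z|\<mu>XY. sqd z)"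
  proof -
    have "(LINT z|J. (R z)\<^sup>2) = (LINT z|\<mu>XY. phi z * (R z)\<^sup>2)"
      by (rule integral_J_density) measurable
    also have "\<dots> = (LINT z|\<mu>XY. 4 * sqd z)"
      by (rule integral_cong_AE, measurable, use R2 in eventually_elim) simp
    finally show ?thesis by simp
  qed
  define T where "T z = b (fst z) * tb z" for z
  have [measurable]: "T \<in> borel_measurable \<mu>XY" unfolding T_def by measurable
  note T_bound = mult_tb_bound[of b C, OF bC C, folded T_def]
  have T_ae: "AE z in J. \<bar>T z\<bar> \<le> C * (2 * K)" "AE z in Q.J. \<bar>T z\<bar> \<le> C * (2 * K)"
    using T_bound by (auto intro!: AE_I2 simp: space_pair_measure)
  have iT: "integrable J T" by (rule J.integrable_const_bound[OF _]) (use T_ae in auto)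
  have iTQ: "integrable Q.J T" by (rule Q.J.integrable_const_bound[OF _]) (use T_ae in auto)
  have iTR: "integrable J (\<lambda>z. T z * R z)"
    by (rule integrable_mult_bounded[OF J.L2_space_integrable[OF RL] _ T_ae(1)]) simp
  have iTR2: "integrable J (\<lambda>z. T z * (R z)\<^sup>2)"
    by (rule integrable_mult_bounded[OF iR2 _ T_ae(1)]) simp
  define W where "W x = b x * (g x - m x)" for x
  have [measurable]: "W \<in> borel_measurable \<mu>X" unfolding W_def by measurable
  have QN: "(LINT y|Q.N x. tb (x, y)) = g x - m x" and gK: "\<bar>g x\<bar> \<le> K" if x [measurable]: "x \<in> space \<mu>X" for x
  proof -
    interpret prob_space "Q.N x" by (rule Q.prob_space_N[OF x])
    have i: "integrable (Q.N x) fb" by (rule integrable_const_bound[of _ K]) (auto simp: fb_bound)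
    have "g x = (LINT y|Q.N x. fb y)"
      using g[OF x] stat_functional_fb[of "eta' x"] by (simp add: Q.integral_N_density[OF x] mult.commute)
    then show "(LINT y|Q.N x. tb (x, y)) = g x - m x"
      using i prob_space[unfolded Q.space_N] by (simp add: tb_def)
    have "\<bar>LINT y|Q.N x. fb y\<bar> \<le> (LINT y|Q.N x. \<bar>fb y\<bar>)" by (rule integral_abs_bound)
    also have "\<dots> \<le> (LINT y|Q.N x. K)"
      using i by (intro integral_mono) (auto simp: fb_bound)
    finally show "\<bar>g x\<bar> \<le> K" using \<open>g x = _\<close> prob_space[unfolded Q.space_N] by simp
  qed
  have W_bound: "\<bar>W x\<bar> \<le> C * (2 * K)" if "x \<in> space \<mu>X" for x
    using gK[OF that] m_bound[OF that] bC[OF that] C K_nonneg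
    unfolding W_def abs_mult by (intro mult_mono) auto
  have iW: "integrable Lam W" by (rule Lam.integrable_const_bound[of _ "C * (2 * K)"]) (auto intro!: AE_I2 W_bound)
  have iWQ: "integrable Q.Lam W" by (rule Q.Lam.integrable_const_bound[of _ "C * (2 * K)"]) (auto intro!: AE_I2 W_bound)
  have QT: "(LINT z|Q.J. T z) = (LINT x|Q.Lam. W x)"
    unfolding Q.integral_J[OF iTQ]
    by (intro Bochner_Integration.integral_cong refl) (simp add: T_def W_def QN)
  have JT: "(LINT z|J. T z) = 0"
  proof -
    have "(LINT z|J. T z) = (LINT x|Lam. 0)"
      unfolding integral_J[OF iT]
      by (intro Bochner_Integration.integral_cong refl) (simp add: T_def integral_tb_N)
    then show ?thesis by simp
  qed
  have LW: "(LINT x|Lam. W x) = 0"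
    unfolding W_def
  proof (rule b0)
    show "(\<lambda>x. g x - m x) \<in> borel_measurable G" using gG m_meas_sigma by simp
    show "\<bar>g x - m x\<bar> \<le> 2 * K" if "x \<in> space \<mu>X" for x
      using gK[OF that] m_bound[OF that] by linarith
  qed
  have "(LINT z|J. T z * (R z + (R z)\<^sup>2 / 4)) = (LINT z|\<mu>XY. phi z * (T z * (R z + (R z)\<^sup>2 / 4)))"
    by (rule integral_J_density) measurable
  also have "\<dots> = (LINT z|\<mu>XY. Q.phi z * T z - phi z * T z)"
  proof (rule integral_cong_AE, measurable, use R2 in eventually_elim)
    fix z assume "phi z * (R z)\<^sup>2 = 4 * sqd z \<and> phi z * (R z + (R z)\<^sup>2 / 4) = Q.phi z - phi z"
    then have "phi z * (R z + (R z)\<^sup>2 / 4) * T z = (Q.phi z - phi z) * T z" by simp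
    then show "phi z * (T z * (R z + (R z)\<^sup>2 / 4)) = Q.phi z * T z - phi z * T z"
      by (simp add: algebra_simps)
  qed
  also have "\<dots> = (LINT z|Q.J. T z) - (LINT z|J. T z)"
    using iT iTQ integral_J_density[of T] Q.integral_J_density[of T] by simp
  \<comment> \<open>By \<open>b0\<close> the integral of \<open>W\<close> under \<open>Lam\<close>
    is zero; subtracting it puts the change of the marginal as a factor beside the change of the
    mean.\<close>
  also have "\<dots> = (LINT x|Q.Lam. W x) - (LINT x|Lam. W x)" by (simp add: QT JT LW)
  also have "\<dots> = (LINT x|\<mu>X. (lam' x - lam x) * W x)"
    using iW iWQ integral_Lam_density[of W] Q.integral_Lam_density[of W]
    by (simp add: left_diff_distrib)
  finally have main: "(LINT z|J. T z * (R z + (R z)\<^sup>2 / 4)) = (LINT x|\<mu>X. (lam' x - lam x) * W x)" .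
  have iWd: "integrable \<mu>X (\<lambda>x. (lam' x - lam x) * W x)"
    using iW iWQ integral_Lam_density(2)[of W] Q.integral_Lam_density(2)[of W]
    by (simp add: left_diff_distrib)
  define N2 where "N2 x = (LINT y|\<mu>Y. sqd (x, y))" for x
  have iN2: "integrable \<mu>X N2" and N2: "(LINT x|\<mu>X. N2 x) = (LINT z|\<mu>XY. sqd z)"
    unfolding N2_def using XY.integrable_fst'[OF isqd] XY.integral_fst'[OF isqd] by auto
  have pw: "\<bar>(lam' x - lam x) * W x\<bar> \<le> C * (1 + 8 * K\<^sup>2) * N2 x" if x [measurable]: "x \<in> space \<mu>X" for x
  proof -
    \<comment> \<open>The Hellinger bound is used on one slice, with the marginal densities at
      \<open>x\<close> as the masses a^2 and c^2.\<close>
    have "\<bar>g x - m x\<bar> * \<bar>lam' x - lam x\<bar> \<le> (1 + 8 * K\<^sup>2) * N2 x"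
      using mean_diff_mult_mass_diff_le_hellinger[OF Q.eta[OF x] eta[OF x] fb_meas fb_bound, of "sqrt (lam' x)" "sqrt (lam x)"]
        g[OF x] m_eq[OF x] stat_functional_fb[of "eta' x"] stat_functional_fb[of "eta x"] lam_nonneg[OF x] Q.lam_nonneg[OF x]
      by (simp add: N2_def sqd_def phi_def Q.phi_def real_sqrt_mult)
    from mult_mono[OF bC[OF x] this C]
    have "\<bar>b x\<bar> * (\<bar>g x - m x\<bar> * \<bar>lam' x - lam x\<bar>) \<le> C * ((1 + 8 * K\<^sup>2) * N2 x)"
      by simp
    moreover have "\<bar>(lam' x - lam x) * W x\<bar> = \<bar>b x\<bar> * (\<bar>g x - m x\<bar> * \<bar>lam' x - lam x\<bar>)"
      by (simp only: W_def abs_mult mult_ac)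
    ultimately show ?thesis by (simp only: mult.assoc)
  qed
  have "\<bar>LINT z|J. T z * (R z + (R z)\<^sup>2 / 4)\<bar> \<le> (LINT x|\<mu>X. \<bar>(lam' x - lam x) * W x\<bar>)"
    unfolding main by (rule integral_abs_bound)
  also have "\<dots> \<le> (LINT x|\<mu>X. C * (1 + 8 * K\<^sup>2) * N2 x)"
    using iWd iN2 pw by (intro integral_mono) auto
  also have "\<dots> = C * (1 + 8 * K\<^sup>2) / 4 * (LINT z|J. (R z)\<^sup>2)"
    by (simp add: N2 R2_eq)
  finally have 1: "\<bar>LINT z|J. T z * (R z + (R z)\<^sup>2 / 4)\<bar> \<le> C * (1 + 8 * K\<^sup>2) / 4 * (LINT z|J. (R z)\<^sup>2)" .
  have "\<bar>LINT z|J. T z * (R z)\<^sup>2\<bar> \<le> (LINT z|J. \<bar>T z * (R z)\<^sup>2\<bar>)" by (rule integral_abs_bound)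
  also have "\<dots> \<le> (LINT z|J. C * (2 * K) * (R z)\<^sup>2)"
  proof (rule integral_mono_AE)
    show "AE z in J. \<bar>T z * (R z)\<^sup>2\<bar> \<le> C * (2 * K) * (R z)\<^sup>2"
      using T_ae(1) by eventually_elim (auto simp: abs_mult intro!: mult_right_mono)
  qed (use iTR2 iR2 in auto)
  finally have 2: "\<bar>LINT z|J. T z * (R z)\<^sup>2\<bar> \<le> C * (2 * K) * (LINT z|J. (R z)\<^sup>2)" by simp
  have "(LINT z|J. T z * (R z + (R z)\<^sup>2 / 4)) = (LINT z|J. T z * R z + T z * (R z)\<^sup>2 / 4)"
    by (simp add: algebra_simps)
  also have "\<dots> = (LINT z|J. T z * R z) + (LINT z|J. T z * (R z)\<^sup>2) / 4"
    using iTR iTR2 by simp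
  finally have 3: "(LINT z|J. T z * R z) = (LINT z|J. T z * (R z + (R z)\<^sup>2 / 4)) - (LINT z|J. T z * (R z)\<^sup>2) / 4"
    by simp
  have "\<bar>LINT z|J. T z * R z\<bar> \<le> C * (1 + 8 * K\<^sup>2) / 4 * (LINT z|J. (R z)\<^sup>2) + C * (2 * K) * (LINT z|J. (R z)\<^sup>2) / 4"
    using abs_triangle_ineq4[of "LINT z|J. T z * (R z + (R z)\<^sup>2 / 4)" "(LINT z|J. T z * (R z)\<^sup>2) / 4"] 1 2
    unfolding 3 by linarith
  then show "\<bar>LINT z|J. b (fst z) * tb z * root_ratio phi \<phi> z\<bar>
          \<le> (C * (1 + 8 * K\<^sup>2) / 4 + C * K / 2) * (LINT z|J. (root_ratio phi \<phi> z)\<^sup>2)"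
    by (simp add: R_def \<phi>Q T_def algebra_simps)
qed

lemma curve_tangents_J:
  "curve_tangents \<mu>XY \<M> phi =
      {v \<in> L2_space J. \<exists>r :: real \<Rightarrow> _.
         (\<forall>\<alpha>\<in>{0..<1}. r \<alpha> \<in> root_ratio phi ` \<M>) \<and> (AE z in J. r 0 z = 0) \<and>
         (\<lambda>\<alpha>. L2_norm J (\<lambda>z. r \<alpha> z - r 0 z - v z * \<alpha>)) \<in> o[at 0 within {0..<1}](\<lambda>\<alpha>. \<bar>\<alpha>\<bar>)}"
  unfolding curve_tangents_def Let_def J_def ..

text \<open>Along a curve, r is \<alpha> v + o(\<alpha>), while the inner product of r with
  \<open>b * tb\<close> is O(\<parallel>r\<parallel>^2) = O(\<alpha>^2). Dividing by \<alpha> and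
  letting it tend to zero leaves the inner product with \<open>v\<close>.\<close>

lemma tangent_orth:
  assumes v: "v \<in> tangents"
    and b [measurable]: "b \<in> borel_measurable \<mu>X" and bC: "\<And>x. x \<in> space \<mu>X \<Longrightarrow> \<bar>b x\<bar> \<le> C" and C: "0 \<le> C"
    and b0: "\<And>D. D \<in> borel_measurable G \<Longrightarrow> (\<And>x. x \<in> space \<mu>X \<Longrightarrow> \<bar>D x\<bar> \<le> 2 * K) \<Longrightarrow> (LINT x|Lam. b x * D x) = 0"
  shows "(LINT z|J. b (fst z) * tb z * v z) = 0"
proof -
  from v obtain r where vL: "v \<in> L2_space J"
    and r: "\<And>\<alpha>. \<alpha> \<in> {0..<1} \<Longrightarrow> r \<alpha> \<in> root_ratio phi ` model \<mu>X \<mu>Y f B"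
    and r0: "AE z in J. r 0 z = 0"
    and o: "(\<lambda>\<alpha>. L2_norm J (\<lambda>z. r \<alpha> z - r 0 z - v z * \<alpha>)) \<in> o[at 0 within {0..<1}](\<lambda>\<alpha>. \<bar>\<alpha>\<bar>)"
    unfolding curve_tangents_J by blast
  define T where "T z = b (fst z) * tb z" for z
  have [measurable]: "T \<in> borel_measurable \<mu>XY" unfolding T_def by measurable
  note T_bound = mult_tb_bound[of b C, OF bC C, folded T_def]
  have TL: "T \<in> L2_space J"
    by (rule J.L2_space_bounded[of _ "C * (2 * K)"]) (auto intro!: AE_I2 T_bound simp: space_pair_measure)
  define C1 where "C1 = C * (1 + 8 * K\<^sup>2) / 4 + C * K / 2"
  have C1: "0 \<le> C1" using C K_nonneg by (simp add: C1_def)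
  have rL: "r \<alpha> \<in> L2_space J" and rT: "\<bar>LINT z|J. T z * r \<alpha> z\<bar> \<le> C1 * (L2_norm J (r \<alpha>))\<^sup>2" if \<alpha>: "\<alpha> \<in> {0..<1}" for \<alpha>
  proof -
    obtain \<phi> where \<phi>: "\<phi> \<in> model \<mu>X \<mu>Y f B" "r \<alpha> = root_ratio phi \<phi>" using r[OF \<alpha>] by blast
    show "r \<alpha> \<in> L2_space J" unfolding \<phi>(2) by (rule integral_score_mult_le(1)[OF \<phi>(1) b bC C b0])
    show "\<bar>LINT z|J. T z * r \<alpha> z\<bar> \<le> C1 * (L2_norm J (r \<alpha>))\<^sup>2"
      unfolding \<phi>(2) T_def C1_def L2_norm_power2 by (rule integral_score_mult_le(2)[OF \<phi>(1) b bC C b0])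
  qed
  define \<rho> where "\<rho> \<alpha> = L2_norm J (\<lambda>z. r \<alpha> z - r 0 z - v z * \<alpha>) / \<bar>\<alpha>\<bar>" for \<alpha>
  have \<rho>: "(\<rho> \<longlongrightarrow> 0) (at 0 within {0..<1})" unfolding \<rho>_def using o by (rule smalloD_tendsto)
  \<comment> \<open>The double successor starts the sequence at 1/2, so that every term lies
    strictly between 0 and 1.\<close>
  define \<alpha> where "\<alpha> n = inverse (real (Suc (Suc n)))" for n
  have \<alpha>: "0 < \<alpha> n" "\<alpha> n < 1" for n by (simp_all add: \<alpha>_def inverse_less_1_iff)
  have \<alpha>0: "\<alpha> \<longlonglongrightarrow> 0" unfolding \<alpha>_def by (rule LIMSEQ_Suc[OF LIMSEQ_inverse_real_of_nat])
  have "filterlim \<alpha> (at 0 within {0..<1}) sequentially"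
    unfolding filterlim_at using \<alpha>0 \<alpha>
    by (metis (mono_tags, lifting) always_eventually atLeastLessThan_iff less_imp_le less_irrefl)
  then have \<rho>\<alpha>: "(\<lambda>n. \<rho> (\<alpha> n)) \<longlonglongrightarrow> 0" by (rule filterlim_compose[OF \<rho>])
  have key: "\<bar>L2_inner J T v\<bar> \<le> C1 * (2 * \<alpha> n * (\<rho> (\<alpha> n))\<^sup>2 + 2 * \<alpha> n * (L2_norm J v)\<^sup>2) + L2_norm J T * \<rho> (\<alpha> n)" for n
  proof -
    let ?a = "\<alpha> n"
    have a: "?a \<in> {0..<1}" using \<alpha>[of n] by simp
    define d where "d z = r ?a z - v z * ?a" for z
    have vaL: "(\<lambda>z. v z * ?a) \<in> L2_space J" using L2_space_cmult[OF vL, of ?a] by (simp add: mult.commute)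
    have dL: "d \<in> L2_space J" unfolding d_def by (rule L2_space_diff[OF rL[OF a] vaL])
    have "L2_norm J d = L2_norm J (\<lambda>z. r ?a z - r 0 z - v z * ?a)"
    proof (rule L2_norm_cong_AE)
      show "AE z in J. d z = r ?a z - r 0 z - v z * ?a" using r0 by eventually_elim (simp add: d_def)
      show "(\<lambda>z. r ?a z - r 0 z - v z * ?a) \<in> borel_measurable J"
        by (intro borel_measurable_diff L2_space_measurable rL a vaL) simp
    qed (rule L2_space_measurable[OF dL])
    then have nd: "L2_norm J d = ?a * \<rho> ?a" using \<alpha>[of n] by (simp add: \<rho>_def)
    have nr: "(L2_norm J (r ?a))\<^sup>2 \<le> 2 * (?a * \<rho> ?a)\<^sup>2 + 2 * (?a * L2_norm J v)\<^sup>2"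
      using L2_norm_power2_add_le[OF dL vaL] L2_norm_cmult[of J ?a v] \<alpha>[of n]
      unfolding nd by (simp add: d_def mult.commute[of _ ?a])
    have "?a * L2_inner J T v = L2_inner J T (r ?a) - L2_inner J T d"
      using L2_space_integrable_mult[OF TL rL[OF a]] L2_space_integrable_mult[OF TL vL]
      by (simp add: L2_inner_def d_def right_diff_distrib mult.assoc[symmetric])
    then have "\<bar>?a * L2_inner J T v\<bar> \<le> \<bar>L2_inner J T (r ?a)\<bar> + \<bar>L2_inner J T d\<bar>" by linarith
    also have "\<dots> \<le> C1 * (2 * (?a * \<rho> ?a)\<^sup>2 + 2 * (?a * L2_norm J v)\<^sup>2) + L2_norm J T * (?a * \<rho> ?a)"
    proof (rule add_mono)
      have "\<bar>L2_inner J T (r ?a)\<bar> \<le> C1 * (L2_norm J (r ?a))\<^sup>2" using rT[OF a] by (simp add: L2_inner_def)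
      also have "\<dots> \<le> C1 * (2 * (?a * \<rho> ?a)\<^sup>2 + 2 * (?a * L2_norm J v)\<^sup>2)"
        by (rule mult_left_mono[OF nr C1])
      finally show "\<bar>L2_inner J T (r ?a)\<bar> \<le> C1 * (2 * (?a * \<rho> ?a)\<^sup>2 + 2 * (?a * L2_norm J v)\<^sup>2)" .
      show "\<bar>L2_inner J T d\<bar> \<le> L2_norm J T * (?a * \<rho> ?a)"
        using L2_Cauchy_Schwarz[OF TL dL] by (simp add: nd)
    qed
    also have "\<dots> = ?a * (C1 * (2 * ?a * (\<rho> ?a)\<^sup>2 + 2 * ?a * (L2_norm J v)\<^sup>2) + L2_norm J T * \<rho> ?a)"
      by (simp add: power2_eq_square algebra_simps)
    finally show ?thesis using \<alpha>(1)[of n] by (simp add: abs_mult)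
  qed
  have "(\<lambda>n. C1 * (2 * \<alpha> n * (\<rho> (\<alpha> n))\<^sup>2 + 2 * \<alpha> n * (L2_norm J v)\<^sup>2) + L2_norm J T * \<rho> (\<alpha> n))
      \<longlonglongrightarrow> C1 * (2 * 0 * 0\<^sup>2 + 2 * 0 * (L2_norm J v)\<^sup>2) + L2_norm J T * 0"
    by (intro tendsto_intros \<alpha>0 \<rho>\<alpha>)
  then have "\<bar>L2_inner J T v\<bar> \<le> C1 * (2 * 0 * 0\<^sup>2 + 2 * 0 * (L2_norm J v)\<^sup>2) + L2_norm J T * 0"
    by (rule LIMSEQ_le_const) (use key in blast)
  then show ?thesis by (simp add: L2_inner_def T_def)
qed

lemma tb_v_integrable:
  assumes "v \<in> L2_space J" shows "integrable J (\<lambda>z. tb z * v z)"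
  by (rule integrable_mult_bounded[OF J.L2_space_integrable[OF assms], of _ "2 * K"])
     (auto intro!: AE_I2 tb_bound)

text \<open>The difference of the indicator of a set and its conditional expectation annihilates all
  bounded \<open>G\<close>-measurable functions, so it is admissible in \<open>tangent_orth\<close>.
  Self-adjointness of conditional expectation then shows that the mean and its projection have equal
  integrals over every set.\<close>

lemma tangent_mean_sigma:
  assumes v: "v \<in> tangents"
  shows "AE x in Lam. (LINT y|N x. tb (x, y) * v (x, y)) = real_cond_exp Lam G (\<lambda>x. LINT y|N x. tb (x, y) * v (x, y)) x"
proof -
  have vL: "v \<in> L2_space J" using v by (simp add: curve_tangents_J)
  note tv = tb_v_integrable[OF vL]
  define l where "l x = (LINT y|N x. tb (x, y) * v (x, y))" for x
  have l: "integrable Lam l" unfolding l_def by (rule integrable_integral_N[OF tv])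
  have [measurable]: "l \<in> borel_measurable \<mu>X" using borel_measurable_integrable[OF l] by simp
  have "AE x in Lam. l x = real_cond_exp Lam G l x"
  proof (rule density_unique_real[OF l G.real_cond_exp_int(1)[OF l]])
    fix A assume "A \<in> sets Lam"
    then have A [measurable]: "A \<in> sets \<mu>X" by simp
    define k :: "_ \<Rightarrow> real" where "k = indicator A"
    have [measurable]: "k \<in> borel_measurable \<mu>X" by (simp add: k_def)
    \<comment> \<open>Clamping gives a version with bounds at every point, as
      \<open>tangent_orth\<close> requires; it stays \<open>G\<close>-measurable.\<close>
    define k' where "k' x = max 0 (min 1 (real_cond_exp Lam G k x))" for x
    have k'G: "k' \<in> borel_measurable G" unfolding k'_def by measurable
    then have [measurable]: "k' \<in> borel_measurable \<mu>X" by (rule measurable_G)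
    have ik: "integrable Lam k" unfolding k_def using A by (simp add: Lam.emeasure_eq_measure)
    have "AE x in Lam. 0 \<le> real_cond_exp Lam G k x"
      by (rule G.real_cond_exp_ge_c[OF ik]) (simp add: k_def)
    moreover have "AE x in Lam. real_cond_exp Lam G k x \<le> 1"
      by (rule G.real_cond_exp_le_c[OF ik]) (simp add: k_def indicator_def)
    ultimately have k': "AE x in Lam. real_cond_exp Lam G k x = k' x"
      by eventually_elim (simp add: k'_def)
    have bounded_int: "integrable Lam (\<lambda>x. u x * w x)" if "integrable Lam w" "u \<in> borel_measurable \<mu>X" "\<And>x. \<bar>u x\<bar> \<le> 1" for u w :: "_ \<Rightarrow> real"
      by (rule integrable_mult_bounded[OF that(1), of _ 1]) (use that in auto)
    have kk: "(LINT x|Lam. k x * w x) = (LINT x|Lam. k' x * w x)"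
      if w: "w \<in> borel_measurable G" "integrable Lam w" for w
    proof -
      have [measurable]: "w \<in> borel_measurable \<mu>X" by (rule measurable_G[OF w(1)])
      have "integrable Lam (\<lambda>x. w x * k x)"
        using bounded_int[OF w(2), of k] by (simp add: k_def mult.commute indicator_def)
      from G.real_cond_exp_intg(2)[OF this w(1)]
      have "(LINT x|Lam. w x * real_cond_exp Lam G k x) = (LINT x|Lam. w x * k x)" by simp
      moreover have "(LINT x|Lam. w x * real_cond_exp Lam G k x) = (LINT x|Lam. w x * k' x)"
        by (rule integral_cong_AE) (use k' in \<open>auto elim!: eventually_mono\<close>)
      ultimately show ?thesis by (simp add: mult.commute)
    qed
    have b1: "\<bar>k x\<bar> \<le> 1" "\<bar>k' x\<bar> \<le> 1" for x by (auto simp: k_def k'_def indicator_def)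
    have "(LINT z|J. (k (fst z) - k' (fst z)) * tb z * v z) = 0"
    proof (rule tangent_orth[OF v, where C = 2])
      show "\<bar>k x - k' x\<bar> \<le> 2" for x using b1[of x] by linarith
      fix D assume D: "D \<in> borel_measurable G" "\<And>x. x \<in> space \<mu>X \<Longrightarrow> \<bar>D x\<bar> \<le> 2 * K"
      have [measurable]: "D \<in> borel_measurable \<mu>X" by (rule measurable_G[OF D(1)])
      have iD: "integrable Lam D" by (rule Lam.integrable_const_bound[of _ "2 * K"]) (auto intro!: AE_I2 D)
      show "(LINT x|Lam. (k x - k' x) * D x) = 0"
        using kk[OF D(1) iD] bounded_int[OF iD, of k] bounded_int[OF iD, of k'] b1
        by (simp add: left_diff_distrib)
    qed simp_all
    moreover have "(LINT z|J. (k (fst z) - k' (fst z)) * tb z * v z) = (LINT x|Lam. (k x - k' x) * l x)"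
    proof -
      have b2: "\<bar>k x - k' x\<bar> \<le> 2" for x using b1[of x] by linarith
      have "integrable J (\<lambda>z. (k (fst z) - k' (fst z)) * (tb z * v z))"
        by (rule integrable_mult_bounded[OF tv, of _ 2]) (auto intro!: AE_I2 b2)
      from integral_J[OF this] show ?thesis by (simp add: l_def mult.assoc)
    qed
    ultimately have "(LINT x|Lam. k x * l x) = (LINT x|Lam. k' x * l x)"
      using bounded_int[OF l, of k] bounded_int[OF l, of k'] b1 by (simp add: left_diff_distrib)
    also have "\<dots> = (LINT x|Lam. k' x * real_cond_exp Lam G l x)"
      using bounded_int[OF l, of k'] b1 k'G by (intro G.real_cond_exp_intg(2)[symmetric]) auto
    also have "\<dots> = (LINT x|Lam. k x * real_cond_exp Lam G l x)"
      by (rule kk[symmetric]) (auto intro: G.real_cond_exp_int l)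
    finally show "(\<integral>x\<in>A. l x \<partial>Lam) = (\<integral>x\<in>A. real_cond_exp Lam G l x \<partial>Lam)"
      by (simp add: set_lebesgue_integral_def k_def)
  qed
  then show ?thesis unfolding l_def .
qed

text \<open>Against a tangent, the inner product reduces to the integral of \<open>q\<close> times
  the conditional covariance of the tangent with \<open>tb\<close>. That covariance agrees almost
  everywhere with a \<open>G\<close>-measurable function, which \<open>q0\<close>
  annihilates.\<close>

lemma orth_tangent_space:
  assumes q: "q \<in> L2_space Lam"
    and q0: "\<And>D. D \<in> borel_measurable G \<Longrightarrow> integrable Lam (\<lambda>x. q x * D x) \<Longrightarrow> (LINT x|Lam. q x * D x) = 0"
  shows "(\<lambda>z. q (fst z) * tb z) \<in> L2_orth_compl J (tangent_space \<mu>XY (model \<mu>X \<mu>Y f B) phi)"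
proof -
  have [measurable]: "q \<in> borel_measurable \<mu>X" using L2_space_measurable[OF q] by simp
  have qJ: "(\<lambda>z. q (fst z)) \<in> L2_space J"
    using q by (intro L2_spaceI) (auto simp: L2_space_def integrable_J_fst_iff[of "\<lambda>x. (q x)\<^sup>2"])
  have S: "(\<lambda>z. q (fst z) * tb z) \<in> L2_space J"
    using L2_space_mult_bounded[OF qJ, of tb "2 * K"] AE_I2[of J, OF tb_bound]
    by (simp add: mult.commute[of _ "tb _"])
  show ?thesis
    unfolding tangent_space_def J_def[symmetric]
  proof (rule L2_orth_closure_hull[OF S])
    show "tangents \<subseteq> L2_space J" by (auto simp: curve_tangents_J)
    fix v assume v: "v \<in> tangents"
    then have vL: "v \<in> L2_space J" by (simp add: curve_tangents_J)
    define l where "l x = (LINT y|N x. tb (x, y) * v (x, y))" for x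
    have il: "integrable Lam l" unfolding l_def by (rule integrable_integral_N[OF tb_v_integrable[OF vL]])
    have [measurable]: "l \<in> borel_measurable \<mu>X" using borel_measurable_integrable[OF il] by simp
    have ls: "AE x in Lam. l x = real_cond_exp Lam G l x"
      unfolding l_def by (rule tangent_mean_sigma[OF v])
    have i: "integrable J (\<lambda>z. q (fst z) * tb z * v z)" by (rule L2_space_integrable_mult[OF S vL])
    have ql: "integrable Lam (\<lambda>x. q x * l x)"
      using integrable_integral_N[OF i] by (simp add: l_def mult.assoc)
    have "L2_inner J (\<lambda>z. q (fst z) * tb z) v = (LINT x|Lam. q x * l x)"
      unfolding L2_inner_def integral_J[OF i] by (simp add: l_def mult.assoc)
    also have "\<dots> = (LINT x|Lam. q x * real_cond_exp Lam G l x)"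
      by (rule integral_cong_AE) (use ls in \<open>auto elim!: eventually_mono\<close>)
    also have "\<dots> = 0"
    proof (rule q0)
      show "integrable Lam (\<lambda>x. q x * real_cond_exp Lam G l x)"
        by (rule integrable_cong_AE_imp[OF ql]) (use ls in \<open>auto elim!: eventually_mono\<close>)
    qed simp
    finally show "L2_inner J (\<lambda>z. q (fst z) * tb z) v = 0" .
  qed
qed

end

section \<open>Directions that are tangents\<close>

lemma sqrt_diff_sq_le:
  assumes "0 \<le> a" "0 \<le> b"
  shows "(sqrt a - sqrt b)\<^sup>2 \<le> \<bar>a - b\<bar>"
proof -
  have "(sqrt a - sqrt b)\<^sup>2 = \<bar>sqrt a - sqrt b\<bar> * \<bar>sqrt a - sqrt b\<bar>"
    by (simp add: power2_eq_square)
  also have "\<dots> \<le> \<bar>sqrt a - sqrt b\<bar> * \<bar>sqrt a + sqrt b\<bar>"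
    using assms by (intro mult_left_mono) (auto simp: abs_le_iff)
  also have "\<dots> = \<bar>(sqrt a + sqrt b) * (sqrt a - sqrt b)\<bar>" by (simp add: abs_mult)
  also have "(sqrt a + sqrt b) * (sqrt a - sqrt b) = a - b"
    using assms by (simp add: square_diff_square_factored[symmetric])
  finally show ?thesis .
qed

text \<open>With s = sqrt(1 + t) the error is exactly -(s - 1)^2, and |s - 1| \<le> |t| because t =
  (s + 1)(s - 1) with s + 1 \<ge> 1.\<close>

lemma sqrt_one_plus_approx:
  assumes "-1 \<le> t"
  shows "(2 * (sqrt (1 + t) - 1) - t)\<^sup>2 \<le> (t\<^sup>2)\<^sup>2"
proof -
  define s where "s = sqrt (1 + t)"
  have s: "0 \<le> s" and t: "t = s\<^sup>2 - 1" using assms by (auto simp: s_def)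
  have "2 * (s - 1) - t = - ((s - 1)\<^sup>2)" by (simp add: t power2_eq_square algebra_simps)
  moreover have "(s - 1)\<^sup>2 \<le> t\<^sup>2"
  proof -
    have "t = (s + 1) * (s - 1)" by (simp add: t power2_eq_square algebra_simps)
    then have "\<bar>s - 1\<bar> \<le> \<bar>t\<bar>" using s mult_right_mono[of 1 "s + 1" "\<bar>s - 1\<bar>"] by (simp add: abs_mult)
    then show ?thesis by (simp add: abs_le_square_iff)
  qed
  ultimately have "2 * (s - 1) - t = - ((s - 1)\<^sup>2)" and le: "(s - 1)\<^sup>2 \<le> t\<^sup>2" by auto
  from this(1) power_mono[OF le, of 2] show ?thesis unfolding s_def[symmetric] by (simp only: power2_minus) simp
qed

context joint_density
begin

lemma integrable_J_nn_bound:
  fixes h :: "'a \<times> 'b \<Rightarrow> real"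
  assumes [measurable]: "h \<in> borel_measurable \<mu>XY"
    and s: "integrable Lam s"
    and le: "\<And>x. x \<in> space \<mu>X \<Longrightarrow> (\<integral>\<^sup>+y. ennreal \<bar>h (x, y)\<bar> \<partial>N x) \<le> ennreal (s x)"
  shows "integrable J h"
proof (rule integrableI_bounded)
  have "(\<integral>\<^sup>+z. ennreal (norm (h z)) \<partial>J) = (\<integral>\<^sup>+x. (\<integral>\<^sup>+y. ennreal \<bar>h (x, y)\<bar> \<partial>N x) \<partial>Lam)"
    by (subst nn_integral_J) auto
  also have "\<dots> \<le> (\<integral>\<^sup>+x. ennreal (norm (s x)) \<partial>Lam)"
    using le by (intro nn_integral_mono) (fastforce intro: order_trans ennreal_leI)
  also have "\<dots> < \<infinity>" using s by (simp add: integrable_iff_bounded)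
  finally show "(\<integral>\<^sup>+z. ennreal (norm (h z)) \<partial>J) < \<infinity>" .
qed simp

end

context central_model
begin

text \<open>As f is essentially bounded, every density lies in the domain of L. The paths
  constructed below therefore need only be nonnegative, of mass one and with the right mean.\<close>

lemma densities_sq_densities:
  assumes p: "p \<in> densities \<mu>Y"
  shows "p \<in> sq_densities \<mu>Y f"
proof -
  have "integrable \<mu>Y (\<lambda>y. (f y)\<^sup>2 * p y)"
  proof (rule integrable_mult_bounded[OF densities_integrable[OF p]])
    show "AE y in \<mu>Y. \<bar>(f y)\<^sup>2\<bar> \<le> K\<^sup>2"
      using f_bound
    proof eventually_elim
      case (elim y)
      from power_mono[OF this, of 2] show ?case by simp
    qed
  qed simp
  with p show ?thesis by (simp add: sq_densities_def)
qed

lemma fb_mult_integrable: "p \<in> densities \<mu>Y \<Longrightarrow> integrable \<mu>Y (\<lambda>y. fb y * p y)"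
  by (rule integrable_mult_bounded[OF densities_integrable, of _ _ _ K]) (auto intro!: AE_I2 fb_bound)

text \<open>Where the score direction \<open>v\<close> is too large for the linear path to stay nonnegative, the path mixes
  in the fixed density \<open>\<nu>\<close>, with a weight that produces the same change of the mean of \<open>f\<close>. The Hellinger
  cost there is of order \<open>\<alpha>\<close> on a set of probability \<open>o(\<alpha>)\<close>, because \<open>k\<close> is integrable.\<close>

lemma curve_tangentI:
  assumes vL: "v \<in> L2_space J"
    and k_meas [measurable]: "k \<in> borel_measurable \<mu>X" and k: "integrable Lam k" and k0: "\<And>x. x \<in> space \<mu>X \<Longrightarrow> 0 \<le> k x"
    and G0 [measurable]: "G0 \<in> sets \<mu>X" and G0_AE: "AE x in Lam. x \<in> G0"
    and vk: "\<And>x y. x \<in> G0 \<Longrightarrow> y \<in> space \<mu>Y \<Longrightarrow> \<bar>v (x, y)\<bar> \<le> k x"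
    and v0: "\<And>x. x \<in> G0 \<Longrightarrow> (LINT y|N x. v (x, y)) = 0"
    and v1: "\<And>x. x \<in> G0 \<Longrightarrow> (LINT y|N x. fb y * v (x, y)) = c x * (mean - m x)"
    and cG: "c \<in> borel_measurable G" and c01: "\<And>x. x \<in> space \<mu>X \<Longrightarrow> 0 \<le> c x \<and> c x \<le> 1"
    and nu: "nu \<in> densities \<mu>Y" and mean: "(LINT y|\<mu>Y. fb y * nu y) = mean"
  shows "v \<in> tangents"
proof -
  have [measurable]: "v \<in> borel_measurable \<mu>XY" using L2_space_measurable[OF vL] by simp
  have [measurable]: "c \<in> borel_measurable \<mu>X" by (rule measurable_G[OF cG])
  have [measurable]: "nu \<in> borel_measurable \<mu>Y" by (rule densities_measurable[OF nu])
  have G0_space: "x \<in> space \<mu>X" if "x \<in> G0" for x using sets.sets_into_space[OF G0] that by auto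
  \<comment> \<open>Here the envelope gives |\<alpha> v| \<le> 1/2, so the linear path is positive;
    as \<alpha> tends to zero these sets exhaust \<open>G0\<close>.\<close>
  define good where "good \<alpha> = {x \<in> space \<mu>X. x \<in> G0 \<and> \<alpha> * k x \<le> 1 / 2}" for \<alpha>
  have good_meas [measurable]: "good \<alpha> \<in> sets \<mu>X" for \<alpha> unfolding good_def by measurable
  \<comment> \<open>\<open>good \<alpha>\<close> need not belong to \<open>G\<close>, so the two
    branches must agree in the mean of f: both give
    \<open>m x + \<alpha> * c x * (mean - m x)\<close>, which is \<open>G\<close>-measurable. The
    second branch also covers the null set outside \<open>G0\<close>, so that the constraint holds
    at every x.\<close>
  define et where "et \<alpha> x y = (if x \<in> good \<alpha> then eta x y * (1 + \<alpha> * v (x, y))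
      else (1 - \<alpha> * c x) * eta x y + \<alpha> * c x * nu y)" for \<alpha> x y
  have et_meas: "(\<lambda>(x, y). et \<alpha> x y) \<in> borel_measurable \<mu>XY" for \<alpha>
    unfolding et_def split_beta' by measurable
  have et: "et \<alpha> x \<in> densities \<mu>Y \<and> (LINT y|\<mu>Y. fb y * et \<alpha> x y) = m x + \<alpha> * c x * (mean - m x)"
    if \<alpha>: "\<alpha> \<in> {0..<1}" and x [measurable]: "x \<in> space \<mu>X" for \<alpha> x
  proof (cases "x \<in> good \<alpha>")
    case True
    then have xG: "x \<in> G0" and ak: "\<alpha> * k x \<le> 1 / 2" by (auto simp: good_def)
    have ie: "integrable \<mu>Y (eta x)" by (rule densities_integrable[OF eta[OF x]])
    have iev: "integrable \<mu>Y (\<lambda>y. v (x, y) * eta x y)"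
      by (rule integrable_mult_bounded[OF ie, of _ "k x"]) (auto intro!: AE_I2 vk xG)
    have ife: "integrable \<mu>Y (\<lambda>y. fb y * eta x y)" by (rule fb_mult_integrable[OF eta[OF x]])
    have ifev: "integrable \<mu>Y (\<lambda>y. fb y * (v (x, y) * eta x y))"
      by (rule integrable_mult_bounded[OF iev, of _ K]) (auto intro!: AE_I2 fb_bound)
    have et_eq: "et \<alpha> x = (\<lambda>y. eta x y + \<alpha> * (v (x, y) * eta x y))"
      using True by (auto simp: et_def algebra_simps)
    have "et \<alpha> x \<in> densities \<mu>Y"
    proof (rule densitiesI)
      show "integrable \<mu>Y (et \<alpha> x)" unfolding et_eq using ie iev by simp
      fix y assume y: "y \<in> space \<mu>Y"
      have "\<bar>\<alpha> * v (x, y)\<bar> \<le> \<alpha> * k x" using vk[OF xG y] \<alpha> by (simp add: abs_mult mult_left_mono)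
      then have "0 \<le> 1 + \<alpha> * v (x, y)" using ak by linarith
      then show "0 \<le> et \<alpha> x y" using True eta_nonneg[OF x y] by (simp add: et_def)
    next
      have "(LINT y|\<mu>Y. v (x, y) * eta x y) = 0"
        using v0[OF xG] by (simp add: integral_N_density[OF x] mult.commute)
      then show "(LINT y|\<mu>Y. et \<alpha> x y) = 1"
        unfolding et_eq using ie iev densities_integral[OF eta[OF x]] by simp
    qed
    moreover have "(LINT y|\<mu>Y. fb y * et \<alpha> x y) = m x + \<alpha> * c x * (mean - m x)"
    proof -
      have "(LINT y|\<mu>Y. fb y * et \<alpha> x y) = (LINT y|\<mu>Y. fb y * eta x y + \<alpha> * (fb y * (v (x, y) * eta x y)))"
        unfolding et_eq by (simp add: algebra_simps)
      also have "\<dots> = (LINT y|\<mu>Y. fb y * eta x y) + \<alpha> * (LINT y|\<mu>Y. fb y * (v (x, y) * eta x y))"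
        using ife ifev by simp
      also have "(LINT y|\<mu>Y. fb y * (v (x, y) * eta x y)) = c x * (mean - m x)"
        using v1[OF xG] by (simp add: integral_N_density[OF x] mult_ac)
      also have "(LINT y|\<mu>Y. fb y * eta x y) = m x"
        using m_eq_integral_N[OF x] by (simp add: integral_N_density[OF x] mult_ac)
      finally show ?thesis by (simp add: mult.assoc)
    qed
    ultimately show ?thesis ..
  next
    case False
    have et_eq: "et \<alpha> x = (\<lambda>y. (1 - \<alpha> * c x) * eta x y + \<alpha> * c x * nu y)"
      using False by (auto simp: et_def)
    have ac: "0 \<le> \<alpha> * c x" "\<alpha> * c x \<le> 1"
      using c01[OF x] \<alpha> mult_mono[of \<alpha> 1 "c x" 1] by auto
    note i = densities_integrable[OF eta[OF x]] densities_integrable[OF nu]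
    have "et \<alpha> x \<in> densities \<mu>Y"
    proof (rule densitiesI)
      show "integrable \<mu>Y (et \<alpha> x)" unfolding et_eq using i by simp
      show "0 \<le> et \<alpha> x y" if y: "y \<in> space \<mu>Y" for y
        unfolding et_eq using ac eta_nonneg[OF x y] densities_nonneg[OF nu y] by simp
      show "(LINT y|\<mu>Y. et \<alpha> x y) = 1"
        unfolding et_eq using i densities_integral[OF eta[OF x]] densities_integral[OF nu] by simp
    qed
    moreover have "(LINT y|\<mu>Y. fb y * et \<alpha> x y) = m x + \<alpha> * c x * (mean - m x)"
    proof -
      have "(LINT y|\<mu>Y. fb y * et \<alpha> x y)
          = (LINT y|\<mu>Y. (1 - \<alpha> * c x) * (fb y * eta x y) + \<alpha> * c x * (fb y * nu y))"
        unfolding et_eq by (intro Bochner_Integration.integral_cong) (auto simp: algebra_simps)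
      also have "\<dots> = (1 - \<alpha> * c x) * (LINT y|\<mu>Y. fb y * eta x y) + \<alpha> * c x * mean"
        using fb_mult_integrable[OF eta[OF x]] fb_mult_integrable[OF nu] mean by simp
      also have "(LINT y|\<mu>Y. fb y * eta x y) = m x"
        using m_eq_integral_N[OF x] by (simp add: integral_N_density[OF x] mult_ac)
      finally show ?thesis by (simp add: algebra_simps)
    qed
    ultimately show ?thesis ..
  qed
  define Phi where "Phi \<alpha> = (\<lambda>(x, y). lam x * et \<alpha> x y)" for \<alpha>
  have Phi_meas [measurable]: "Phi \<alpha> \<in> borel_measurable \<mu>XY" for \<alpha>
    using et_meas[of \<alpha>] unfolding Phi_def split_beta' by measurable
  have in_model: "Phi \<alpha> \<in> model \<mu>X \<mu>Y f B" if \<alpha>: "\<alpha> \<in> {0..<1}" for \<alpha>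
  proof -
    define g where "g x = m x + \<alpha> * c x * (mean - m x)" for x
    have gG: "g \<in> borel_measurable G" unfolding g_def using m_meas_sigma cG by measurable
    have [measurable]: "g \<in> borel_measurable \<mu>X" by (rule measurable_G[OF gG])
    have sg: "stat_functional \<mu>Y f (et \<alpha> x) = g x" if x: "x \<in> space \<mu>X" for x
      using et[OF \<alpha> x] by (simp add: stat_functional_fb densities_measurable g_def)
    have "\<bar>g x\<bar> \<le> K + (\<bar>mean\<bar> + K)" if x: "x \<in> space \<mu>X" for x
    proof -
      have "\<bar>\<alpha> * c x\<bar> \<le> 1" using c01[OF x] \<alpha> mult_mono[of \<alpha> 1 "c x" 1] by auto
      then have "\<bar>\<alpha> * c x\<bar> * \<bar>mean - m x\<bar> \<le> 1 * (\<bar>mean\<bar> + K)"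
        using m_bound[OF x] by (intro mult_mono) auto
      then show ?thesis using m_bound[OF x] abs_triangle_ineq[of "m x" "\<alpha> * c x * (mean - m x)"]
        by (simp add: g_def abs_mult[of "\<alpha> * c x"])
    qed
    then have ig: "integrable Lam g"
      by (intro Lam.integrable_const_bound[of _ "K + (\<bar>mean\<bar> + K)"]) (auto intro!: AE_I2)
    have isg: "integrable Lam (\<lambda>x. stat_functional \<mu>Y f (et \<alpha> x))"
      by (rule Bochner_Integration.integrable_cong[OF refl, THEN iffD1, OF _ ig]) (simp add: sg)
    have "AE x in Lam. real_cond_exp Lam G (\<lambda>x. stat_functional \<mu>Y f (et \<alpha> x)) x = real_cond_exp Lam G g x"
      by (rule G.real_cond_exp_cong) (use sg isg ig in \<open>auto intro!: AE_I2\<close>)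
    moreover have "AE x in Lam. real_cond_exp Lam G g x = g x" by (rule G.real_cond_exp_F_meas[OF ig gG])
    ultimately have "AE x in Lam. real_cond_exp Lam G (\<lambda>x. stat_functional \<mu>Y f (et \<alpha> x)) x = g x"
      by eventually_elim simp
    then have "constraint_version \<mu>X \<mu>Y f B lam (et \<alpha>) g"
      unfolding constraint_version_def is_cond_exp_def Lam_def[symmetric] using subalg isg gG sg by simp
    then have "et \<alpha> \<in> cond_densities \<mu>X \<mu>Y f B lam"
      using et_meas et[OF \<alpha>] by (auto simp: cond_densities_def intro!: densities_sq_densities)
    then show ?thesis using lam by (auto simp: model_def Phi_def)
  qed
  define r where "r \<alpha> = root_ratio phi (Phi \<alpha>)" for \<alpha>
  have r_meas [measurable]: "r \<alpha> \<in> borel_measurable \<mu>XY" for \<alpha>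
    unfolding r_def root_ratio_def by measurable
  have r0: "r 0 z = 0" for z
  proof -
    have "Phi 0 z = phi z" by (cases z) (simp add: Phi_def phi_def et_def)
    then show ?thesis by (simp add: r_def root_ratio_def)
  qed
  define F where "F \<alpha> z = (r \<alpha> z - v z * \<alpha>)\<^sup>2 / \<alpha>\<^sup>2" for \<alpha> z
  \<comment> \<open>Envelope for the mixing branch. Under \<open>N x\<close> the quotient of
    \<open>nu\<close> and \<open>eta x\<close> has integral at most one, so \<open>E\<close> is
    integrable because \<open>k\<close> is. \<open>H\<close> below dominates the squared remainder
    in both branches.\<close>
  define E where "E z = k (fst z) + k (fst z) * (nu (snd z) / eta (fst z) (snd z))" for z
  define H where "H z = 3 * (v z)\<^sup>2 + 16 * E z" for z
  have iH: "integrable J H"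
  proof -
    have "integrable J (\<lambda>z. k (fst z) * (nu (snd z) / eta (fst z) (snd z)))"
    proof (rule integrable_J_nn_bound[OF _ k])
      fix x assume x [measurable]: "x \<in> space \<mu>X"
      have "(\<integral>\<^sup>+y. ennreal \<bar>k (fst (x, y)) * (nu (snd (x, y)) / eta (fst (x, y)) (snd (x, y)))\<bar> \<partial>N x)
          = (\<integral>\<^sup>+y. ennreal (eta x y) * ennreal \<bar>k x * (nu y / eta x y)\<bar> \<partial>\<mu>Y)"
        unfolding N_def by (subst nn_integral_density) auto
      also have "\<dots> \<le> (\<integral>\<^sup>+y. ennreal (k x * nu y) \<partial>\<mu>Y)"
      proof (rule nn_integral_mono)
        fix y assume y: "y \<in> space \<mu>Y"
        note p = k0[OF x] eta_nonneg[OF x y] densities_nonneg[OF nu y]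
        have "ennreal (eta x y) * ennreal \<bar>k x * (nu y / eta x y)\<bar> = ennreal (eta x y * (k x * (nu y / eta x y)))"
        proof -
          have "0 \<le> k x * (nu y / eta x y)" using p by simp
          then show ?thesis using p by (simp only: ennreal_mult[of "eta x y"] abs_of_nonneg)
        qed
        also have "\<dots> \<le> ennreal (k x * nu y)"
          using p by (intro ennreal_leI) (cases "eta x y = 0", auto)
        finally show "ennreal (eta x y) * ennreal \<bar>k x * (nu y / eta x y)\<bar> \<le> ennreal (k x * nu y)" .
      qed
      also have "\<dots> = ennreal (k x) * (\<integral>\<^sup>+y. ennreal (nu y) \<partial>\<mu>Y)"
        using k0[OF x] densities_nonneg[OF nu]
        by (subst nn_integral_cmult[symmetric]) (auto intro!: nn_integral_cong simp: ennreal_mult)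
      also have "\<dots> = ennreal (k x)" using nu by (simp add: densities_def)
      finally show "(\<integral>\<^sup>+y. ennreal \<bar>k (fst (x, y)) * (nu (snd (x, y)) / eta (fst (x, y)) (snd (x, y)))\<bar> \<partial>N x) \<le> ennreal (k x)" .
    qed measurable
    moreover have "integrable J (\<lambda>z. k (fst z))" using k by (subst integrable_J_fst_iff) auto
    ultimately show ?thesis
      unfolding H_def E_def
      by (intro Bochner_Integration.integrable_add integrable_mult_right L2_space_integrable_sq[OF vL])
  qed
  have nice: "AE z in J. z \<in> space J \<and> 0 < phi z \<and> fst z \<in> G0"
    using AE_J_I'[OF phi_pos] AE_space[of J] AE_J_fst_iff[of "\<lambda>x. x \<in> G0"] G0_AE by auto
  \<comment> \<open>The first bound gives the pointwise limit, the second the domination uniformly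
    in \<alpha>.\<close>
  have F_good: "F \<alpha> z \<le> \<alpha>\<^sup>2 * (v z)^4" and F_good': "F \<alpha> z \<le> (v z)\<^sup>2"
    if z: "z \<in> space J \<and> 0 < phi z \<and> fst z \<in> G0" and \<alpha>: "0 < \<alpha>" and ak: "\<alpha> * k (fst z) \<le> 1 / 2" for \<alpha> z
  proof -
    have gd: "fst z \<in> good \<alpha>" using z ak G0_space by (auto simp: good_def)
    have "\<bar>\<alpha> * v z\<bar> \<le> \<alpha> * k (fst z)"
      using vk[of "fst z" "snd z"] z \<alpha> by (auto simp: abs_mult mult_left_mono)
    then have t: "\<bar>\<alpha> * v z\<bar> \<le> 1 / 2" using ak by linarith
    have "Phi \<alpha> z = phi z * (1 + \<alpha> * v z)"
      using gd by (cases z) (simp add: Phi_def phi_def et_def mult.assoc)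
    then have r_eq: "r \<alpha> z = 2 * (sqrt (1 + \<alpha> * v z) - 1)"
      using z by (simp add: r_def root_ratio_def real_sqrt_mult right_diff_distrib diff_divide_distrib)
    have "(r \<alpha> z - v z * \<alpha>)\<^sup>2 \<le> ((\<alpha> * v z)\<^sup>2)\<^sup>2"
      using sqrt_one_plus_approx[of "\<alpha> * v z"] t by (simp add: r_eq mult.commute)
    then have "F \<alpha> z \<le> ((\<alpha> * v z)\<^sup>2)\<^sup>2 / \<alpha>\<^sup>2" unfolding F_def by (rule divide_right_mono) simp
    also have "\<dots> = \<alpha>\<^sup>2 * (v z)^4" using \<alpha> by (simp add: power_mult_distrib power2_eq_square power4_eq_xxxx)
    finally show "F \<alpha> z \<le> \<alpha>\<^sup>2 * (v z)^4" .
    also have "\<dots> = (\<alpha> * v z)\<^sup>2 * (v z)\<^sup>2" by (simp add: power_mult_distrib power2_eq_square power4_eq_xxxx)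
    also have "\<dots> \<le> 1 * (v z)\<^sup>2"
    proof (rule mult_right_mono)
      show "(\<alpha> * v z)\<^sup>2 \<le> 1" using power_mono[OF t, of 2] by (simp add: power2_eq_square)
    qed simp
    finally show "F \<alpha> z \<le> (v z)\<^sup>2" by simp
  qed
  have F_bad: "F \<alpha> z \<le> 2 * (v z)\<^sup>2 + 16 * E z"
    if z: "z \<in> space J \<and> 0 < phi z \<and> fst z \<in> G0" and \<alpha>: "0 < \<alpha>" "\<alpha> < 1" and ak: "\<not> \<alpha> * k (fst z) \<le> 1 / 2" for \<alpha> z
  proof -
    obtain x y where xy: "z = (x, y)" by (cases z)
    have x: "x \<in> space \<mu>X" and y: "y \<in> space \<mu>Y" using z xy by auto
    have lp: "0 < lam x" and ep: "0 < eta x y"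
      using z xy lam_nonneg[OF x] eta_nonneg[OF x y] by (auto simp: phi_def zero_less_mult_iff)
    have nd: "x \<notin> good \<alpha>" using ak xy by (auto simp: good_def)
    have n0: "0 \<le> nu y" by (rule densities_nonneg[OF nu y])
    have ac: "0 \<le> \<alpha> * c x" "\<alpha> * c x \<le> \<alpha>" "\<alpha> * c x \<le> 1"
      using c01[OF x] \<alpha> mult_mono[of \<alpha> 1 "c x" 1] mult_left_mono[of "c x" 1 \<alpha>] by auto
    have Phi0: "0 \<le> Phi \<alpha> z"
      using nd ac lp ep n0 by (simp add: Phi_def xy et_def)
    have "phi z * (r \<alpha> z)\<^sup>2 = 4 * (sqrt (Phi \<alpha> z) - sqrt (phi z))\<^sup>2"
      using phi_root_ratio(2)[of z "Phi \<alpha>"] z Phi0 by (simp add: r_def)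
    also have "\<dots> \<le> 4 * \<bar>Phi \<alpha> z - phi z\<bar>"
      using sqrt_diff_sq_le[OF Phi0, of "phi z"] z by simp
    also have "Phi \<alpha> z - phi z = (\<alpha> * c x) * (lam x * (nu y - eta x y))"
      using nd by (simp add: Phi_def phi_def xy et_def algebra_simps)
    also have "4 * \<bar>(\<alpha> * c x) * (lam x * (nu y - eta x y))\<bar> \<le> 4 * (\<alpha> * (lam x * (nu y + eta x y)))"
      unfolding abs_mult using ac lp ep n0 by (intro mult_left_mono mult_mono) auto
    also have "\<dots> = phi z * (4 * \<alpha> * (1 + nu y / eta x y))"
      using ep by (simp add: phi_def xy field_simps)
    finally have r2: "(r \<alpha> z)\<^sup>2 \<le> 4 * \<alpha> * (1 + nu y / eta x y)" using z by simp
    \<comment> \<open>Outside \<open>good \<alpha>\<close> the failed inequality itself bounds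
      1/\<alpha> by \<open>2 * k x\<close>. This turns the Hellinger cost of order \<alpha>, divided
      by \<alpha>^2, into an integrable quantity.\<close>
    have "1 / \<alpha> \<le> 2 * k x" using ak \<alpha> by (simp add: xy field_simps)
    then have inv: "1 / \<alpha> * (1 + nu y / eta x y) \<le> 2 * k x * (1 + nu y / eta x y)"
      using n0 ep by (intro mult_right_mono) auto
    have "(r \<alpha> z - v z * \<alpha>)\<^sup>2 \<le> 2 * (r \<alpha> z)\<^sup>2 + 2 * (v z * \<alpha>)\<^sup>2"
      using sum_squares_ge_zero[of "r \<alpha> z + v z * \<alpha>" 0]
      by (simp add: power2_eq_square algebra_simps)
    then have "F \<alpha> z \<le> (2 * (r \<alpha> z)\<^sup>2 + 2 * (v z * \<alpha>)\<^sup>2) / \<alpha>\<^sup>2" unfolding F_def by (rule divide_right_mono) simp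
    also have "\<dots> = 2 * (r \<alpha> z)\<^sup>2 / \<alpha>\<^sup>2 + 2 * (v z)\<^sup>2" using \<alpha> by (simp add: add_divide_distrib power_mult_distrib)
    also have "2 * (r \<alpha> z)\<^sup>2 / \<alpha>\<^sup>2 \<le> 2 * (4 * \<alpha> * (1 + nu y / eta x y)) / \<alpha>\<^sup>2"
      using r2 by (intro divide_right_mono mult_left_mono) auto
    also have "2 * (4 * \<alpha> * (1 + nu y / eta x y)) / \<alpha>\<^sup>2 = 8 * (1 / \<alpha> * (1 + nu y / eta x y))"
      using \<alpha> by (simp add: power2_eq_square)
    also have "8 * (1 / \<alpha> * (1 + nu y / eta x y)) \<le> 8 * (2 * k x * (1 + nu y / eta x y))"
      using inv by (rule mult_left_mono) simp
    finally show ?thesis by (simp add: E_def xy algebra_simps)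
  qed
  have F_le_H: "F \<alpha> z \<le> H z"
    if z: "z \<in> space J \<and> 0 < phi z \<and> fst z \<in> G0" and \<alpha>: "0 < \<alpha>" "\<alpha> < 1" for \<alpha> z
  proof -
    have "0 \<le> k (fst z)" "0 \<le> nu (snd z) / eta (fst z) (snd z)"
      using z k0[of "fst z"] densities_nonneg[OF nu, of "snd z"] eta_nonneg[of "fst z" "snd z"] by auto
    from \<open>0 \<le> k (fst z)\<close> \<open>0 \<le> nu (snd z) / eta (fst z) (snd z)\<close> have h0: "0 \<le> E z"
      unfolding E_def
      by (intro add_nonneg_nonneg mult_nonneg_nonneg)
    have v2: "0 \<le> (v z)\<^sup>2" by simp
    show ?thesis
    proof (cases "\<alpha> * k (fst z) \<le> 1 / 2")
      case True
      from F_good'[OF z \<alpha>(1) this] h0 v2 show ?thesis unfolding H_def by linarith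
    next
      case False
      from F_bad[OF z \<alpha> this] h0 v2 show ?thesis unfolding H_def by linarith
    qed
  qed
  have F_meas [measurable]: "F \<alpha> \<in> borel_measurable \<mu>XY" for \<alpha>
    unfolding F_def by measurable
  have F0: "0 \<le> F \<alpha> z" for \<alpha> z by (simp add: F_def)
  have lim: "((\<lambda>\<alpha>. LINT z|J. F \<alpha> z) \<longlongrightarrow> 0) (at 0 within {0..<1})"
    unfolding tendsto_at_iff_sequentially comp_def
  proof (intro allI impI)
    fix a :: "nat \<Rightarrow> real" assume "\<forall>i. a i \<in> {0..<1} - {0}" and a0: "a \<longlonglongrightarrow> 0"
    then have a: "0 < a i" "a i < 1" for i by (auto simp: less_le)
    have "(\<lambda>i. LINT z|J. F (a i) z) \<longlonglongrightarrow> (LINT z|J. 0)"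
    proof (rule integral_dominated_convergence[OF _ _ iH])
      show "AE z in J. (\<lambda>i. F (a i) z) \<longlonglongrightarrow> 0"
        using nice
      proof eventually_elim
        case (elim z)
        have "(\<lambda>i. a i * k (fst z)) \<longlonglongrightarrow> 0 * k (fst z)" by (intro tendsto_intros a0)
        \<comment> \<open>For fixed \<open>z\<close> the mixing branch is left eventually, so only
          the linear branch matters for the pointwise limit.\<close>
        then have ev: "\<forall>\<^sub>F i in sequentially. a i * k (fst z) < 1 / 2" by (rule order_tendstoD) simp
        have "(\<lambda>i. (a i)\<^sup>2 * (v z)^4) \<longlonglongrightarrow> 0\<^sup>2 * (v z)^4" by (intro tendsto_intros a0)
        then have up: "(\<lambda>i. (a i)\<^sup>2 * (v z)^4) \<longlonglongrightarrow> 0" by simp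
        show ?case
        proof (rule tendsto_sandwich[OF _ _ tendsto_const up])
          show "\<forall>\<^sub>F i in sequentially. F (a i) z \<le> (a i)\<^sup>2 * (v z)^4"
            using ev by eventually_elim (use F_good[OF elim a(1)] in auto)
        qed (simp add: F0)
      qed
      show "AE z in J. norm (F (a i) z) \<le> H z" for i
        using nice by eventually_elim (use F_le_H a F0 in auto)
    qed auto
    then show "(\<lambda>i. LINT z|J. F (a i) z) \<longlonglongrightarrow> 0" by simp
  qed
  have norm_eq: "L2_norm J (\<lambda>z. r \<alpha> z - r 0 z - v z * \<alpha>) / \<bar>\<alpha>\<bar> = sqrt (LINT z|J. F \<alpha> z)" for \<alpha>
    by (simp add: F_def L2_norm_def L2_inner_self r0 real_sqrt_divide)
  have "((\<lambda>\<alpha>. L2_norm J (\<lambda>z. r \<alpha> z - r 0 z - v z * \<alpha>) / \<bar>\<alpha>\<bar>) \<longlongrightarrow> 0) (at 0 within {0..<1})"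
    unfolding norm_eq using tendsto_real_sqrt[OF lim] by simp
  then have "(\<lambda>\<alpha>. L2_norm J (\<lambda>z. r \<alpha> z - r 0 z - v z * \<alpha>)) \<in> o[at 0 within {0..<1}](\<lambda>\<alpha>. \<bar>\<alpha>\<bar>)"
    by (intro smalloI_tendsto) (auto simp: eventually_at_filter)
  moreover have "\<forall>\<alpha>\<in>{0..<1}. r \<alpha> \<in> root_ratio phi ` model \<mu>X \<mu>Y f B"
    unfolding r_def by (intro ballI imageI in_model)
  moreover have "AE z in J. r 0 z = 0" by (simp add: r0)
  ultimately show ?thesis unfolding curve_tangents_J using vL by blast
qed

end

section \<open>Conditional variance, conditional covariance and the residual directions\<close>

context central_model
begin

text \<open>The representative of q2 computed with the conditional laws \<open>N x\<close>.\<close>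

definition var :: "real^'d \<Rightarrow> real" where "var x = (LINT y|N x. (tb (x, y))\<^sup>2)"

lemma var_meas [measurable]: "var \<in> borel_measurable \<mu>X"
  unfolding var_def by measurable

lemma var_nonneg: "0 \<le> var x"
  by (simp add: var_def)

lemma tb_slice_L2: "x \<in> space \<mu>X \<Longrightarrow> (\<lambda>y. tb (x, y)) \<in> L2_space (N x)"
proof -
  assume x [measurable]: "x \<in> space \<mu>X"
  interpret prob_space "N x" by (rule prob_space_N[OF x])
  show ?thesis
    by (rule L2_space_bounded[of _ "2 * K"]) (auto intro!: AE_I2 tb_bound simp: x)
qed

lemma slice_L2:
  assumes g: "g \<in> L2_space J"
  shows "AE x in Lam. (\<lambda>y. g (x, y)) \<in> L2_space (N x)"
proof -
  have [measurable]: "g \<in> borel_measurable \<mu>XY" using L2_space_measurable[OF g] by simp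
  have "AE x in Lam. integrable (N x) (\<lambda>y. (g (x, y))\<^sup>2)"
    by (rule AE_integrable_N[OF L2_space_integrable_sq[OF g]])
  moreover have "AE x in Lam. x \<in> space Lam" by (rule AE_space)
  ultimately show ?thesis
  proof eventually_elim
    case (elim x)
    then have [measurable]: "x \<in> space \<mu>X" by simp
    show ?case by (rule L2_spaceI) (use elim in simp_all)
  qed
qed

definition mean0 :: "((real^'d) \<times> real \<Rightarrow> real) \<Rightarrow> real^'d \<Rightarrow> real" where
  "mean0 g x = (LINT y|N x. g (x, y))"

text \<open>As \<open>tb\<close> is centered under \<open>N x\<close>, this is the conditional
  covariance of \<open>g\<close> with \<open>tb\<close>.\<close>

definition mean1 :: "((real^'d) \<times> real \<Rightarrow> real) \<Rightarrow> real^'d \<Rightarrow> real" where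
  "mean1 g x = (LINT y|N x. tb (x, y) * g (x, y))"

lemma mean_meas [measurable]:
  assumes [measurable]: "g \<in> borel_measurable \<mu>XY"
  shows "mean0 g \<in> borel_measurable \<mu>X" "mean1 g \<in> borel_measurable \<mu>X"
  unfolding mean0_def mean1_def by measurable

lemma mean0_sq_le:
  assumes x: "x \<in> space \<mu>X" and g: "(\<lambda>y. g (x, y)) \<in> L2_space (N x)"
  shows "(mean0 g x)\<^sup>2 \<le> (LINT y|N x. (g (x, y))\<^sup>2)"
proof -
  interpret prob_space "N x" by (rule prob_space_N[OF x])
  have "\<bar>L2_inner (N x) (\<lambda>_. 1) (\<lambda>y. g (x, y))\<bar> \<le> L2_norm (N x) (\<lambda>_. 1) * L2_norm (N x) (\<lambda>y. g (x, y))"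
    by (rule L2_Cauchy_Schwarz[OF L2_space_bounded[of _ 1] g]) auto
  also have "L2_norm (N x) (\<lambda>_. 1) = 1"
    using prob_space[unfolded space_N] by (simp add: L2_norm_def L2_inner_def)
  finally have "\<bar>mean0 g x\<bar> \<le> L2_norm (N x) (\<lambda>y. g (x, y))" by (simp add: L2_inner_def mean0_def)
  from power_mono[OF this, of 2] show ?thesis by (simp add: L2_norm_power2)
qed

text \<open>Cauchy-Schwarz on a slice. The factor \<open>var x\<close> is what absorbs the inverse
  variance when \<open>proj1 g\<close> is shown to be square-integrable.\<close>

lemma mean1_sq_le:
  assumes x: "x \<in> space \<mu>X" and g: "(\<lambda>y. g (x, y)) \<in> L2_space (N x)"
  shows "(mean1 g x)\<^sup>2 \<le> var x * (LINT y|N x. (g (x, y))\<^sup>2)"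
proof -
  have "\<bar>mean1 g x\<bar> \<le> L2_norm (N x) (\<lambda>y. tb (x, y)) * L2_norm (N x) (\<lambda>y. g (x, y))"
    using L2_Cauchy_Schwarz[OF tb_slice_L2[OF x] g] by (simp add: L2_inner_def mean1_def)
  from power_mono[OF this, of 2] show ?thesis by (simp add: power_mult_distrib L2_norm_power2 var_def)
qed

lemma mean0_fst_L2:
  assumes g: "g \<in> L2_space J"
  shows "(\<lambda>z. mean0 g (fst z)) \<in> L2_space J"
proof -
  have [measurable]: "g \<in> borel_measurable \<mu>XY" using L2_space_measurable[OF g] by simp
  have "integrable Lam (\<lambda>x. (mean0 g x)\<^sup>2)"
  proof (rule Bochner_Integration.integrable_bound[OF integrable_integral_N[OF L2_space_integrable_sq[OF g]]])
    have "AE x in Lam. x \<in> space \<mu>X" using AE_space[of Lam] by simp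
    with slice_L2[OF g] show "AE x in Lam. norm ((mean0 g x)\<^sup>2) \<le> norm (LINT y|N x. (g (x, y))\<^sup>2)"
      by eventually_elim (use mean0_sq_le in fastforce)
  qed measurable
  then show ?thesis by (intro L2_spaceI) (auto simp: integrable_J_fst_iff[of "\<lambda>x. (mean0 g x)\<^sup>2"])
qed

lemma tb_mult_fst_L2:
  assumes [measurable]: "s \<in> borel_measurable \<mu>X" and i: "integrable Lam (\<lambda>x. (s x)\<^sup>2 * var x)"
  shows "(\<lambda>z. tb z * s (fst z)) \<in> L2_space J"
proof (rule L2_spaceI)
  show "integrable J (\<lambda>z. (tb z * s (fst z))\<^sup>2)"
  proof (rule integrable_J_nn_bound[OF _ i])
    fix x assume x: "x \<in> space \<mu>X"
    have "(\<integral>\<^sup>+y. ennreal \<bar>(tb (x, y) * s (fst (x, y)))\<^sup>2\<bar> \<partial>N x) = ennreal (LINT y|N x. (s x)\<^sup>2 * (tb (x, y))\<^sup>2)"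
      using tb_slice_L2[OF x]
      by (subst nn_integral_eq_integral[symmetric]) (auto simp: L2_space_def power_mult_distrib mult.commute)
    then show "(\<integral>\<^sup>+y. ennreal \<bar>(tb (x, y) * s (fst (x, y)))\<^sup>2\<bar> \<partial>N x) \<le> ennreal ((s x)\<^sup>2 * var x)"
      by (simp add: var_def)
  qed measurable
qed measurable

lemma inner_mean0:
  assumes g: "g \<in> L2_space J" and [measurable]: "s \<in> borel_measurable \<mu>X" and s: "(\<lambda>z. s (fst z)) \<in> L2_space J"
  shows "integrable Lam (\<lambda>x. mean0 g x * s x)" "L2_inner J g (\<lambda>z. s (fst z)) = (LINT x|Lam. mean0 g x * s x)"
proof -
  note i = L2_space_integrable_mult[OF g s]
  show "integrable Lam (\<lambda>x. mean0 g x * s x)" "L2_inner J g (\<lambda>z. s (fst z)) = (LINT x|Lam. mean0 g x * s x)"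
    using integrable_integral_N[OF i] integral_J[OF i] by (simp_all add: mean0_def L2_inner_def)
qed

lemma inner_mean1:
  assumes g: "g \<in> L2_space J" and s: "(\<lambda>z. tb z * s (fst z)) \<in> L2_space J"
  shows "integrable Lam (\<lambda>x. mean1 g x * s x)"
    and "L2_inner J g (\<lambda>z. tb z * s (fst z)) = (LINT x|Lam. mean1 g x * s x)"
proof -
  note i = L2_space_integrable_mult[OF g s]
  have "(LINT y|N x. g (x, y) * (tb (x, y) * s x)) = mean1 g x * s x" for x
  proof -
    have "(LINT y|N x. g (x, y) * (tb (x, y) * s x)) = (LINT y|N x. tb (x, y) * g (x, y) * s x)"
      by (simp only: mult_ac)
    then show ?thesis by (simp add: mean1_def)
  qed
  then show "integrable Lam (\<lambda>x. mean1 g x * s x)"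
    and "L2_inner J g (\<lambda>z. tb z * s (fst z)) = (LINT x|Lam. mean1 g x * s x)"
    using integrable_integral_N[OF i] integral_J[OF i] by (simp_all add: L2_inner_def)
qed

lemma tb_eq_0_if_var_eq_0:
  assumes x [measurable]: "x \<in> space \<mu>X" and "var x = 0"
  shows "AE y in N x. tb (x, y) = 0"
proof -
  have "AE y in N x. (tb (x, y))\<^sup>2 = 0"
    using assms(2) tb_slice_L2[OF x] unfolding var_def
    by (subst (asm) integral_nonneg_eq_0_iff_AE) (auto simp: L2_space_def)
  then show ?thesis by simp
qed

lemma mean1_eq_0_if_var_eq_0:
  assumes x: "x \<in> space \<mu>X" and "var x = 0"
  shows "mean1 g x = 0"
proof -
  have "mean1 g x = (LINT y|N x. tb (x, y) * g (x, y))" by (simp add: mean1_def)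
  also have "AE y in N x. tb (x, y) * g (x, y) = 0"
    using tb_eq_0_if_var_eq_0[OF assms] by eventually_elim simp
  then have "(LINT y|N x. tb (x, y) * g (x, y)) = 0" by (rule integral_eq_zero_AE)
  finally show ?thesis .
qed

text \<open>If the variance vanishes at one x whose conditional density is positive almost
  everywhere, then f is constant \<mu>Y-almost everywhere, and the variance vanishes at every x.
  Almost every x has such a density. This settles what \<open>inverse (var x)\<close> means: in the
  degenerate case it is 0 throughout, otherwise it is a true reciprocal almost everywhere.\<close>

lemma var_dichotomy: "(\<forall>x\<in>space \<mu>X. var x = 0) \<or> (AE x in Lam. var x \<noteq> 0)"
proof (cases "\<exists>x\<in>space \<mu>X. var x = 0 \<and> (AE y in \<mu>Y. 0 < eta x y)")
  case True
  then obtain x0 where x0 [measurable]: "x0 \<in> space \<mu>X" and v0: "var x0 = 0" and pos: "AE y in \<mu>Y. 0 < eta x0 y"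
    by blast
  have "AE y in \<mu>Y. 0 < ennreal (eta x0 y) \<longrightarrow> tb (x0, y) = 0"
    using tb_eq_0_if_var_eq_0[OF x0 v0] unfolding N_def by (subst (asm) AE_density) auto
  with pos have fb0: "AE y in \<mu>Y. fb y = m x0"
    by eventually_elim (simp add: tb_def)
  have "var x = 0" if x: "x \<in> space \<mu>X" for x
  proof -
    interpret prob_space "N x" by (rule prob_space_N[OF x])
    have ae: "AE y in N x. fb y = m x0" by (rule AE_N_I[OF x fb0])
    have "m x = (LINT y|N x. m x0)"
      unfolding m_eq_integral_N[OF x] by (rule integral_cong_AE) (use ae in auto)
    then have "m x = m x0" using prob_space[unfolded space_N] by simp
    then have "AE y in N x. (tb (x, y))\<^sup>2 = 0" using ae by (auto simp: tb_def)
    then show ?thesis unfolding var_def by (rule integral_eq_zero_AE)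
  qed
  then show ?thesis by blast
next
  case False
  have "AE x in Lam. AE y in \<mu>Y. 0 < eta x y" using AE_Lam_I[OF AE_eta_pos[OF phi_pos]] by eventually_elim simp
  moreover have "AE x in Lam. x \<in> space \<mu>X" using AE_space[of Lam] by simp
  ultimately have "AE x in Lam. var x \<noteq> 0" by eventually_elim (use False in auto)
  then show ?thesis ..
qed

end

text \<open>Integrability of the inverse variance supplies the envelopes \<open>k\<close> for the
  curves; in the theorem it is contained in the existence of the conditional expectation of the
  inverse of q2.\<close>

locale central_model_inverse_var = central_model \<mu>X \<mu>Y lam eta B f m K
  for \<mu>X :: "(real^'d) measure" and \<mu>Y :: "real measure"
    and lam :: "real^'d \<Rightarrow> real" and eta :: "real^'d \<Rightarrow> real \<Rightarrow> real"
    and B :: "real^'s^'d" and f :: "real \<Rightarrow> real" and m :: "real^'d \<Rightarrow> real" and K :: real +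
  assumes inverse_var: "integrable Lam (\<lambda>x. inverse (var x))"
begin

text \<open>The orthogonal projection onto the square-integrable functions of the form
  \<open>tb\<close> times a function of X. Where the variance is zero, \<open>inverse 0 = 0\<close>
  gives the correct value 0, because \<open>tb\<close> vanishes there almost surely.\<close>

definition proj1 :: "((real^'d) \<times> real \<Rightarrow> real) \<Rightarrow> (real^'d) \<times> real \<Rightarrow> real" where
  "proj1 g z = tb z * (inverse (var (fst z)) * mean1 g (fst z))"

lemma proj1_L2:
  assumes g: "g \<in> L2_space J"
  shows "proj1 g \<in> L2_space J"
proof -
  have [measurable]: "g \<in> borel_measurable \<mu>XY" using L2_space_measurable[OF g] by simp
  have "integrable Lam (\<lambda>x. (inverse (var x) * mean1 g x)\<^sup>2 * var x)"
  proof (rule Bochner_Integration.integrable_bound[OF integrable_integral_N[OF L2_space_integrable_sq[OF g]]])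
    have "AE x in Lam. x \<in> space \<mu>X" using AE_space[of Lam] by simp
    with slice_L2[OF g] show "AE x in Lam. norm ((inverse (var x) * mean1 g x)\<^sup>2 * var x) \<le> norm (LINT y|N x. (g (x, y))\<^sup>2)"
    proof eventually_elim
      case (elim x)
      show ?case
      proof (cases "var x = 0")
        case False
        then have v: "0 < var x" using var_nonneg[of x] by simp
        have "(inverse (var x) * mean1 g x)\<^sup>2 * var x = (mean1 g x)\<^sup>2 / var x"
          using v by (simp add: power2_eq_square field_simps)
        also have "\<dots> \<le> (LINT y|N x. (g (x, y))\<^sup>2)"
          using mean1_sq_le[OF elim(2,1)] v by (simp add: pos_divide_le_eq mult.commute)
        finally show ?thesis using v by simp
      qed simp
    qed
  qed measurable
  then show ?thesis unfolding proj1_def by (intro tb_mult_fst_L2) auto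
qed

lemma inner_proj1:
  assumes g: "g \<in> L2_space J" and h: "h \<in> L2_space J"
  shows "L2_inner J h (proj1 g) = (LINT x|Lam. inverse (var x) * mean1 g x * mean1 h x)"
    and "integrable Lam (\<lambda>x. inverse (var x) * mean1 g x * mean1 h x)"
  using inner_mean1[OF h, of "\<lambda>x. inverse (var x) * mean1 g x"] proj1_L2[OF g]
  by (simp_all add: proj1_def[abs_def] mult_ac)

text \<open>The conditional second moment of \<open>tb / var\<close> is
  \<open>var / var\<^sup>2\<close>, so the squared norm is controlled by the integral of the inverse
  variance.\<close>

lemma tb_inverse_var_L2:
  assumes [measurable]: "s \<in> borel_measurable \<mu>X" and s: "\<And>x. x \<in> space \<mu>X \<Longrightarrow> \<bar>s x\<bar> \<le> C"
  shows "(\<lambda>z. tb z * (inverse (var (fst z)) * s (fst z))) \<in> L2_space J"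
proof (rule tb_mult_fst_L2)
  show "integrable Lam (\<lambda>x. (inverse (var x) * s x)\<^sup>2 * var x)"
  proof (rule Bochner_Integration.integrable_bound)
    show "integrable Lam (\<lambda>x. C\<^sup>2 * inverse (var x))" using inverse_var by simp
    show "AE x in Lam. norm ((inverse (var x) * s x)\<^sup>2 * var x) \<le> norm (C\<^sup>2 * inverse (var x))"
    proof (rule AE_I2)
      fix x assume "x \<in> space Lam"
      then have "(s x)\<^sup>2 \<le> C\<^sup>2" using power_mono[OF s, of x 2] by simp
      then have "inverse (var x) * (s x)\<^sup>2 \<le> inverse (var x) * C\<^sup>2"
        using var_nonneg[of x] by (intro mult_left_mono) auto
      moreover have "(inverse (var x) * s x)\<^sup>2 * var x = inverse (var x) * (s x)\<^sup>2"
        by (cases "var x = 0") (simp_all add: power2_eq_square)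
      ultimately show "norm ((inverse (var x) * s x)\<^sup>2 * var x) \<le> norm (C\<^sup>2 * inverse (var x))"
        using var_nonneg[of x] by (simp add: mult.commute)
    qed
  qed measurable
qed measurable

lemma mean_tb_mult:
  assumes x: "x \<in> space \<mu>X"
  shows "(LINT y|N x. tb (x, y) * s) = 0" and "(LINT y|N x. fb y * (tb (x, y) * s)) = var x * s"
    and "integrable (N x) (\<lambda>y. tb (x, y) * s)" "integrable (N x) (\<lambda>y. fb y * (tb (x, y) * s))"
proof -
  interpret prob_space "N x" by (rule prob_space_N[OF x])
  have it: "integrable (N x) (\<lambda>y. tb (x, y))" by (rule L2_space_integrable[OF tb_slice_L2[OF x]])
  have it2: "integrable (N x) (\<lambda>y. (tb (x, y))\<^sup>2)" using tb_slice_L2[OF x] by (simp add: L2_space_def)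
  show "(LINT y|N x. tb (x, y) * s) = 0" using integral_tb_N[OF x] by simp
  show "integrable (N x) (\<lambda>y. tb (x, y) * s)" using it by simp
  have eq: "fb y * (tb (x, y) * s) = (tb (x, y))\<^sup>2 * s + (m x * s) * tb (x, y)" for y
    by (simp add: tb_def power2_eq_square algebra_simps)
  show "integrable (N x) (\<lambda>y. fb y * (tb (x, y) * s))" unfolding eq using it it2 by simp
  show "(LINT y|N x. fb y * (tb (x, y) * s)) = var x * s"
    unfolding eq using it it2 integral_tb_N[OF x] by (simp add: var_def)
qed

text \<open>Subtracting the conditional mean preserves mass and subtracting \<open>proj1\<close>
  preserves the mean of f, so the path stays in the model with an unchanged conditional mean.
  Boundedness of \<open>u\<close> makes the inverse variance, up to constants, an envelope.\<close>

lemma bounded_minus_proj_tangent: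
  assumes u [measurable]: "u \<in> borel_measurable \<mu>XY" and uC: "\<And>z. \<bar>u z\<bar> \<le> C"
  shows "(\<lambda>z. u z - mean0 u (fst z) - proj1 u z) \<in> tangents"
proof -
  have C: "0 \<le> C" using uC[of undefined] by linarith
  have uL: "u \<in> L2_space J" by (rule J.L2_space_bounded[of _ C]) (auto intro!: AE_I2 uC)
  have slice: "integrable (N x) (\<lambda>y. u (x, y))" "\<bar>mean0 u x\<bar> \<le> C" "\<bar>mean1 u x\<bar> \<le> 2 * K * C"
    "integrable (N x) (\<lambda>y. tb (x, y) * u (x, y))" if x [measurable]: "x \<in> space \<mu>X" for x
  proof -
    interpret prob_space "N x" by (rule prob_space_N[OF x])
    show i: "integrable (N x) (\<lambda>y. u (x, y))"
      by (rule integrable_const_bound[of _ C]) (auto intro!: AE_I2 uC)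
    have tbu: "\<bar>tb (x, y) * u (x, y)\<bar> \<le> 2 * K * C" if "y \<in> space \<mu>Y" for y
      unfolding abs_mult using tb_bound[of "(x, y)"] x that uC K_nonneg by (intro mult_mono) auto
    show i1: "integrable (N x) (\<lambda>y. tb (x, y) * u (x, y))"
      by (rule integrable_const_bound[of _ "2 * K * C"]) (auto intro!: AE_I2 tbu)
    have "\<bar>mean0 u x\<bar> \<le> (LINT y|N x. \<bar>u (x, y)\<bar>)" unfolding mean0_def by (rule integral_abs_bound)
    also have "\<dots> \<le> (LINT y|N x. C)" using i uC by (intro integral_mono) auto
    finally show "\<bar>mean0 u x\<bar> \<le> C" using prob_space[unfolded space_N] by simp
    have "\<bar>mean1 u x\<bar> \<le> (LINT y|N x. \<bar>tb (x, y) * u (x, y)\<bar>)" unfolding mean1_def by (rule integral_abs_bound)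
    also have "\<dots> \<le> (LINT y|N x. 2 * K * C)" using i1 tbu by (intro integral_mono) auto
    finally show "\<bar>mean1 u x\<bar> \<le> 2 * K * C" using prob_space[unfolded space_N] by simp
  qed
  obtain x0 where x0: "x0 \<in> space \<mu>X" using Lam.not_empty by auto
  define k where "k x = 2 * C + (2 * K) * (inverse (var x) * (2 * K * C))" for x
  show ?thesis
  \<comment> \<open>With \<open>c = 0\<close> the mean does not move and the mixing density gets
    weight zero; \<open>eta x0\<close> is simply a density at hand.\<close>
  proof (rule curve_tangentI[where k = k and ?G0.0 = "space \<mu>X" and c = "\<lambda>_. 0" and nu = "eta x0", OF _ _ _ _ _ _ _ _ _ _ _ eta[OF x0] refl])
    show "(\<lambda>z. u z - mean0 u (fst z) - proj1 u z) \<in> L2_space J"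
      by (intro L2_space_diff uL mean0_fst_L2 proj1_L2)
    show "k \<in> borel_measurable \<mu>X" unfolding k_def by measurable
    show "integrable Lam k" unfolding k_def using inverse_var by simp
    show "0 \<le> k x" for x unfolding k_def using C K_nonneg var_nonneg[of x] by simp
    fix x assume x: "x \<in> space \<mu>X"
    show "\<bar>u (x, y) - mean0 u (fst (x, y)) - proj1 u (x, y)\<bar> \<le> k x" if y: "y \<in> space \<mu>Y" for y
    proof -
      have "\<bar>proj1 u (x, y)\<bar> \<le> (2 * K) * (inverse (var x) * (2 * K * C))"
        unfolding proj1_def abs_mult fst_conv
        using tb_bound[of "(x, y)"] x y slice(3)[OF x] var_nonneg[of x] K_nonneg
        by (intro mult_mono) auto
      then show ?thesis using uC[of "(x, y)"] slice(2)[OF x] unfolding k_def fst_conv by linarith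
    qed
    interpret prob_space "N x" by (rule prob_space_N[OF x])
    note mt = mean_tb_mult[OF x, of "inverse (var x) * mean1 u x"]
    show "(LINT y|N x. u (x, y) - mean0 u (fst (x, y)) - proj1 u (x, y)) = 0"
      using slice(1)[OF x] mt(1,3) prob_space[unfolded space_N] by (simp add: proj1_def mean0_def)
    have fb_u: "fb y * u (x, y) = tb (x, y) * u (x, y) + m x * u (x, y)" for y
      by (simp add: tb_def algebra_simps)
    have fu: "integrable (N x) (\<lambda>y. fb y * u (x, y))"
      unfolding fb_u using slice(1,4)[OF x] by simp
    have fm: "(LINT y|N x. fb y * u (x, y)) = mean1 u x + m x * mean0 u x"
      unfolding fb_u using slice(1,4)[OF x] by (simp add: mean0_def mean1_def)
    have "(LINT y|N x. fb y * (u (x, y) - mean0 u (fst (x, y)) - proj1 u (x, y)))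
        = (LINT y|N x. fb y * u (x, y) - fb y * mean0 u x - fb y * (tb (x, y) * (inverse (var x) * mean1 u x)))"
      by (simp add: proj1_def right_diff_distrib)
    also have "\<dots> = mean1 u x + m x * mean0 u x - m x * mean0 u x - var x * (inverse (var x) * mean1 u x)"
      using fu fb_integrable_N[OF x] mt(2,4) fm m_eq_integral_N[OF x] by simp
    \<comment> \<open>The cancellation of \<open>var x\<close> also holds where it is zero, because
      the covariance is zero there as well.\<close>
    also have "\<dots> = 0" using mean1_eq_0_if_var_eq_0[OF x, of u] by (cases "var x = 0") auto
    finally show "(LINT y|N x. fb y * (u (x, y) - mean0 u (fst (x, y)) - proj1 u (x, y))) = 0 * ((LINT y|\<mu>Y. fb y * eta x0 y) - m x)"
      by simp
  qed (use AE_space[of Lam] in auto)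
qed

text \<open>The conditional covariance of \<open>tb / var\<close> with f is one, so this direction
  moves the conditional mean by \<open>c * (mean - m)\<close>, exactly as mixing in
  \<open>nu\<close> with weight \<open>\<alpha> * c\<close> does. The shift is
  \<open>G\<close>-measurable because \<open>c\<close> and \<open>m\<close> are.\<close>

lemma sigma_direction_tangent:
  assumes var0: "AE x in Lam. var x \<noteq> 0"
    and cG: "c \<in> borel_measurable G" and c01: "\<And>x. x \<in> space \<mu>X \<Longrightarrow> 0 \<le> c x \<and> c x \<le> 1"
    and nu: "nu \<in> densities \<mu>Y" and mean: "(LINT y|\<mu>Y. fb y * nu y) = mean"
  shows "(\<lambda>z. tb z * (inverse (var (fst z)) * (c (fst z) * (mean - m (fst z)))))
      \<in> tangents"
proof -
  have [measurable]: "c \<in> borel_measurable \<mu>X" by (rule measurable_G[OF cG])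
  have cm: "\<bar>c x * (mean - m x)\<bar> \<le> 1 * (\<bar>mean\<bar> + K)" if x: "x \<in> space \<mu>X" for x
    unfolding abs_mult using c01[OF x] m_bound[OF x] by (intro mult_mono) auto
  define k where "k x = (2 * K) * (inverse (var x) * (1 * (\<bar>mean\<bar> + K)))" for x
  have G0: "{x \<in> space \<mu>X. var x \<noteq> 0} \<in> sets \<mu>X" by measurable
  show ?thesis
  proof (rule curve_tangentI[where k = k and ?G0.0 = "{x \<in> space \<mu>X. var x \<noteq> 0}", OF _ _ _ _ G0 _ _ _ _ cG c01 nu mean])
    show "(\<lambda>z. tb z * (inverse (var (fst z)) * (c (fst z) * (mean - m (fst z))))) \<in> L2_space J"
      by (rule tb_inverse_var_L2[of "\<lambda>x. c x * (mean - m x)"]) (measurable, rule cm)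
    show "k \<in> borel_measurable \<mu>X" unfolding k_def by measurable
    show "integrable Lam k" unfolding k_def using inverse_var by simp
    show "0 \<le> k x" for x unfolding k_def using K_nonneg var_nonneg[of x] by simp
    show "AE x in Lam. x \<in> {x \<in> space \<mu>X. var x \<noteq> 0}"
      using var0 AE_space[of Lam] by eventually_elim simp
    fix x assume "x \<in> {x \<in> space \<mu>X. var x \<noteq> 0}"
    then have x: "x \<in> space \<mu>X" and v: "var x \<noteq> 0" by auto
    show "\<bar>tb (x, y) * (inverse (var (fst (x, y))) * (c (fst (x, y)) * (mean - m (fst (x, y)))))\<bar> \<le> k x" if y: "y \<in> space \<mu>Y" for y
    proof -
      have "\<bar>tb (x, y) * (inverse (var x) * (c x * (mean - m x)))\<bar> = \<bar>tb (x, y)\<bar> * (inverse (var x) * \<bar>c x * (mean - m x)\<bar>)"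
        using var_nonneg[of x] by (simp add: abs_mult)
      also have "\<dots> \<le> k x"
        unfolding k_def using tb_bound[of "(x, y)"] cm[OF x] x y var_nonneg[of x] K_nonneg
        by (intro mult_mono) auto
      finally show ?thesis by simp
    qed
    note mt = mean_tb_mult[OF x, of "inverse (var x) * (c x * (mean - m x))"]
    show "(LINT y|N x. tb (x, y) * (inverse (var (fst (x, y))) * (c (fst (x, y)) * (mean - m (fst (x, y)))))) = 0"
      using mt(1) by simp
    show "(LINT y|N x. fb y * (tb (x, y) * (inverse (var (fst (x, y))) * (c (fst (x, y)) * (mean - m (fst (x, y))))))) = c x * (mean - m x)"
      using mt(2) v by simp
  qed
qed

text \<open>Conditional mean and \<open>proj1\<close> are self-adjoint. Orthogonality of
  \<open>h\<close> to the residual of every indicator is therefore orthogonality of the residual of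
  \<open>h\<close> to every indicator.\<close>

lemma orth_tangents_decomposition:
  assumes h: "h \<in> L2_space J"
    and orth: "\<And>v. v \<in> tangents \<Longrightarrow> L2_inner J h v = 0"
  shows "AE z in J. h z = mean0 h (fst z) + proj1 h z"
proof -
  have [measurable]: "h \<in> borel_measurable \<mu>XY" using L2_space_measurable[OF h] by simp
  have hL: "(\<lambda>z. mean0 h (fst z) + proj1 h z) \<in> L2_space J"
    by (intro L2_space_add mean0_fst_L2 proj1_L2 h)
  show ?thesis
  proof (rule density_unique_real[OF J.L2_space_integrable[OF h] J.L2_space_integrable[OF hL]])
    fix A assume "A \<in> sets J"
    then have [measurable]: "A \<in> sets \<mu>XY" by simp
    define u :: "_ \<Rightarrow> real" where "u = indicator A"
    have [measurable]: "u \<in> borel_measurable \<mu>XY" by (simp add: u_def)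
    have u1: "\<bar>u z\<bar> \<le> 1" for z by (simp add: u_def indicator_def)
    have uL: "u \<in> L2_space J" by (rule J.L2_space_bounded[of _ 1]) (auto intro!: AE_I2 u1)
    note L = mean0_fst_L2[OF uL] proj1_L2[OF uL] mean0_fst_L2[OF h] proj1_L2[OF h]
    have "0 = L2_inner J h (\<lambda>z. u z - mean0 u (fst z) - proj1 u z)"
      by (rule orth[OF bounded_minus_proj_tangent[of u 1], symmetric]) (auto simp: u1)
    also have "\<dots> = L2_inner J h u - L2_inner J h (\<lambda>z. mean0 u (fst z)) - L2_inner J h (proj1 u)"
      using L2_space_integrable_mult[OF h uL] L2_space_integrable_mult[OF h L(1)] L2_space_integrable_mult[OF h L(2)]
      by (simp add: L2_inner_def right_diff_distrib)
    also have "L2_inner J h (\<lambda>z. mean0 u (fst z)) = L2_inner J u (\<lambda>z. mean0 h (fst z))"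
      using inner_mean0(2)[OF h _ L(1)] inner_mean0(2)[OF uL _ L(3)] by (simp add: mult.commute)
    also have "L2_inner J h (proj1 u) = L2_inner J u (proj1 h)"
      using inner_proj1(1)[OF h uL] inner_proj1(1)[OF uL h] by (simp add: mult_ac)
    finally have "L2_inner J u h = L2_inner J u (\<lambda>z. mean0 h (fst z)) + L2_inner J u (proj1 h)"
      by (simp add: L2_inner_def mult.commute)
    also have "\<dots> = L2_inner J u (\<lambda>z. mean0 h (fst z) + proj1 h z)"
      using L2_space_integrable_mult[OF uL L(3)] L2_space_integrable_mult[OF uL L(4)]
      by (simp add: L2_inner_def distrib_left)
    finally show "(\<integral>z\<in>A. h z \<partial>J) = (\<integral>z\<in>A. (mean0 h (fst z) + proj1 h z) \<partial>J)"
      by (simp add: L2_inner_def u_def set_lebesgue_integral_def)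
  qed
qed

text \<open>With \<open>c\<close> the indicator of \<open>A\<close>, two densities with different
  means of f give two tangents whose difference is a nonzero multiple of
  \<open>c * tb / var\<close>, with \<open>m\<close> cancelled.\<close>

lemma orth_tangents_sigma:
  assumes h: "h \<in> L2_space J"
    and orth: "\<And>v. v \<in> tangents \<Longrightarrow> L2_inner J h v = 0"
    and A: "A \<in> sets G"
  shows "(LINT x|Lam. indicator A x * (inverse (var x) * mean1 h x)) = 0"
  using var_dichotomy
proof
  assume "\<forall>x\<in>space \<mu>X. var x = 0"
  then have "(LINT x|Lam. indicator A x * (inverse (var x) * mean1 h x)) = (LINT x|Lam. 0)"
    by (intro Bochner_Integration.integral_cong) auto
  then show ?thesis by simp
next
  assume var0: "AE x in Lam. var x \<noteq> 0"
  define c :: "_ \<Rightarrow> real" where "c = indicator A"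
  have cG: "c \<in> borel_measurable G" using A by (simp add: c_def)
  then have [measurable]: "c \<in> borel_measurable \<mu>X" by (rule measurable_G)
  have c01: "0 \<le> c x \<and> c x \<le> 1" for x by (simp add: c_def indicator_def)
  have [measurable]: "h \<in> borel_measurable \<mu>XY" using L2_space_measurable[OF h] by simp
  have key: "(LINT x|Lam. mean1 h x * (inverse (var x) * (c x * (mean - m x)))) = 0 \<and>
      integrable Lam (\<lambda>x. mean1 h x * (inverse (var x) * (c x * (mean - m x))))"
    if nu: "nu \<in> densities \<mu>Y" "(LINT y|\<mu>Y. fb y * nu y) = mean" for nu mean
  proof -
    note t = sigma_direction_tangent[OF var0 cG c01 nu]
    then have "(\<lambda>z. tb z * (inverse (var (fst z)) * (c (fst z) * (mean - m (fst z))))) \<in> L2_space J"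
      by (simp add: curve_tangents_J)
    from inner_mean1[OF h, of "\<lambda>x. inverse (var x) * (c x * (mean - m x))", OF this] orth[OF t] show ?thesis by simp
  qed
  have "\<not> (\<forall>x\<in>space \<mu>X. var x = 0)"
  proof
    assume all0: "\<forall>x\<in>space \<mu>X. var x = 0"
    from var0 AE_space[of Lam] have "AE x in Lam. False" by eventually_elim (use all0 in auto)
    then show False by simp
  qed
  then obtain x1 where x1 [measurable]: "x1 \<in> space \<mu>X" and v1: "var x1 \<noteq> 0" by blast
  have K1: "0 < 2 * K + 1" using K_nonneg by simp
  \<comment> \<open>The second density tilts \<open>eta x1\<close> towards larger values of
    \<open>fb\<close>. The divisor exceeds the bound \<open>2 * K\<close> for \<open>tb\<close>,
    which keeps the tilt nonnegative and is positive even for \<open>K = 0\<close>; the mean grows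
    by \<open>var x1 / (2 * K + 1)\<close>, which is not zero.\<close>
  define nu where "nu y = eta x1 y + tb (x1, y) * eta x1 y / (2 * K + 1)" for y
  have i1: "integrable \<mu>Y (eta x1)" by (rule densities_integrable[OF eta[OF x1]])
  have mt1: "(LINT y|\<mu>Y. eta x1 y * tb (x1, y)) = 0" "integrable \<mu>Y (\<lambda>y. eta x1 y * tb (x1, y))"
    using mean_tb_mult(1,3)[OF x1, of 1] by (simp_all add: integral_N_density[OF x1])
  have mt2: "(LINT y|\<mu>Y. eta x1 y * (fb y * tb (x1, y))) = var x1" "integrable \<mu>Y (\<lambda>y. eta x1 y * (fb y * tb (x1, y)))"
    using mean_tb_mult(2,4)[OF x1, of 1] by (simp_all add: integral_N_density[OF x1])
  have nu: "nu \<in> densities \<mu>Y"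
  proof (rule densitiesI)
    show "integrable \<mu>Y nu" unfolding nu_def using i1 mt1 by (simp add: mult.commute)
    fix y assume y: "y \<in> space \<mu>Y"
    have "\<bar>tb (x1, y)\<bar> \<le> 2 * K + 1" using tb_bound[of "(x1, y)"] x1 y by auto
    then have "0 \<le> 1 + tb (x1, y) / (2 * K + 1)" using K1 by (simp add: field_simps)
    then have "0 \<le> eta x1 y * (1 + tb (x1, y) / (2 * K + 1))" using eta_nonneg[OF x1 y] by simp
    then show "0 \<le> nu y" by (simp add: nu_def algebra_simps)
  next
    show "(LINT y|\<mu>Y. nu y) = 1"
      unfolding nu_def using i1 mt1 densities_integral[OF eta[OF x1]] by (simp add: mult.commute)
  qed
  have mean2: "(LINT y|\<mu>Y. fb y * nu y) = m x1 + var x1 / (2 * K + 1)"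
  proof -
    have "(LINT y|\<mu>Y. fb y * nu y) = (LINT y|\<mu>Y. fb y * eta x1 y + (eta x1 y * (fb y * tb (x1, y))) / (2 * K + 1))"
      by (intro Bochner_Integration.integral_cong) (auto simp: nu_def algebra_simps)
    also have "\<dots> = (LINT y|\<mu>Y. fb y * eta x1 y) + var x1 / (2 * K + 1)"
      using mt2 fb_mult_integrable[OF eta[OF x1]] by simp
    also have "(LINT y|\<mu>Y. fb y * eta x1 y) = m x1"
      using m_eq_integral_N[OF x1] by (simp add: integral_N_density[OF x1] mult_ac)
    finally show ?thesis .
  qed
  have mean1': "(LINT y|\<mu>Y. fb y * eta x1 y) = m x1"
    using m_eq_integral_N[OF x1] by (simp add: integral_N_density[OF x1] mult_ac)
  define l where "l x = inverse (var x) * mean1 h x" for x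
  have "0 = (LINT x|Lam. mean1 h x * (inverse (var x) * (c x * (m x1 + var x1 / (2 * K + 1) - m x))))
      - (LINT x|Lam. mean1 h x * (inverse (var x) * (c x * (m x1 - m x))))"
    using key[OF nu mean2] key[OF eta[OF x1] mean1'] by simp
  also have "\<dots> = (LINT x|Lam. mean1 h x * (inverse (var x) * (c x * (m x1 + var x1 / (2 * K + 1) - m x)))
      - mean1 h x * (inverse (var x) * (c x * (m x1 - m x))))"
    using key[OF nu mean2] key[OF eta[OF x1] mean1'] by simp
  also have "\<dots> = (LINT x|Lam. (var x1 / (2 * K + 1)) * (c x * l x))"
    by (intro Bochner_Integration.integral_cong) (auto simp: l_def algebra_simps)
  also have "\<dots> = (var x1 / (2 * K + 1)) * (LINT x|Lam. c x * l x)" by simp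
  finally show ?thesis using v1 K1 by (simp add: c_def l_def)
qed

text \<open>By the preceding lemmas \<open>h\<close> is a function of X plus
  \<open>tb * l(X)\<close> with zero conditional expectation of \<open>l\<close> given
  \<open>G\<close>. The centering of \<open>V\<close> removes the first part, and the second
  contributes the integral of \<open>w * l\<close>, which vanishes as \<open>w\<close> is
  \<open>G\<close>-measurable.\<close>

lemma orth_tangents_inner_eq_0:
  assumes h: "h \<in> L2_space J"
    and orth: "\<And>v. v \<in> tangents \<Longrightarrow> L2_inner J h v = 0"
    and V: "V \<in> L2_space J" and V0: "AE x in Lam. mean0 V x = 0"
    and wG: "w \<in> borel_measurable G"
    and V1: "AE x in Lam. inverse (var x) * mean1 V x = inverse (var x) * w x"
  shows "L2_inner J V h = 0"
proof -
  have [measurable]: "h \<in> borel_measurable \<mu>XY" "V \<in> borel_measurable \<mu>XY"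
    using L2_space_measurable[OF h] L2_space_measurable[OF V] by simp_all
  have [measurable]: "w \<in> borel_measurable \<mu>X" by (rule measurable_G[OF wG])
  note L = mean0_fst_L2[OF h] proj1_L2[OF h]
  have [measurable]: "(\<lambda>z. proj1 h z) \<in> borel_measurable J" using L2_space_measurable[OF L(2)] .
  define l where "l x = inverse (var x) * mean1 h x" for x
  have [measurable]: "l \<in> borel_measurable \<mu>X" unfolding l_def by measurable
  have il: "integrable Lam l"
  proof -
    have "(\<lambda>z. tb z * (inverse (var (fst z)) * 1)) \<in> L2_space J"
      by (rule tb_inverse_var_L2[of "\<lambda>_. 1" 1]) auto
    from inner_mean1(1)[OF h, of "\<lambda>x. inverse (var x) * 1", OF this] show ?thesis
      by (simp add: l_def[abs_def] mult.commute)
  qed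
  have "AE x in Lam. real_cond_exp Lam G l x = 0"
  proof (rule G.real_cond_exp_charact[OF _ il])
    fix A assume "A \<in> sets G"
    then have "(LINT x|Lam. indicator A x * (inverse (var x) * mean1 h x)) = 0"
      by (intro orth_tangents_sigma[OF h] orth)
    then show "(\<integral>x\<in>A. l x \<partial>Lam) = (\<integral>x\<in>A. 0 \<partial>Lam)"
      by (simp add: set_lebesgue_integral_def l_def)
  qed auto
  note ce0 = this
  have dec: "AE z in J. h z = mean0 h (fst z) + proj1 h z"
    by (rule orth_tangents_decomposition[OF h]) (rule orth)
  have "L2_inner J V h = L2_inner J V (\<lambda>z. mean0 h (fst z) + proj1 h z)"
    unfolding L2_inner_def
  proof (rule integral_cong_AE)
    show "AE z in J. V z * h z = V z * (mean0 h (fst z) + proj1 h z)"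
      using dec by eventually_elim simp
  qed simp_all
  also have "\<dots> = L2_inner J V (\<lambda>z. mean0 h (fst z)) + L2_inner J V (proj1 h)"
    using L2_space_integrable_mult[OF V L(1)] L2_space_integrable_mult[OF V L(2)]
    by (simp add: L2_inner_def distrib_left)
  also have "L2_inner J V (\<lambda>z. mean0 h (fst z)) = 0"
  proof -
    have "L2_inner J V (\<lambda>z. mean0 h (fst z)) = (LINT x|Lam. mean0 V x * mean0 h x)"
      by (rule inner_mean0(2)[OF V _ L(1)]) measurable
    also have "\<dots> = 0"
      by (rule integral_eq_zero_AE) (use V0 in \<open>auto elim!: eventually_mono\<close>)
    finally show ?thesis .
  qed
  also have "L2_inner J V (proj1 h) = (LINT x|Lam. w x * l x)"
  proof -
    have "L2_inner J V (proj1 h) = (LINT x|Lam. inverse (var x) * mean1 h x * mean1 V x)"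
      by (rule inner_proj1(1)[OF h V])
    also have "\<dots> = (LINT x|Lam. w x * l x)"
    proof (rule integral_cong_AE)
      show "AE x in Lam. inverse (var x) * mean1 h x * mean1 V x = w x * l x"
        using V1 by eventually_elim (auto simp: l_def)
    qed measurable
    finally show ?thesis .
  qed
  also have "\<dots> = (LINT x|Lam. w x * real_cond_exp Lam G l x)"
  proof (rule G.real_cond_exp_intg(2)[symmetric, OF _ wG])
    \<comment> \<open>No integrability of \<open>w\<close> alone is at hand; that of the product
      comes from the square-integrability of \<open>V\<close> and \<open>h\<close>.\<close>
    show "integrable Lam (\<lambda>x. w x * l x)"
    proof (rule integrable_cong_AE_imp[OF inner_proj1(2)[OF h V]])
      show "AE x in Lam. inverse (var x) * mean1 h x * mean1 V x = w x * l x"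
        using V1 by eventually_elim (auto simp: l_def)
    qed measurable
  qed simp
  also have "\<dots> = 0"
    by (rule integral_eq_zero_AE) (use ce0 in \<open>auto elim!: eventually_mono\<close>)
  finally show ?thesis by simp
qed

end

section \<open>The efficient score\<close>

context joint_density
begin

text \<open>r^2 = 2 (1 + r/2)^2 + 2 (1 - r/2)^2 - 4, so existence of the functional at r, -r and 0
  makes g r^2 integrable.\<close>

lemma integrable_mult_sq_of_perturbation:
  fixes g :: "'b \<Rightarrow> real"
  assumes x: "x \<in> space \<mu>X" and g [measurable]: "g \<in> borel_measurable \<mu>Y"
    and int: "\<And>r. r \<in> L2_space (N x) \<Longrightarrow> integrable \<mu>Y (\<lambda>y. g y * (1 + r y / 2)\<^sup>2 * eta x y)"
    and r: "r \<in> L2_space (N x)"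
  shows "integrable (N x) (\<lambda>y. g y * (r y)\<^sup>2)"
proof -
  have i: "integrable (N x) (\<lambda>y. g y * (1 + s y / 2)\<^sup>2)" if s: "s \<in> L2_space (N x)" for s
  proof -
    have [measurable]: "s \<in> borel_measurable \<mu>Y" using L2_space_measurable[OF s] by simp
    show ?thesis using int[OF s] by (subst integral_N_density(2)[OF x]) (simp_all add: mult_ac)
  qed
  have z: "(\<lambda>_. 0) \<in> L2_space (N x)" by (simp add: L2_space_def)
  have mr: "(\<lambda>y. - r y) \<in> L2_space (N x)" using L2_space_cmult[OF r, of "-1"] by simp
  have eq: "g y * (r y)\<^sup>2 = 2 * (g y * (1 + r y / 2)\<^sup>2) + 2 * (g y * (1 + - r y / 2)\<^sup>2) - 4 * (g y * (1 + 0 / 2)\<^sup>2)" for y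
    by (simp add: power2_eq_square field_simps)
  show ?thesis
    unfolding eq using i[OF r] i[OF mr] i[OF z]
    by (intro Bochner_Integration.integrable_add Bochner_Integration.integrable_diff integrable_mult_right)
qed

end

context central_model
begin

lemma AE_eq_riesz_rep:
  assumes x: "x \<in> space \<mu>X"
    and C1: "L2_C1_near_zero (N x) (local_functional \<mu>Y f (eta x)) D"
    and riesz: "is_riesz_rep (N x) (D (\<lambda>_. 0)) t"
  shows "AE y in N x. t y = fb y"
proof -
  interpret prob_space "N x" by (rule prob_space_N[OF x])
  have f_ae: "AE y in N x. \<bar>f y\<bar> \<le> K" by (rule AE_N_I[OF x f_bound])
  have fL: "f \<in> L2_space (N x)" by (rule L2_space_bounded[OF _ f_ae]) simp
  have z: "(\<lambda>_. 0) \<in> L2_space (N x)" by (simp add: L2_space_def)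
  have loc: "local_functional \<mu>Y f (eta x) r = (LINT y|N x. f y * (1 + r y / 2)\<^sup>2)" if r: "r \<in> L2_space (N x)" for r
  proof -
    have [measurable]: "r \<in> borel_measurable \<mu>Y" using L2_space_measurable[OF r] by simp
    show ?thesis
      unfolding local_functional_def by (subst integral_N_density(1)[OF x]) (simp_all add: mult_ac)
  qed
  have "L2_norm (N x) (\<lambda>_. 0) = 0" by (simp add: L2_norm_def L2_inner_def)
  then have "has_L2_derivative (N x) (local_functional \<mu>Y f (eta x)) (D (\<lambda>_. 0)) (\<lambda>_. 0)"
    using C1 z unfolding L2_C1_near_zero_def by (metis (no_types, lifting))
  then have der: "has_L2_derivative (N x) (\<lambda>r. LINT y|N x. f y * (1 + r y / 2)\<^sup>2) (D (\<lambda>_. 0)) (\<lambda>_. 0)"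
    unfolding has_L2_derivative_def by (simp add: loc loc[OF z])
  have "AE y in N x. t y = f y"
  proof (rule AE_eq_riesz_rep_perturbation[OF fL _ der riesz])
    fix r assume "r \<in> L2_space (N x)"
    then show "integrable (N x) (\<lambda>y. f y * (r y)\<^sup>2)"
      using integrable_mult_bounded[OF L2_space_integrable_sq _ f_ae] by simp
  qed
  moreover have "AE y in N x. fb y = f y" by (rule AE_N_I[OF x fb_eq])
  ultimately show ?thesis by eventually_elim simp
qed

text \<open>The factor \<open>lam x\<close> cancels in the root ratio, so inserting the root ratio
  into the local functional gives back the mean of f under \<open>etas \<theta>\<close>. The second
  claim is the same computation with f replaced by 1, where the integral is constantly one.\<close>

lemma mean_has_derivative:
  fixes etas :: "real^'p \<Rightarrow> real \<Rightarrow> real"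
  assumes x: "x \<in> space \<mu>X" and lam_pos: "0 < lam x" and eta_pos: "AE y in \<mu>Y. 0 < eta x y"
    and etas: "\<And>\<theta>. etas \<theta> \<in> densities \<mu>Y" and etas0: "etas \<theta>0 = eta x"
    and grad: "has_L2_gradient (N x) (\<lambda>\<theta> y. root_ratio (\<lambda>y. lam x * eta x y) (\<lambda>y. lam x * etas \<theta> y) y) D \<theta>0"
  shows "((\<lambda>\<theta>. stat_functional \<mu>Y f (etas \<theta>)) has_derivative (\<lambda>h. (\<chi> i. LINT y|N x. fb y * D y $ i) \<bullet> h)) (at \<theta>0)"
    and "(LINT y|N x. D y $ i) = 0"
proof -
  interpret prob_space "N x" by (rule prob_space_N[OF x])
  let ?F = "\<lambda>\<theta> y. root_ratio (\<lambda>y. lam x * eta x y) (\<lambda>y. lam x * etas \<theta> y) y"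
  have F0: "AE y in N x. ?F \<theta>0 y = 0" by (simp add: etas0 root_ratio_def)
  have eq: "(LINT y|N x. g y * (1 + ?F \<theta> y / 2)\<^sup>2) = (LINT y|\<mu>Y. g y * etas \<theta> y)"
    if [measurable]: "g \<in> borel_measurable \<mu>Y" for g \<theta>
  proof -
    have "?F \<theta> \<in> L2_space (N x)" using grad by (simp add: has_L2_gradient_def)
    from L2_space_measurable[OF this] have [measurable]: "?F \<theta> \<in> borel_measurable \<mu>Y" by simp
    have [measurable]: "etas \<theta> \<in> borel_measurable \<mu>Y" by (rule densities_measurable[OF etas])
    have "(LINT y|N x. g y * (1 + ?F \<theta> y / 2)\<^sup>2) = (LINT y|\<mu>Y. eta x y * (g y * (1 + ?F \<theta> y / 2)\<^sup>2))"
      by (rule integral_N_density(1)[OF x]) measurable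
    also have "\<dots> = (LINT y|\<mu>Y. g y * etas \<theta> y)"
    proof (rule integral_cong_AE)
      have "AE y in \<mu>Y. y \<in> space \<mu>Y" by (rule AE_space)
      with eta_pos show "AE y in \<mu>Y. eta x y * (g y * (1 + ?F \<theta> y / 2)\<^sup>2) = g y * etas \<theta> y"
      proof eventually_elim
        case (elim y)
        have p: "0 < lam x * eta x y" "0 \<le> lam x * etas \<theta> y"
          using elim lam_pos densities_nonneg[OF etas elim(2)] by auto
        have "1 + ?F \<theta> y / 2 = sqrt (lam x * etas \<theta> y) / sqrt (lam x * eta x y)"
          using p elim(1) lam_pos by (simp add: root_ratio_def diff_divide_distrib)
        then have "(1 + ?F \<theta> y / 2)\<^sup>2 = (lam x * etas \<theta> y) / (lam x * eta x y)"
          using p by (simp add: power_divide)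
        then show ?case using elim lam_pos by simp
      qed
    qed (measurable, use x in measurable)
    finally show ?thesis .
  qed
  have "((\<lambda>\<theta>. LINT y|N x. fb y * (1 + ?F \<theta> y / 2)\<^sup>2) has_derivative (\<lambda>h. (\<chi> i. LINT y|N x. fb y * D y $ i) \<bullet> h)) (at \<theta>0)"
    by (rule has_derivative_perturbation_of_gradient[OF _ _ grad F0, of fb K]) (auto intro!: AE_I2 fb_bound)
  then show "((\<lambda>\<theta>. stat_functional \<mu>Y f (etas \<theta>)) has_derivative (\<lambda>h. (\<chi> i. LINT y|N x. fb y * D y $ i) \<bullet> h)) (at \<theta>0)"
    by (simp add: eq stat_functional_fb densities_measurable[OF etas])
  have "((\<lambda>\<theta>. LINT y|N x. 1 * (1 + ?F \<theta> y / 2)\<^sup>2) has_derivative (\<lambda>h. (\<chi> i. LINT y|N x. 1 * D y $ i) \<bullet> h)) (at \<theta>0)"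
    by (rule has_derivative_perturbation_of_gradient[OF _ _ grad F0, of "\<lambda>_. 1" 1]) auto
  then have "((\<lambda>\<theta>. 1) has_derivative (\<lambda>h. (\<chi> i. LINT y|N x. 1 * D y $ i) \<bullet> h)) (at \<theta>0)"
    unfolding eq[of "\<lambda>_. 1", simplified, unfolded densities_integral[OF etas]] by (simp add: eq[of "\<lambda>_. 1", simplified] densities_integral[OF etas])
  \<comment> \<open>The gradient functional is zero; its value at its own representing vector is the
    squared norm of that vector.\<close>
  from has_derivative_unique[OF this has_derivative_const]
  have "(\<chi> i. LINT y|N x. 1 * D y $ i) \<bullet> (\<chi> i. LINT y|N x. 1 * D y $ i) = 0" by metis
  then have "(\<chi> i. LINT y|N x. D y $ i) = 0" by simp
  then show "(LINT y|N x. D y $ i) = 0" by (simp add: vec_eq_iff)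
qed

lemma var_eq: "x \<in> space \<mu>X \<Longrightarrow> var x = (LINT y|N x. (fb y)\<^sup>2) - (m x)\<^sup>2"
proof -
  assume x: "x \<in> space \<mu>X"
  interpret prob_space "N x" by (rule prob_space_N[OF x])
  have i2: "integrable (N x) (\<lambda>y. (fb y)\<^sup>2)"
    by (rule L2_space_integrable_sq[OF L2_space_bounded[of _ K]]) (auto intro!: AE_I2 fb_bound)
  have "var x = (LINT y|N x. (fb y)\<^sup>2 - 2 * m x * fb y + (m x)\<^sup>2)"
    by (simp add: var_def tb_def power2_diff algebra_simps)
  also have "\<dots> = (LINT y|N x. (fb y)\<^sup>2) - 2 * m x * m x + (m x)\<^sup>2"
    using i2 fb_integrable_N[OF x] m_eq_integral_N[OF x] prob_space[unfolded space_N] by simp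
  finally show ?thesis by (simp add: power2_eq_square)
qed

lemma slice_measurable_G:
  assumes g: "(\<lambda>(x, y). g x) \<in> borel_measurable (sigma_proj_joint \<mu>X \<mu>Y B)"
  shows "g \<in> borel_measurable G"
proof -
  obtain y0 where y0: "y0 \<in> space \<mu>Y" using space_Y_nonempty by auto
  have "(\<lambda>x. transpose B *v fst (x, y0)) \<in> measurable G borel"
    unfolding sigma_proj_def fst_conv by (rule measurable_vimage_algebra1) auto
  then have "(\<lambda>x. (x, y0)) \<in> measurable G (sigma_proj_joint \<mu>X \<mu>Y B)"
    unfolding sigma_proj_joint_def
    by (intro measurable_vimage_algebra2) (auto simp: sigma_proj_def y0)
  from measurable_compose[OF this g] show ?thesis by simp
qed

lemma fst_measurable_G_joint:
  assumes g: "g \<in> borel_measurable G"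
  shows "(\<lambda>z. g (fst z)) \<in> borel_measurable (sigma_proj_joint \<mu>X \<mu>Y B)"
proof -
  have "(\<lambda>z. transpose B *v fst z) \<in> measurable (sigma_proj_joint \<mu>X \<mu>Y B) borel"
    unfolding sigma_proj_joint_def by (rule measurable_vimage_algebra1) auto
  then have "fst \<in> measurable (sigma_proj_joint \<mu>X \<mu>Y B) G"
    unfolding sigma_proj_def by (intro measurable_vimage_algebra2) (auto simp: sigma_proj_joint_def)
  from measurable_compose[OF this g] show ?thesis .
qed

text \<open>\<open>e12 / e2\<close> is the conditional mean of \<open>q\<close> with respect to the
  weight \<open>inverse q2\<close>. The weighted residual therefore has conditional expectation
  \<open>e12 - (e12 / e2) * e2 = 0\<close>, where \<open>e2\<close> is positive as the conditional
  expectation of a positive weight.\<close>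

lemma weighted_residual_orth_sigma:
  assumes q [measurable]: "q \<in> borel_measurable \<mu>X" and q2 [measurable]: "q2 \<in> borel_measurable \<mu>X"
    and q2_pos: "AE x in Lam. 0 < q2 x"
    and e12: "is_cond_exp J (sigma_proj_joint \<mu>X \<mu>Y B) (\<lambda>(x, y). q x * inverse (q2 x)) (\<lambda>(x, y). e12 x)"
    and e2: "is_cond_exp J (sigma_proj_joint \<mu>X \<mu>Y B) (\<lambda>(x, y). inverse (q2 x)) (\<lambda>(x, y). e2 x)"
    and q4: "(\<lambda>x. inverse (q2 x) * (q x - inverse (e2 x) * e12 x)) \<in> L2_space Lam"
    and D: "D \<in> borel_measurable G"
    and int: "integrable Lam (\<lambda>x. inverse (q2 x) * (q x - inverse (e2 x) * e12 x) * D x)"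
  shows "(LINT x|Lam. inverse (q2 x) * (q x - inverse (e2 x) * e12 x) * D x) = 0"
proof -
  let ?Gj = "sigma_proj_joint \<mu>X \<mu>Y B"
  let ?E = "real_cond_exp J ?Gj"
  have sub: "subalgebra J ?Gj" using e2 by (simp add: is_cond_exp_def)
  interpret Gj: finite_measure_subalgebra J ?Gj
    by (intro finite_measure_subalgebra.intro finite_measure_subalgebra_axioms.intro sub) unfold_locales
  have e12G: "e12 \<in> borel_measurable G" and e2G: "e2 \<in> borel_measurable G"
    using e12 e2 by (auto simp: is_cond_exp_def intro: slice_measurable_G)
  have [measurable]: "e12 \<in> borel_measurable \<mu>X" "e2 \<in> borel_measurable \<mu>X" "D \<in> borel_measurable \<mu>X"
    by (rule measurable_G, fact)+
  define w where "w x = inverse (e2 x) * e12 x" for x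
  have wG: "w \<in> borel_measurable G" unfolding w_def using e12G e2G by measurable
  have [measurable]: "w \<in> borel_measurable \<mu>X" by (rule measurable_G[OF wG])
  define q4 where "q4 x = inverse (q2 x) * (q x - w x)" for x
  have [measurable]: "q4 \<in> borel_measurable \<mu>X" unfolding q4_def by measurable
  have q4L: "q4 \<in> L2_space Lam" using q4 by (simp add: q4_def[abs_def] w_def)
  have iq4: "integrable J (\<lambda>z. q4 (fst z))"
    using Lam.L2_space_integrable[OF q4L] by (subst integrable_J_fst_iff) auto
  have iq1: "integrable J (\<lambda>z. q (fst z) * inverse (q2 (fst z)))"
    and iq2: "integrable J (\<lambda>z. inverse (q2 (fst z)))"
    using e12 e2 by (auto simp: is_cond_exp_def split_beta')
  have split: "w (fst z) * inverse (q2 (fst z)) = q (fst z) * inverse (q2 (fst z)) - q4 (fst z)" for z :: "(real^'d) \<times> real"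
    by (simp add: q4_def algebra_simps)
  \<comment> \<open>The product is the difference of two functions known to be integrable, the
    second being the square-integrable weighted residual \<open>q4\<close>; \<open>w\<close> itself
    comes with no bound.\<close>
  have iw: "integrable J (\<lambda>z. w (fst z) * inverse (q2 (fst z)))"
    unfolding split using iq1 iq4 by simp
  have q2J: "AE z in J. 0 < inverse (q2 (fst z))"
    using q2_pos AE_J_fst_iff[of "\<lambda>x. 0 < q2 x"] by simp
  have c1: "AE z in J. ?E (\<lambda>z. q (fst z) * inverse (q2 (fst z))) z = e12 (fst z)"
    and c2: "AE z in J. ?E (\<lambda>z. inverse (q2 (fst z))) z = e2 (fst z)"
    using e12 e2 by (auto simp: is_cond_exp_def split_beta')
  have c3: "AE z in J. ?E (\<lambda>z. w (fst z) * inverse (q2 (fst z))) z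
      = w (fst z) * ?E (\<lambda>z. inverse (q2 (fst z))) z"
    by (rule Gj.real_cond_exp_mult[OF fst_measurable_G_joint[OF wG] _ iw]) measurable
  have c4: "AE z in J. 0 < ?E (\<lambda>z. inverse (q2 (fst z))) z"
    by (rule Gj.real_cond_exp_gr_c[OF iq2 q2J])
  have c5: "AE z in J. ?E (\<lambda>z. q (fst z) * inverse (q2 (fst z)) - w (fst z) * inverse (q2 (fst z))) z
      = ?E (\<lambda>z. q (fst z) * inverse (q2 (fst z))) z - ?E (\<lambda>z. w (fst z) * inverse (q2 (fst z))) z"
    by (rule Gj.real_cond_exp_diff[OF iq1 iw])
  have "q4 (fst z) = q (fst z) * inverse (q2 (fst z)) - w (fst z) * inverse (q2 (fst z))" for z :: "(real^'d) \<times> real"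
    by (simp add: split)
  then have eq: "(\<lambda>z :: (real^'d) \<times> real. q4 (fst z)) = (\<lambda>z. q (fst z) * inverse (q2 (fst z)) - w (fst z) * inverse (q2 (fst z)))"
    by (rule ext)
  have ce0: "AE z in J. ?E (\<lambda>z. q4 (fst z)) z = 0"
    unfolding eq using c1 c2 c3 c4 c5 by eventually_elim (simp add: w_def)
  have i: "integrable J (\<lambda>z. D (fst z) * q4 (fst z))"
    using int by (subst integrable_J_fst_iff[of "\<lambda>x. D x * q4 x"]) (simp_all add: q4_def w_def mult.commute)
  have "(LINT x|Lam. q4 x * D x) = (LINT z|J. D (fst z) * q4 (fst z))"
    by (subst integral_J_fst[of "\<lambda>x. D x * q4 x"]) (simp_all add: mult.commute)
  also have "\<dots> = (LINT z|J. D (fst z) * ?E (\<lambda>z. q4 (fst z)) z)"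
    by (rule Gj.real_cond_exp_intg(2)[symmetric, OF i fst_measurable_G_joint[OF D]]) measurable
  also have "\<dots> = 0"
    by (rule integral_eq_zero_AE) (use ce0 in \<open>auto elim!: eventually_mono\<close>)
  finally show ?thesis by (simp add: q4_def w_def)
qed

end

theorem theorem3:
  fixes \<mu>X :: "(real^'d) measure" and \<mu>Y :: "real measure"
    and \<beta> :: "real^'p \<Rightarrow> real^'s^'d"
    and f :: "real \<Rightarrow> real"
    and lam0 :: "real^'d \<Rightarrow> real"
    and \<eta>0 :: "real^'p \<Rightarrow> real^'d \<Rightarrow> real \<Rightarrow> real"
    and \<phi>0 :: "real^'p \<Rightarrow> (real^'d) \<times> real \<Rightarrow> real"
    and P :: "real^'p \<Rightarrow> ((real^'d) \<times> real) measure"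
    and \<theta>0 :: "real^'p" and U :: "(real^'p) set"
    and score :: "real^'d \<Rightarrow> real \<Rightarrow> real^'p"
    and ef :: "real^'p \<Rightarrow> real^'d \<Rightarrow> real"
    and \<tau> \<tau>c :: "real^'p \<Rightarrow> real^'d \<Rightarrow> real \<Rightarrow> real"
    and e\<tau> :: "real^'p \<Rightarrow> real^'d \<Rightarrow> real"
    and q1 q3 q4 e12 :: "real^'d \<Rightarrow> real^'p"
    and q2 e2 :: "real^'d \<Rightarrow> real"
  \<comment> \<open>sample spaces and parameterization\<close>
  assumes sigma_finite: "sigma_finite_measure \<mu>X" "sigma_finite_measure \<mu>Y"
    and borel_sets: "sets \<mu>X = sets (restrict_space borel (space \<mu>X))"
      "sets \<mu>Y = sets (restrict_space borel (space \<mu>Y))"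
    and dims: "CARD('p) = CARD('s) * (CARD('d) - CARD('s))"
    and param: "smooth_map \<beta>" "\<And>\<theta>. rank (\<beta> \<theta>) = CARD('s)"
  \<comment> \<open>the model and the true density\<close>
    and f_meas: "f \<in> borel_measurable \<mu>Y"
    and lam0: "lam0 \<in> densities \<mu>X"
    and \<eta>0: "\<And>\<theta>. \<eta>0 \<theta> \<in> cond_densities \<mu>X \<mu>Y f (\<beta> \<theta>) lam0"
    and \<phi>0_def: "\<And>\<theta>. \<phi>0 \<theta> = (\<lambda>(x, y). lam0 x * \<eta>0 \<theta> x y)"
    and P_def: "\<And>\<theta>. P \<theta> = joint_law \<mu>X \<mu>Y (\<phi>0 \<theta>)"
    and \<phi>0_pos: "AE z in \<mu>X \<Otimes>\<^sub>M \<mu>Y. 0 < \<phi>0 \<theta>0 z"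
  \<comment> \<open>\<open>ef \<theta> x\<close> is the conditional expectation of \<open>f(Y)\<close> given \<open>\<sigma>\<^sub>\<theta>(X)\<close> at \<open>x\<close>, in the version
      for which the model constraint holds at every \<open>x\<close>\<close>
    and ef: "\<And>\<theta>. is_cond_exp (P \<theta>) (sigma_proj_joint \<mu>X \<mu>Y (\<beta> \<theta>)) (\<lambda>(x, y). f y) (\<lambda>(x, y). ef \<theta> x)"
    and ef_constraint: "\<And>\<theta>. constraint_version \<mu>X \<mu>Y f (\<beta> \<theta>) lam0 (\<eta>0 \<theta>) (ef \<theta>)"
  \<comment> \<open>the true score\<close>
    and score: "has_L2_gradient (P \<theta>0) (\<lambda>\<theta>. root_ratio (\<phi>0 \<theta>0) (\<phi>0 \<theta>)) (\<lambda>(x, y). score x y) \<theta>0"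
  \<comment> \<open>differentiability of the functional and the Riesz representation\<close>
    and U: "open U" "\<theta>0 \<in> U"
    and local_functional_exists: "\<And>x \<theta> r. x \<in> space \<mu>X \<Longrightarrow> \<theta> \<in> U \<Longrightarrow>
          r \<in> L2_space (density \<mu>Y (\<lambda>y. ennreal (\<eta>0 \<theta> x y))) \<Longrightarrow>
          integrable \<mu>Y (\<lambda>y. f y * (1 + r y / 2)\<^sup>2 * \<eta>0 \<theta> x y)"
    and cond1: "\<And>x \<theta>. x \<in> space \<mu>X \<Longrightarrow> \<theta> \<in> U \<Longrightarrow>
          \<exists>D. L2_C1_near_zero (density \<mu>Y (\<lambda>y. ennreal (\<eta>0 \<theta> x y)))
                 (local_functional \<mu>Y f (\<eta>0 \<theta> x)) D \<and>
              is_riesz_rep (density \<mu>Y (\<lambda>y. ennreal (\<eta>0 \<theta> x y))) (D (\<lambda>_. 0)) (\<tau> \<theta> x)"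
    and e\<tau>: "\<And>\<theta>. \<theta> \<in> U \<Longrightarrow>
          is_cond_exp (P \<theta>) (sigma_X \<mu>X \<mu>Y) (\<lambda>(x, y). \<tau> \<theta> x y) (\<lambda>(x, y). e\<tau> \<theta> x)"
    and \<tau>c_def: "\<And>\<theta> x y. \<tau>c \<theta> x y = \<tau> \<theta> x y - e\<tau> \<theta> x"
  \<comment> \<open>differentiability for fixed \<open>x\<close>; the quotient is defined where \<open>lam0 x > 0\<close>, that is, a.e.\<close>
    and cond2: "\<And>x. x \<in> space \<mu>X \<Longrightarrow> 0 < lam0 x \<Longrightarrow>
          has_L2_gradient (density \<mu>Y (\<lambda>y. ennreal (\<eta>0 \<theta>0 x y)))
            (\<lambda>\<theta> y. root_ratio (\<phi>0 \<theta>0) (\<phi>0 \<theta>) (x, y)) (score x) \<theta>0"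
    and q1: "\<And>i. is_cond_exp (P \<theta>0) (sigma_X \<mu>X \<mu>Y)
          (\<lambda>(x, y). score x y $ i * \<tau>c \<theta>0 x y) (\<lambda>(x, y). q1 x $ i)"
    and q2: "is_cond_exp (P \<theta>0) (sigma_X \<mu>X \<mu>Y) (\<lambda>(x, y). (\<tau>c \<theta>0 x y)\<^sup>2) (\<lambda>(x, y). q2 x)"
    and e12: "\<And>i. is_cond_exp (P \<theta>0) (sigma_proj_joint \<mu>X \<mu>Y (\<beta> \<theta>0))
          (\<lambda>(x, y). q1 x $ i * inverse (q2 x)) (\<lambda>(x, y). e12 x $ i)"
    and e2: "is_cond_exp (P \<theta>0) (sigma_proj_joint \<mu>X \<mu>Y (\<beta> \<theta>0))
          (\<lambda>(x, y). inverse (q2 x)) (\<lambda>(x, y). e2 x)"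
    and q3_def: "\<And>x. q3 x = q1 x - e12 x /\<^sub>R e2 x"
    and q4_def: "\<And>x. q4 x = inverse (q2 x) *\<^sub>R q3 x"
    and cond3: "\<And>i. (\<lambda>x. q4 x $ i) \<in> L2_space (density \<mu>X (\<lambda>x. ennreal (lam0 x)))"
  shows "is_efficient_score (\<mu>X \<Otimes>\<^sub>M \<mu>Y) (model \<mu>X \<mu>Y f (\<beta> \<theta>0)) (\<phi>0 \<theta>0)
           (\<lambda>(x, y). score x y) (\<lambda>(x, y). \<tau>c \<theta>0 x y *\<^sub>R q4 x) \<and>
         (AE (x, y) in P \<theta>0. \<tau>c \<theta>0 x y = f y - ef \<theta>0 x) \<and>
         (AE x in density \<mu>X (\<lambda>x. ennreal (lam0 x)).
           ((\<lambda>\<theta>. ef \<theta> x) has_derivative (\<lambda>h. q1 x \<bullet> h)) (at \<theta>0)) \<and>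
         (\<exists>m2. is_cond_exp (P \<theta>0) (sigma_X \<mu>X \<mu>Y) (\<lambda>(x, y). (f y)\<^sup>2) (\<lambda>(x, y). m2 x) \<and>
           (AE (x, y) in P \<theta>0. q2 x = m2 x - (ef \<theta>0 x)\<^sup>2))"
proof -
  have dens: "\<eta>0 \<theta> x \<in> densities \<mu>Y" if "x \<in> space \<mu>X" for \<theta> x
    using \<eta>0[of \<theta>] that by (auto simp: cond_densities_def sq_densities_def)
  interpret JD: joint_density \<mu>X \<mu>Y lam0 "\<eta>0 \<theta>0"
    by (intro joint_density.intro sigma_finite lam0 dens) (use \<eta>0[of \<theta>0] in \<open>simp add: cond_densities_def\<close>)
  have phi: "\<phi>0 \<theta>0 = JD.phi" by (simp add: \<phi>0_def JD.phi_def)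
  have P: "P \<theta>0 = JD.J" by (simp add: P_def joint_law_def JD.J_def phi)
  have Lam: "density \<mu>X (\<lambda>x. ennreal (lam0 x)) = JD.Lam" by (simp add: JD.Lam_def)
  have N: "density \<mu>Y (\<lambda>y. ennreal (\<eta>0 \<theta>0 x y)) = JD.N x" for x by (simp add: JD.N_def)
  have phi_pos: "AE z in \<mu>X \<Otimes>\<^sub>M \<mu>Y. 0 < JD.phi z" using \<phi>0_pos by (simp add: phi)
  have space_AE: "AE x in JD.Lam. x \<in> space \<mu>X" using AE_space[of JD.Lam] by simp
  have pos_AE: "AE x in JD.Lam. 0 < lam0 x \<and> (AE y in \<mu>Y. 0 < \<eta>0 \<theta>0 x y)"
    by (rule JD.AE_Lam_I[OF JD.AE_eta_pos[OF phi_pos]])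

  \<comment> \<open>One x suffices: a bound under \<open>N x\<close> becomes a bound \<mu>Y-almost
    everywhere when \<open>\<eta>0 \<theta>0 x\<close> is positive almost everywhere, and then it
    serves all other x. Such an x exists because \<open>JD.Lam\<close> has mass one.\<close>
  obtain K where K: "0 \<le> K" "AE y in \<mu>Y. \<bar>f y\<bar> \<le> K"
  proof -
    obtain x where x [measurable]: "x \<in> space \<mu>X" and pos: "AE y in \<mu>Y. 0 < \<eta>0 \<theta>0 x y"
      using eventually_happens[OF eventually_conj[OF space_AE pos_AE]] JD.Lam.emeasure_space_1
      by (auto simp: ae_filter_eq_bot_iff)
    interpret Nx: prob_space "JD.N x" by (rule JD.prob_space_N[OF x])
    have "\<exists>K\<ge>0. AE y in JD.N x. \<bar>f y\<bar> \<le> K"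
    proof (rule Nx.AE_bounded_if_integrable_mult_sq)
      fix r assume "r \<in> L2_space (JD.N x)"
      then show "integrable (JD.N x) (\<lambda>y. f y * (r y)\<^sup>2)"
        by (intro JD.integrable_mult_sq_of_perturbation[OF x f_meas])
           (use local_functional_exists[OF x U(2), unfolded N] in auto)
    qed (use f_meas in simp)
    then obtain K where K: "0 \<le> K" "AE y in JD.N x. \<bar>f y\<bar> \<le> K" by blast
    have "AE y in \<mu>Y. 0 < ennreal (\<eta>0 \<theta>0 x y) \<longrightarrow> \<bar>f y\<bar> \<le> K"
      using K(2) unfolding JD.N_def by (subst (asm) AE_density) auto
    with pos have "AE y in \<mu>Y. \<bar>f y\<bar> \<le> K" by eventually_elim simp
    with K(1) show thesis by (rule that)
  qed

  note efc = ef_constraint[unfolded constraint_version_def is_cond_exp_def]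
  interpret C: central_model \<mu>X \<mu>Y lam0 "\<eta>0 \<theta>0" "\<beta> \<theta>0" f "ef \<theta>0" K
    by (intro central_model.intro JD.joint_density_axioms central_model_axioms.intro f_meas K phi_pos)
       (use efc[of \<theta>0] in \<open>simp_all add: Lam\<close>)
  note [measurable] = f_meas

  have fb_J: "AE z in JD.J. C.fb (snd z) = f (snd z)"
  proof (rule JD.AE_J_I)
    show "AE x in JD.Lam. AE y in JD.N x. C.fb (snd (x, y)) = f (snd (x, y))"
      using space_AE by eventually_elim (use JD.AE_N_I[OF _ C.fb_eq] in simp)
  qed measurable

  have \<tau>_N: "AE y in JD.N x. \<tau> \<theta>0 x y = C.fb y" if x: "x \<in> space \<mu>X" for x
    using cond1[OF x U(2), unfolded N] C.AE_eq_riesz_rep[OF x] by blast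
  note e\<tau>0 = e\<tau>[OF U(2), unfolded P sigma_X_def]
  have \<tau>_meas [measurable]: "(\<lambda>z. \<tau> \<theta>0 (fst z) (snd z)) \<in> borel_measurable (\<mu>X \<Otimes>\<^sub>M \<mu>Y)"
    using borel_measurable_integrable[OF JD.is_cond_exp_fstD(1)[OF e\<tau>0]] by (simp add: split_beta')
  have \<tau>_J: "AE z in JD.J. \<tau> \<theta>0 (fst z) (snd z) = C.fb (snd z)"
  proof (rule JD.AE_J_I)
    show "AE x in JD.Lam. AE y in JD.N x. \<tau> \<theta>0 (fst (x, y)) (snd (x, y)) = C.fb (snd (x, y))"
      using space_AE by eventually_elim (simp add: \<tau>_N)
  qed measurable
  have "AE x in JD.Lam. e\<tau> \<theta>0 x = (LINT y|JD.N x. C.fb (snd (x, y)))"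
    by (rule JD.is_cond_exp_fst_AE[OF e\<tau>0, of "\<lambda>z. C.fb (snd z)"]) (use \<tau>_J in \<open>simp_all add: split_beta'\<close>)
  then have e\<tau>_AE: "AE x in JD.Lam. e\<tau> \<theta>0 x = ef \<theta>0 x"
    using space_AE by eventually_elim (simp add: C.m_eq_integral_N)
  have \<tau>c_J: "AE z in JD.J. \<tau>c \<theta>0 (fst z) (snd z) = C.tb z"
  proof -
    have "AE z in JD.J. e\<tau> \<theta>0 (fst z) = ef \<theta>0 (fst z)"
      using e\<tau>_AE by (simp add: JD.AE_J_fst_iff[of "\<lambda>x. e\<tau> \<theta>0 x = ef \<theta>0 x"])
    with \<tau>_J show ?thesis by eventually_elim (simp add: \<tau>c_def C.tb_def)
  qed
  have [measurable]: "e\<tau> \<theta>0 \<in> borel_measurable \<mu>X" by (rule JD.is_cond_exp_fstD(2)[OF e\<tau>0])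
  have [measurable]: "(\<lambda>z. \<tau>c \<theta>0 (fst z) (snd z)) \<in> borel_measurable (\<mu>X \<Otimes>\<^sub>M \<mu>Y)"
    unfolding \<tau>c_def by measurable

  have concl2: "AE (x, y) in P \<theta>0. \<tau>c \<theta>0 x y = f y - ef \<theta>0 x"
    using \<tau>c_J fb_J unfolding P by eventually_elim (simp add: C.tb_def split_beta')

  have sL: "(\<lambda>z. score (fst z) (snd z) $ i) \<in> L2_space JD.J" for i
    using score by (simp add: has_L2_gradient_def P split_beta')
  have s_meas [measurable]: "(\<lambda>z. score (fst z) (snd z) $ i) \<in> borel_measurable (\<mu>X \<Otimes>\<^sub>M \<mu>Y)" for i
    using L2_space_measurable[OF sL] by simp
  have q1_AE: "AE x in JD.Lam. q1 x $ i = (LINT y|JD.N x. score x y $ i * C.tb (x, y))" for i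
  proof -
    have "AE z in JD.J. (case z of (x, y) \<Rightarrow> score x y $ i * \<tau>c \<theta>0 x y) = score (fst z) (snd z) $ i * C.tb z"
      using \<tau>c_J by eventually_elim (simp add: split_beta')
    from JD.is_cond_exp_fst_AE[OF q1[of i, unfolded P sigma_X_def] _ this] show ?thesis by simp
  qed
  have q2_AE: "AE x in JD.Lam. q2 x = C.var x"
  proof -
    have "AE z in JD.J. (case z of (x, y) \<Rightarrow> (\<tau>c \<theta>0 x y)\<^sup>2) = (C.tb z)\<^sup>2"
      using \<tau>c_J by eventually_elim (simp add: split_beta')
    from JD.is_cond_exp_fst_AE[OF q2[unfolded P sigma_X_def] _ this] show ?thesis by (simp add: C.var_def)
  qed
  have q2_meas [measurable]: "q2 \<in> borel_measurable \<mu>X"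
    by (rule JD.is_cond_exp_fstD(2)[OF q2[unfolded P sigma_X_def]])
  have q1_meas [measurable]: "(\<lambda>x. q1 x $ i) \<in> borel_measurable \<mu>X" for i
    by (rule JD.is_cond_exp_fstD(2)[OF q1[of i, unfolded P sigma_X_def]])

  have concl4: "\<exists>m2. is_cond_exp (P \<theta>0) (sigma_X \<mu>X \<mu>Y) (\<lambda>(x, y). (f y)\<^sup>2) (\<lambda>(x, y). m2 x) \<and>
           (AE (x, y) in P \<theta>0. q2 x = m2 x - (ef \<theta>0 x)\<^sup>2)"
  proof (intro exI conjI)
    have "integrable JD.J (\<lambda>z. (f (snd z))\<^sup>2)"
    proof (rule JD.J.integrable_const_bound[of _ "K\<^sup>2"])
      show "AE z in JD.J. norm ((f (snd z))\<^sup>2) \<le> K\<^sup>2"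
        using fb_J
      proof eventually_elim
        case (elim z)
        with C.fb_bound[of "snd z"] power_mono[of "\<bar>f (snd z)\<bar>" K 2] show ?case by simp
      qed
    qed simp
    then have i: "integrable JD.J (\<lambda>(x, y). (f y)\<^sup>2)" by (simp add: split_beta')
    show "is_cond_exp (P \<theta>0) (sigma_X \<mu>X \<mu>Y) (\<lambda>(x, y). (f y)\<^sup>2) (\<lambda>(x, y). \<integral>y'. (f y')\<^sup>2 \<partial>JD.N x)"
      unfolding P sigma_X_def using JD.is_cond_exp_fstI[OF i] by simp
    have "AE x in JD.Lam. q2 x = (\<integral>y'. (f y')\<^sup>2 \<partial>JD.N x) - (ef \<theta>0 x)\<^sup>2"
      using q2_AE space_AE
    proof eventually_elim
      case (elim x)
      have ae: "AE y in JD.N x. C.fb y = f y" by (rule JD.AE_N_I[OF elim(2) C.fb_eq])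
      have "(LINT y|JD.N x. (C.fb y)\<^sup>2) = (LINT y|JD.N x. (f y)\<^sup>2)"
        by (rule integral_cong_AE, measurable, use ae in eventually_elim) simp
      with elim C.var_eq show ?case by simp
    qed
    then show "AE (x, y) in P \<theta>0. q2 x = (\<integral>y'. (f y')\<^sup>2 \<partial>JD.N x) - (ef \<theta>0 x)\<^sup>2"
      unfolding P split_beta' by (subst JD.AE_J_fst_iff)
  qed

  have der: "AE x in JD.Lam. ((\<lambda>\<theta>. ef \<theta> x) has_derivative
        (\<lambda>h. (\<chi> i. LINT y|JD.N x. C.fb y * score x y $ i) \<bullet> h)) (at \<theta>0) \<and> (\<forall>i. (LINT y|JD.N x. score x y $ i) = 0)"
    using pos_AE space_AE
  proof eventually_elim
    case (elim x)
    have grad: "has_L2_gradient (JD.N x)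
        (\<lambda>\<theta> y. root_ratio (\<lambda>y. lam0 x * \<eta>0 \<theta>0 x y) (\<lambda>y. lam0 x * \<eta>0 \<theta> x y) y) (score x) \<theta>0"
      using cond2[OF elim(2)] elim(1) unfolding N \<phi>0_def root_ratio_def by simp
    have "stat_functional \<mu>Y f (\<eta>0 \<theta> x) = ef \<theta> x" for \<theta> using efc[of \<theta>] elim(2) by simp
    with C.mean_has_derivative[OF elim(2) _ _ dens[OF elim(2)] refl grad] elim(1) show ?case by simp
  qed
  have score_slice: "AE x in JD.Lam. \<forall>i. (\<lambda>y. score x y $ i) \<in> L2_space (JD.N x)"
  proof -
    have "AE x in JD.Lam. (\<lambda>y. score x y $ i) \<in> L2_space (JD.N x)" for i
      using C.slice_L2[OF sL[of i]] by simp
    then show ?thesis by (rule eventually_all_finite)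
  qed
  have q1_all: "AE x in JD.Lam. \<forall>i. q1 x $ i = (LINT y|JD.N x. score x y $ i * C.tb (x, y))"
    using q1_AE by (rule eventually_all_finite)
  have concl3: "AE x in density \<mu>X (\<lambda>x. ennreal (lam0 x)).
           ((\<lambda>\<theta>. ef \<theta> x) has_derivative (\<lambda>h. q1 x \<bullet> h)) (at \<theta>0)"
    unfolding Lam using der q1_all score_slice space_AE
  proof eventually_elim
    case (elim x)
    interpret Nx: prob_space "JD.N x" by (rule JD.prob_space_N[OF elim(4)])
    have "q1 x $ i = (LINT y|JD.N x. C.fb y * score x y $ i)" for i
    proof -
      have sx: "(\<lambda>y. score x y $ i) \<in> L2_space (JD.N x)" using elim(3) by simp
      have i1: "integrable (JD.N x) (\<lambda>y. score x y $ i)" by (rule Nx.L2_space_integrable[OF sx])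
      have i2: "integrable (JD.N x) (\<lambda>y. C.fb y * score x y $ i)"
        by (rule integrable_mult_bounded[OF i1, of _ K]) (auto intro!: AE_I2 C.fb_bound)
      \<comment> \<open>The score has conditional mean zero, so centering f at
        \<open>ef \<theta>0 x\<close> does not change its conditional covariance with the
        score.\<close>
      have "q1 x $ i = (LINT y|JD.N x. C.fb y * score x y $ i - ef \<theta>0 x * score x y $ i)"
        using elim(2) by (simp add: C.tb_def algebra_simps)
      also have "\<dots> = (LINT y|JD.N x. C.fb y * score x y $ i)"
        using i1 i2 elim(1) by simp
      finally show ?thesis .
    qed
    then have "q1 x = (\<chi> i. LINT y|JD.N x. C.fb y * score x y $ i)" by (simp add: vec_eq_iff)
    with elim(1) show ?case by simp
  qed

  have e2_int: "integrable JD.J (\<lambda>z. inverse (q2 (fst z)))"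
    using e2 by (simp add: is_cond_exp_def P split_beta')
  have "integrable JD.Lam (\<lambda>x. inverse (q2 x))"
    using e2_int by (subst (asm) JD.integrable_J_fst_iff) auto
  then have inv_var: "integrable JD.Lam (\<lambda>x. inverse (C.var x))"
    by (rule integrable_cong_AE_imp, measurable, use q2_AE in eventually_elim) simp
  interpret V: central_model_inverse_var \<mu>X \<mu>Y lam0 "\<eta>0 \<theta>0" "\<beta> \<theta>0" f "ef \<theta>0" K
    by (intro central_model_inverse_var.intro C.central_model_axioms central_model_inverse_var_axioms.intro inv_var)

  have eff: "is_L2_projection JD.J (L2_orth_compl JD.J (tangent_space (\<mu>X \<Otimes>\<^sub>M \<mu>Y) (model \<mu>X \<mu>Y f (\<beta> \<theta>0)) JD.phi))
      (\<lambda>z. score (fst z) (snd z) $ i) (\<lambda>z. \<tau>c \<theta>0 (fst z) (snd z) * q4 (fst z) $ i)" for i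
  proof -
    let ?T = "tangent_space (\<mu>X \<Otimes>\<^sub>M \<mu>Y) (model \<mu>X \<mu>Y f (\<beta> \<theta>0)) JD.phi"
    let ?c = "curve_tangents (\<mu>X \<Otimes>\<^sub>M \<mu>Y) (model \<mu>X \<mu>Y f (\<beta> \<theta>0)) JD.phi"
    define q4i where "q4i x = q4 x $ i" for x
    have q4L: "q4i \<in> L2_space JD.Lam" using cond3[of i] by (simp add: q4i_def[abs_def] Lam)
    have [measurable]: "q4i \<in> borel_measurable \<mu>X" using L2_space_measurable[OF q4L] by simp
    define w where "w x = inverse (e2 x) * e12 x $ i" for x
    have q4_eq: "q4i x = inverse (q2 x) * (q1 x $ i - w x)" for x
      by (simp add: q4i_def q4_def q3_def w_def)
    have wG: "w \<in> borel_measurable C.G"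
    proof -
      have "(\<lambda>x. e12 x $ i) \<in> borel_measurable C.G" "e2 \<in> borel_measurable C.G"
        using e12[of i] e2 by (auto simp: is_cond_exp_def intro: C.slice_measurable_G)
      then show ?thesis unfolding w_def by measurable
    qed
    define S where "S z = q4i (fst z) * C.tb z" for z
    have S_orth: "S \<in> L2_orth_compl JD.J ?T"
      unfolding S_def
    proof (rule C.orth_tangent_space[OF q4L])
      fix D assume D: "D \<in> borel_measurable C.G" and iD: "integrable JD.Lam (\<lambda>x. q4i x * D x)"
      from C.var_dichotomy show "(LINT x|JD.Lam. q4i x * D x) = 0"
      proof
        \<comment> \<open>In this degenerate case \<open>inverse 0 = 0\<close> makes
          \<open>q4i\<close> vanish almost everywhere, so the claimed efficient score is
          zero.\<close>
        assume var0: "\<forall>x\<in>space \<mu>X. C.var x = 0"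
        have "AE x in JD.Lam. q4i x * D x = 0"
          using q2_AE space_AE by eventually_elim (use var0 in \<open>simp add: q4_eq\<close>)
        then show ?thesis by (rule integral_eq_zero_AE)
      next
        assume "AE x in JD.Lam. C.var x \<noteq> 0"
        with q2_AE have pos: "AE x in JD.Lam. 0 < q2 x"
          by eventually_elim (use C.var_nonneg in \<open>auto simp: less_le\<close>)
        show ?thesis
          using C.weighted_residual_orth_sigma[OF q1_meas q2_meas pos e12[of i, unfolded P] e2[unfolded P] _ D] q4L iD
          by (simp add: q4_eq[abs_def] w_def)
      qed
    qed
    have SL: "S \<in> L2_space JD.J" using S_orth by (simp add: L2_orth_compl_def)
    have S_eq: "AE z in JD.J. S z = \<tau>c \<theta>0 (fst z) (snd z) * q4 (fst z) $ i"
      using \<tau>c_J by eventually_elim (simp add: S_def q4i_def)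
    have S_meas: "(\<lambda>z. \<tau>c \<theta>0 (fst z) (snd z) * q4 (fst z) $ i) \<in> borel_measurable JD.J"
    proof -
      have "(\<lambda>z. \<tau>c \<theta>0 (fst z) (snd z) * q4i (fst z)) \<in> borel_measurable JD.J" by measurable
      then show ?thesis by (simp add: q4i_def)
    qed
    have T_L2: "?T \<subseteq> L2_space JD.J"
      by (auto simp: tangent_space_def JD.J_def L2_closure_def)
    have c_T: "?c \<subseteq> ?T"
      unfolding tangent_space_def JD.J_def[symmetric]
      by (rule subset_L2_closure_hull) (auto simp: C.curve_tangents_J)
    \<comment> \<open>The projection property asks that this residual be orthogonal to everything in
      the orthogonal complement. It is conditionally centered, and where the variance is positive
      its covariance with \<open>tb\<close> is \<open>q1 - q4 * var = w\<close>, a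
      \<open>G\<close>-measurable function.\<close>
    define W where "W z = score (fst z) (snd z) $ i - S z" for z
    have WL: "W \<in> L2_space JD.J" unfolding W_def by (rule L2_space_diff[OF sL SL])
    have W_means: "AE x in JD.Lam. C.mean0 W x = 0 \<and> inverse (C.var x) * C.mean1 W x = inverse (C.var x) * w x"
      using der q1_AE[of i] q2_AE score_slice space_AE
    proof eventually_elim
      case (elim x)
      interpret Nx: prob_space "JD.N x" by (rule JD.prob_space_N[OF elim(5)])
      have sx: "(\<lambda>y. score x y $ i) \<in> L2_space (JD.N x)" using elim(4) by simp
      note tx = C.tb_slice_L2[OF elim(5)]
      note i = Nx.L2_space_integrable[OF sx] Nx.L2_space_integrable[OF tx]
        L2_space_integrable_mult[OF sx tx] L2_space_integrable_sq[OF tx]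
      have "C.mean0 W x = (LINT y|JD.N x. score x y $ i - q4i x * C.tb (x, y))"
        by (simp add: C.mean0_def W_def S_def)
      also have "\<dots> = 0" using i elim(1) C.integral_tb_N[OF elim(5)] by simp
      finally have 0: "C.mean0 W x = 0" .
      have "C.mean1 W x = (LINT y|JD.N x. score x y $ i * C.tb (x, y) - q4i x * (C.tb (x, y))\<^sup>2)"
        by (simp add: C.mean1_def W_def S_def power2_eq_square algebra_simps)
      also have "\<dots> = q1 x $ i - q4i x * C.var x"
        using i elim(2) by (simp add: C.var_def)
      finally have "C.mean1 W x = q1 x $ i - q4i x * C.var x" .
      then have "inverse (C.var x) * C.mean1 W x = inverse (C.var x) * w x"
        using elim(3) by (cases "C.var x = 0") (simp_all add: q4_eq field_simps)
      with 0 show ?case ..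
    qed
    have W_orth: "L2_inner JD.J W h = 0" if h: "h \<in> L2_orth_compl JD.J ?T" for h
    proof (rule V.orth_tangents_inner_eq_0[OF _ _ WL _ wG])
      show "h \<in> L2_space JD.J" using h by (simp add: L2_orth_compl_def)
      show "L2_inner JD.J h v = 0" if "v \<in> ?c" for v
        using h c_T that by (auto simp: L2_orth_compl_def)
    qed (use W_means in \<open>auto elim!: eventually_mono\<close>)
    show ?thesis
      unfolding is_L2_projection_def
    proof (intro conjI ballI sL)
      show "(\<lambda>z. \<tau>c \<theta>0 (fst z) (snd z) * q4 (fst z) $ i) \<in> L2_orth_compl JD.J ?T"
        by (rule L2_orth_compl_cong_AE[OF S_orth T_L2 S_meas S_eq])
      fix h assume h: "h \<in> L2_orth_compl JD.J ?T"
      have [measurable]: "h \<in> borel_measurable JD.J" using h by (auto simp: L2_orth_compl_def L2_space_def)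
      have [measurable]: "S \<in> borel_measurable JD.J" by (rule L2_space_measurable[OF SL])
      have "L2_inner JD.J (\<lambda>z. score (fst z) (snd z) $ i - \<tau>c \<theta>0 (fst z) (snd z) * q4 (fst z) $ i) h
          = L2_inner JD.J W h"
        unfolding L2_inner_def
      proof (rule integral_cong_AE)
        show "AE z in JD.J. (score (fst z) (snd z) $ i - \<tau>c \<theta>0 (fst z) (snd z) * q4 (fst z) $ i) * h z = W z * h z"
          using S_eq by eventually_elim (simp add: W_def)
        show "(\<lambda>z. (score (fst z) (snd z) $ i - \<tau>c \<theta>0 (fst z) (snd z) * q4 (fst z) $ i) * h z) \<in> borel_measurable JD.J"
          by (intro borel_measurable_times borel_measurable_diff S_meas L2_space_measurable[OF sL]) simp
      qed (use L2_space_measurable[OF WL] in simp)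
      with W_orth[OF h] show "L2_inner JD.J (\<lambda>z. score (fst z) (snd z) $ i - \<tau>c \<theta>0 (fst z) (snd z) * q4 (fst z) $ i) h = 0"
        by simp
    qed
  qed
  have concl1: "is_efficient_score (\<mu>X \<Otimes>\<^sub>M \<mu>Y) (model \<mu>X \<mu>Y f (\<beta> \<theta>0)) (\<phi>0 \<theta>0)
           (\<lambda>(x, y). score x y) (\<lambda>(x, y). \<tau>c \<theta>0 x y *\<^sub>R q4 x)"
    unfolding is_efficient_score_def Let_def phi JD.J_def[symmetric]
    using eff by (simp add: split_beta')
  from concl1 concl2 concl3 concl4 show ?thesis by blast
qed

end
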